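(* Let $n$ be a positive odd integer. For generic $x,y\in\mathbb{C}^*$, \[ f_{n,n+2,n}(x,y,q)=g_{n,n+2,n}(x,y,q,y^n/x^n,x^n/y^n)-\Theta_{n,2}(x,y,q), \] where \[ \Theta_{n,2}(x,y,q):=\frac{y^{\frac{n+1}{2}}J_{2n,4n}J_{4(n+1),8(n+1)}\,j(y/x;q^{4(n+1)})\,j(q^{n+2}xy;q^{4(n+1)})\,j(q^{2n}/(x^2y^2);q^{8(n+1)})}{q^{\frac{n^2-3}{2}}x^{\frac{n-3}{2}}\,j(y^n/x^n;q^{4n(n+1)})\,j(-q^{n+2}x^2;q^{4(n+1)})\,j(-q^{n+2}y^2;q^{4(n+1)})}. \]
   Context: Let $q\in\mathbb{C}$ with $0<|q|<1$. $j(x;q):=(x;q)_\infty(q/x;q)_\infty(q;q)_\infty=\sum_{n\in\mathbb{Z}}(-1)^nq^{\binom n2}x^n$; $J_{a,m}:=j(q^a;q^m)$. $m(x,q,z):=\frac{1}{j(z;q)}\sum_{r\in\mathbb{Z}}\frac{(-1)^rq^{\binom r2}z^r}{1-q^{r-1}xz}$. With $\mathrm{sg}(r)=1$ for $r\ge0$, $-1$ for $r<0$: $f_{a,b,c}(x,y,q):=\sum_{\mathrm{sg}(r)=\mathrm{sg}(s)}\mathrm{sg}(r)(-1)^{r+s}x^ry^sq^{a\binom r2+brs+c\binom s2}$ and \begin{align*} g_{a,b,c}(x,y,q,z_1,z_0):=&\sum_{t=0}^{a-1}(-y)^tq^{c\binom t2}j(q^{bt}x;q^a)\,m\Big(-q^{a\binom{b+1}{2}-c\binom{a+1}{2}-t(b^2-ac)}\frac{(-y)^a}{(-x)^b},q^{a(b^2-ac)},z_0\Big)\\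 &+\sum_{t=0}^{c-1}(-x)^tq^{a\binom t2}j(q^{bt}y;q^c)\,m\Big(-q^{c\binom{b+1}{2}-a\binom{c+1}{2}-t(b^2-ac)}\frac{(-x)^c}{(-y)^b},q^{c(b^2-ac)},z_1\Big). \end{align*} "Generic" means no poles occur in the Appell–Lerch sums or theta quotients. *)

theory Defs
  imports "HOL-Analysis.Analysis"
begin

definition choose2 :: "int \<Rightarrow> int" where
  "choose2 r = r * (r - 1) div 2"

definition qpoch_inf :: "complex \<Rightarrow> complex \<Rightarrow> complex" where
  "qpoch_inf x q = (\<Prod>k. 1 - x * q ^ k)"

definition jtheta :: "complex \<Rightarrow> complex \<Rightarrow> complex" where
  "jtheta x q = qpoch_inf x q * qpoch_inf (q / x) q * qpoch_inf q q"

definition Jtheta :: "int \<Rightarrow> int \<Rightarrow> complex \<Rightarrow> complex" where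
  "Jtheta a m q = jtheta (q powi a) (q powi m)"

definition appell_m :: "complex \<Rightarrow> complex \<Rightarrow> complex \<Rightarrow> complex" where
  "appell_m x q z = 1 / jtheta z q *
     (\<Sum>\<^sub>\<infinity>r::int. (-1) powi r * q powi (choose2 r) * z powi r / (1 - q powi (r - 1) * x * z))"

definition appell_m_no_pole :: "complex \<Rightarrow> complex \<Rightarrow> complex \<Rightarrow> bool" where
  "appell_m_no_pole x q z \<longleftrightarrow>
     jtheta z q \<noteq> 0 \<and> (\<forall>r::int. 1 - q powi (r - 1) * x * z \<noteq> 0)"

(* Not the library's sgn: sg 0 = 1. *)
definition sg :: "int \<Rightarrow> int" where
  "sg r = (if r \<ge> 0 then 1 else -1)"

definition hecke_f :: "int \<Rightarrow> int \<Rightarrow> int \<Rightarrow> complex \<Rightarrow> complex \<Rightarrow> complex \<Rightarrow> complex" where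
  "hecke_f a b c x y q =
     (\<Sum>\<^sub>\<infinity>(r, s)\<in>{(r, s). sg r = sg s}.
        of_int (sg r) * (-1) powi (r + s) * x powi r * y powi s *
        q powi (a * choose2 r + b * r * s + c * choose2 s))"

(* The first argument of m in the t-th term of the first sum of g_{a,b,c}(x,y,q,z1,z0). The second
   sum arises from the first by exchanging a with c, x with y, and z0 with z1. *)
definition g_arg :: "int \<Rightarrow> int \<Rightarrow> int \<Rightarrow> complex \<Rightarrow> complex \<Rightarrow> complex \<Rightarrow> int \<Rightarrow> complex" where
  "g_arg a b c x y q t =
     - (q powi (a * choose2 (b + 1) - c * choose2 (a + 1) - t * (b\<^sup>2 - a * c))) *
     ((- y) powi a / (- x) powi b)"

definition appell_g ::
  "int \<Rightarrow> int \<Rightarrow> int \<Rightarrow> complex \<Rightarrow> complex \<Rightarrow> complex \<Rightarrow> complex \<Rightarrow> complex \<Rightarrow> complex" where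
  "appell_g a b c x y q z1 z0 =
     (\<Sum>t = 0..a - 1. (- y) powi t * q powi (c * choose2 t) *
        jtheta (q powi (b * t) * x) (q powi a) *
        appell_m (g_arg a b c x y q t) (q powi (a * (b\<^sup>2 - a * c))) z0) +
     (\<Sum>t = 0..c - 1. (- x) powi t * q powi (a * choose2 t) *
        jtheta (q powi (b * t) * y) (q powi c) *
        appell_m (g_arg c b a y x q t) (q powi (c * (b\<^sup>2 - a * c))) z1)"

definition appell_g_no_pole ::
  "int \<Rightarrow> int \<Rightarrow> int \<Rightarrow> complex \<Rightarrow> complex \<Rightarrow> complex \<Rightarrow> complex \<Rightarrow> complex \<Rightarrow> bool" where
  "appell_g_no_pole a b c x y q z1 z0 \<longleftrightarrow>
     (\<forall>t\<in>{0..a - 1}. appell_m_no_pole (g_arg a b c x y q t) (q powi (a * (b\<^sup>2 - a * c))) z0) \<and>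
     (\<forall>t\<in>{0..c - 1}. appell_m_no_pole (g_arg c b a y x q t) (q powi (c * (b\<^sup>2 - a * c))) z1)"

(* For odd n the divisions by 2 in the exponents are exact. *)
definition Theta_n2 :: "int \<Rightarrow> complex \<Rightarrow> complex \<Rightarrow> complex \<Rightarrow> complex" where
  "Theta_n2 n x y q =
     (y powi ((n + 1) div 2) * Jtheta (2 * n) (4 * n) q * Jtheta (4 * (n + 1)) (8 * (n + 1)) q *
      jtheta (y / x) (q powi (4 * (n + 1))) *
      jtheta (q powi (n + 2) * x * y) (q powi (4 * (n + 1))) *
      jtheta (q powi (2 * n) / (x\<^sup>2 * y\<^sup>2)) (q powi (8 * (n + 1)))) /
     (q powi ((n\<^sup>2 - 3) div 2) * x powi ((n - 3) div 2) *
      jtheta (y powi n / x powi n) (q powi (4 * n * (n + 1))) *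
      jtheta (- (q powi (n + 2)) * x\<^sup>2) (q powi (4 * (n + 1))) *
      jtheta (- (q powi (n + 2)) * y\<^sup>2) (q powi (4 * (n + 1))))"

definition Theta_n2_no_pole :: "int \<Rightarrow> complex \<Rightarrow> complex \<Rightarrow> complex \<Rightarrow> bool" where
  "Theta_n2_no_pole n x y q \<longleftrightarrow>
     jtheta (y powi n / x powi n) (q powi (4 * n * (n + 1))) \<noteq> 0 \<and>
     jtheta (- (q powi (n + 2)) * x\<^sup>2) (q powi (4 * (n + 1))) \<noteq> 0 \<and>
     jtheta (- (q powi (n + 2)) * y\<^sup>2) (q powi (4 * (n + 1))) \<noteq> 0"

end

theory Submission
  imports Defs "HOL-Complex_Analysis.Complex_Analysis"
begin

text \<open>
  Put \<open>p = q\<^bsup>2n+2\<^esup>\<close>, fix the ratio \<open>w = y / x\<close> and let \<open>D(x)\<close> be the difference of the two sides. The double sum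
  and \<open>g\<close> satisfy the same inhomogeneous equation relating \<open>(x, y)\<close> to \<open>(p x, p y)\<close>, so \<open>D\<close> is
  quasi-periodic: \<open>D(x) = q\<^bsup>n+2\<^esup> w x\<^sup>2 D(p x)\<close>. With \<open>w\<close> fixed, the only poles of \<open>D\<close> come from single terms of
  the Appell-Lerch sums and lie at \<open>x\<^sup>2, y\<^sup>2 \<in> - q\<^bsup>3n+2\<^esup> p\<^bsup>2\<int>\<^esup>\<close>, where the theta quotient cancels the residue.
  Reflection symmetries make \<open>D\<close> vanish when \<open>x y = q\<^bsup>3n+2\<^esup>\<close>. Hence \<open>S(x) = x\<^sup>2 D(x) / j(x y / q\<^bsup>3n+2\<^esup>; p\<^sup>2)\<close>
  extends holomorphically to the punctured plane and satisfies \<open>S(p x) = - S(x)\<close>. Such a function is bounded,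
  so by Liouville's theorem it is constant, and therefore 0. The remaining values of \<open>w\<close>, for which poles collide,
  follow by continuity.
\<close>

section \<open>The Jacobi triple product\<close>

text \<open>The parameters (x/y)^n and (y/x)^n shape the proof. They do not change under (x, y) ->
  (p x, p y). The Lambert denominators see only the product of the first argument of m with its z,
  and here it collapses to -q^e / x^2 in one half of g and to -q^e / y^2 in the other. So the
  denominators of each half involve one variable, and all their zeros lie on a single progression.
  Powers of p move every pole to the index r = 1 of the middle term t = l, where n = 2 l + 1.

  The contradiction behind the last step is a sign. A nonzero holomorphic function with the
  multiplier of D has two zeros modulo powers of p, whose product is q^(3n+2) / w up to such powers.
  The reflection supplies the zeros k and -k with k^2 = q^(3n+2) / w, whose product is -k^2, and -1
  is not a power of p. The multiplier -1 of S records this mismatch: a constant d with d = -d is 0.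
  The factor x^2 in S turns the multiplier -1 / p^2 of the plain quotient into -1.

  The excluded ratios with w^2 a power of p^2 are those for which the pole lattices in x and in y
  coincide.\<close>

lemma two_choose2: "2 * choose2 r = r * (r - 1)"
  unfolding choose2_def by simp

lemma choose2_add: "choose2 (a + b) = choose2 a + choose2 b + a * b"
  using two_choose2[of "a + b"] two_choose2[of a] two_choose2[of b] by (simp add: algebra_simps)

lemma choose2_minus: "choose2 (- r) = choose2 r + r"
  using two_choose2[of "- r"] two_choose2[of r] by (simp add: algebra_simps)

lemma choose2_simps [simp]: "choose2 0 = 0" "choose2 1 = 0"
  by (simp_all add: choose2_def)

text \<open>Consecutive terms have ratio \<open>\<rho> ^ k * R\<close>, which tends to 0: the
  quadratic exponent beats any geometric growth.\<close>

lemma summable_gauss_nat: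
  fixes \<rho> R :: real
  assumes "0 < \<rho>" "\<rho> < 1" "R > 0"
  shows "summable (\<lambda>k::nat. \<rho> powi choose2 (int k) * R ^ k)"
proof -
  have lim: "(\<lambda>k. \<rho> ^ k * R) \<longlonglongrightarrow> 0 * R"
    by (intro tendsto_mult LIMSEQ_power_zero tendsto_const) (use assms in auto)
  hence "eventually (\<lambda>k. \<rho> ^ k * R < 1/2) sequentially"
    by (intro order_tendstoD) auto
  then obtain N where N: "\<And>k. k \<ge> N \<Longrightarrow> \<rho> ^ k * R < 1/2"
    by (auto simp: eventually_sequentially)
  show ?thesis
  proof (rule summable_ratio_test[where c = "1/2" and N = N])
    fix k assume "k \<ge> N"
    have "\<rho> powi choose2 (int (Suc k)) = \<rho> powi choose2 (int k) * \<rho> ^ k"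
      using assms choose2_add[of "int k" 1] by (simp add: power_int_add add.commute)
    hence "norm (\<rho> powi choose2 (int (Suc k)) * R ^ Suc k) =
          norm (\<rho> powi choose2 (int k) * R ^ k) * (\<rho> ^ k * R)"
      using assms by (simp add: abs_mult)
    also have "\<dots> \<le> norm (\<rho> powi choose2 (int k) * R ^ k) * (1/2)"
      by (intro mult_left_mono) (use N[OF \<open>k \<ge> N\<close>] in auto)
    finally show "norm (\<rho> powi choose2 (int (Suc k)) * R ^ Suc k) \<le>
          1/2 * norm (\<rho> powi choose2 (int k) * R ^ k)" by simp
  qed auto
qed

lemma summable_on_int_splitI:
  fixes f :: "int \<Rightarrow> 'a::banach"
  assumes "summable (\<lambda>k::nat. norm (f (int k)))" "summable (\<lambda>k::nat. norm (f (- int k)))"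
  shows "f summable_on UNIV"
proof -
  have "(f \<circ> int) summable_on UNIV"
    unfolding o_def using assms(1) by (rule norm_summable_imp_summable_on)
  hence 1: "f summable_on range int"
    by (subst summable_on_reindex) auto
  have "(f \<circ> (\<lambda>k. - int k)) summable_on UNIV"
    unfolding o_def using assms(2) by (rule norm_summable_imp_summable_on)
  hence 2: "f summable_on range (\<lambda>k. - int k)"
    by (subst summable_on_reindex) (auto simp: inj_on_def)
  \<comment> \<open>Zero lies in both ranges, so only the part of the second range outside the first
    is adjoined.\<close>
  have U: "range int \<union> (range (\<lambda>k. - int k) - range int) = UNIV"
    by (auto simp: image_iff) (metis int_cases2)
  show ?thesis
    using summable_on_Un_disjoint[OF 1 summable_on_subset_banach[OF 2, of "range (\<lambda>k. - int k) - range int"]]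
    unfolding U by auto
qed

text \<open>By \<open>choose2_minus\<close>, the negative half is again a sum over the naturals,
  with \<open>R\<close> replaced by \<open>\<rho> / R\<close>.\<close>

lemma summable_gauss:
  fixes \<rho> R :: real
  assumes "0 < \<rho>" "\<rho> < 1" "R > 0"
  shows "(\<lambda>r::int. \<rho> powi choose2 r * R powi r) summable_on UNIV"
proof (rule summable_on_int_splitI)
  have "summable (\<lambda>k::nat. \<rho> powi choose2 (int k) * R ^ k)"
    using assms by (rule summable_gauss_nat)
  thus "summable (\<lambda>k::nat. norm (\<rho> powi choose2 (int k) * R powi int k))"
    using assms by simp
  have "summable (\<lambda>k::nat. \<rho> powi choose2 (int k) * (\<rho> / R) ^ k)"
    using assms by (intro summable_gauss_nat) auto
  moreover have "norm (\<rho> powi choose2 (- int k) * R powi (- int k)) =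
       \<rho> powi choose2 (int k) * (\<rho> / R) ^ k" for k
    using assms by (simp add: choose2_minus power_int_add power_int_minus field_simps)
  ultimately show "summable (\<lambda>k::nat. norm (\<rho> powi choose2 (- int k) * R powi (- int k)))"
    by simp
qed

section \<open>Infinite q-products\<close>

lemma convergent_qpoch:
  fixes x q :: complex
  assumes "norm q < 1"
  shows "convergent_prod (\<lambda>k. 1 - x * q ^ k)"
proof (rule abs_convergent_prod_imp_convergent_prod)
  have "summable (\<lambda>k. norm x * norm q ^ k)"
    by (intro summable_mult summable_geometric) (use assms in auto)
  thus "abs_convergent_prod (\<lambda>k. 1 - x * q ^ k)"
    by (simp add: abs_convergent_prod_conv_summable norm_mult norm_power)
qed

lemma qpoch_inf_split:
  assumes "norm q < 1"
  shows "qpoch_inf x q = (1 - x) * qpoch_inf (x * q) q"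
proof -
  have c: "convergent_prod (\<lambda>k. 1 - x * q * q ^ k)"
    by (rule convergent_qpoch[OF assms])
  hence "(\<lambda>k. 1 - x * q ^ Suc k) has_prod qpoch_inf (x * q) q"
    unfolding qpoch_inf_def by (simp add: convergent_prod_has_prod mult.assoc)
  hence "(\<lambda>k. 1 - x * q ^ k) has_prod (qpoch_inf (x * q) q * (1 - x * q ^ 0))"
    by (rule has_prod_Suc_imp)
  from has_prod_unique[OF this] show ?thesis
    by (simp add: qpoch_inf_def mult.commute)
qed

lemma qpoch_inf_LIMSEQ:
  assumes "norm q < 1"
  shows "(\<lambda>N. \<Prod>k<N. 1 - x * q ^ k) \<longlonglongrightarrow> qpoch_inf x q"
  using convergent_prod_LIMSEQ[OF convergent_qpoch[OF assms, of x]]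
  unfolding qpoch_inf_def by (simp add: LIMSEQ_lessThan_iff_atMost)

lemma qpoch_inf_eq_0_iff:
  assumes "norm q < 1"
  shows "qpoch_inf x q = 0 \<longleftrightarrow> (\<exists>k. x * q ^ k = 1)"
proof -
  have "(\<lambda>k. 1 - x * q ^ k) has_prod qpoch_inf x q"
    unfolding qpoch_inf_def by (rule convergent_prod_has_prod[OF convergent_qpoch[OF assms]])
  from has_prod_eq_0_iff[OF this] show ?thesis by auto
qed

lemma qpoch_inf_self_nonzero:
  assumes "norm q < 1"
  shows "qpoch_inf q q \<noteq> 0"
proof
  assume "qpoch_inf q q = 0"
  then obtain k where "q ^ Suc k = 1"
    using qpoch_inf_eq_0_iff[OF assms] by auto
  hence "norm q ^ Suc k = 1" by (metis norm_one norm_power)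
  moreover have "norm q ^ Suc k < 1"
    using assms by (intro power_less_one_iff[THEN iffD2]) auto
  ultimately show False by simp
qed

lemma qpoch_inf_mult_minus:
  assumes "norm q < 1"
  shows "qpoch_inf x q * qpoch_inf (- x) q = qpoch_inf (x\<^sup>2) (q\<^sup>2)"
  unfolding qpoch_inf_def
  by (subst prodinf_mult[OF convergent_qpoch[OF assms] convergent_qpoch[OF assms]])
     (simp add: algebra_simps power2_eq_square power_mult_distrib)

text \<open>The factors are sorted by the parity of the exponent. This is exact for partial products
  of lengths N, N and 2N, so the limits agree.\<close>

lemma qpoch_inf_bisect:
  assumes "norm q < 1"
  shows "qpoch_inf x (q\<^sup>2) * qpoch_inf (x * q) (q\<^sup>2) = qpoch_inf x q"
proof -
  have q2: "norm (q\<^sup>2) < 1"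
    using assms by (simp add: norm_power power_less_one_iff)
  have "(\<lambda>N. (\<Prod>k<N. 1 - x * (q\<^sup>2) ^ k) * (\<Prod>k<N. 1 - x * q * (q\<^sup>2) ^ k)) \<longlonglongrightarrow>
        qpoch_inf x (q\<^sup>2) * qpoch_inf (x * q) (q\<^sup>2)"
    by (intro tendsto_mult qpoch_inf_LIMSEQ q2)
  moreover have "(\<Prod>k<N. 1 - x * (q\<^sup>2) ^ k) * (\<Prod>k<N. 1 - x * q * (q\<^sup>2) ^ k) =
       (\<Prod>k<2*N. 1 - x * q ^ k)" for N
    by (induction N) (auto simp: power_mult[symmetric] mult_ac)
  moreover have "(\<lambda>N. \<Prod>k<2*N. 1 - x * q ^ k) \<longlonglongrightarrow> qpoch_inf x q"
    using LIMSEQ_subseq_LIMSEQ[OF qpoch_inf_LIMSEQ[OF assms, of x], of "\<lambda>N. 2 * N"]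
    by (simp add: o_def strict_mono_def)
  ultimately show ?thesis using LIMSEQ_unique by fastforce
qed

text \<open>Serves the single factors in \<open>tendsto_jtheta_div\<close>; holomorphy of the full
  theta function is taken from its series.\<close>

lemma continuous_qpoch_inf:
  assumes "norm q < 1"
  shows "isCont (\<lambda>x. qpoch_inf x q) x"
proof -
  let ?A = "cball (0::complex) (norm x + 1)"
  have "uniformly_convergent_on ?A (\<lambda>N x. \<Prod>k<N. 1 - x * q ^ k)"
  proof (rule uniformly_convergent_on_prod')
    show "uniformly_convergent_on ?A (\<lambda>N x. \<Sum>k<N. norm (1 - x * q ^ k - 1))"
    proof (rule Weierstrass_m_test'_ev)
      show "\<forall>\<^sub>F k in sequentially. \<forall>z\<in>?A. norm (norm (1 - z * q ^ k - 1)) \<le> (norm x + 1) * norm q ^ k"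
        by (intro always_eventually) (auto simp: norm_mult norm_power intro!: mult_right_mono)
      show "summable (\<lambda>k. (norm x + 1) * norm q ^ k)"
        by (intro summable_mult summable_geometric) (use assms in auto)
    qed
  qed (auto intro!: continuous_intros)
  then obtain l where l: "uniform_limit ?A (\<lambda>N x. \<Prod>k<N. 1 - x * q ^ k) l sequentially"
    unfolding uniformly_convergent_on_def by blast
  have "continuous_on ?A l"
    by (rule uniform_limit_theorem[OF _ l]) (auto intro!: always_eventually continuous_intros)
  moreover have "l z = qpoch_inf z q" if "z \<in> ?A" for z
    using LIMSEQ_unique[OF tendsto_uniform_limitI[OF l that] qpoch_inf_LIMSEQ[OF assms]] .
  ultimately have "continuous_on ?A (\<lambda>x. qpoch_inf x q)"
    using continuous_on_cong[of ?A ?A l "\<lambda>x. qpoch_inf x q"] by blast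
  thus ?thesis
    by (rule continuous_on_interior) auto
qed

section \<open>Theta series and the finite triple product\<close>

definition theta_term :: "complex \<Rightarrow> complex \<Rightarrow> int \<Rightarrow> complex" where
  "theta_term q x r = (-1) powi r * q powi choose2 r * x powi r"

lemma norm_theta_term:
  "norm (theta_term q x r) = norm q powi choose2 r * norm x powi r"
  by (simp add: theta_term_def norm_mult norm_power_int)

lemma theta_term_abs_summable:
  assumes "0 < norm q" "norm q < 1" "x \<noteq> 0"
  shows "(\<lambda>r. norm (theta_term q x r)) summable_on UNIV"
  unfolding norm_theta_term using assms by (intro summable_gauss) auto

lemma theta_term_summable:
  assumes "0 < norm q" "norm q < 1" "x \<noteq> 0"
  shows "theta_term q x summable_on UNIV"
  using theta_term_abs_summable[OF assms] by (rule abs_summable_summable)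

lemma bij_betw_int_shift: "bij_betw (\<lambda>r::int. r + k) UNIV UNIV"
  by (rule bij_betwI[where g = "\<lambda>r. r - k"]) auto

lemma has_sum_int_shift:
  assumes "(f has_sum s) (UNIV :: int set)"
  shows "((\<lambda>r. f (r + k)) has_sum s) UNIV"
  using has_sum_reindex_bij_betw[OF bij_betw_int_shift[of k], of f s] assms by simp

text \<open>The finite product (q; q)_m.\<close>

definition qfac :: "complex \<Rightarrow> nat \<Rightarrow> complex" where
  "qfac q m = (\<Prod>k<m. 1 - q * q ^ k)"

definition rqfac :: "complex \<Rightarrow> int \<Rightarrow> complex" where
  "rqfac q i = (if i < 0 then 0 else 1 / qfac q (nat i))"

lemma qfac_nonzero:
  assumes "norm q < 1"
  shows "qfac q m \<noteq> 0"
proof -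
  have "q * q ^ k \<noteq> 1" for k
  proof
    assume "q * q ^ k = 1"
    hence "qpoch_inf q q = 0"
      using qpoch_inf_eq_0_iff[OF assms] by blast
    thus False using qpoch_inf_self_nonzero[OF assms] by simp
  qed
  thus ?thesis by (auto simp: qfac_def)
qed

text \<open>Setting the reciprocal to 0 at negative arguments makes this recursion hold for all integers,
  which is what lets the coefficients in \<open>finite_jacobi\<close> be treated without boundary cases.\<close>

lemma rqfac_rec:
  assumes "norm q < 1"
  shows "rqfac q i = (1 - q powi (i + 1)) * rqfac q (i + 1)"
proof (cases "i \<ge> 0")
  case True
  then obtain m where m: "i = int m" using nonneg_int_cases by blast
  have "q powi (i + 1) = q * q ^ m"
    unfolding m by (metis of_nat_Suc power_Suc power_int_of_nat add.commute)
  moreover have "nat (int m + 1) = Suc m" by simp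
  moreover have "1 - q * q ^ m \<noteq> 0"
    using qfac_nonzero[OF assms, of "Suc m"] by (simp add: qfac_def)
  ultimately show ?thesis unfolding m
    using qfac_nonzero[OF assms, of m]
    by (simp add: rqfac_def qfac_def)
next
  case False
  thus ?thesis by (cases "i = -1") (auto simp: rqfac_def)
qed

text \<open>The Gaussian binomial coefficient of 2N over N + r in base q; by the convention in
  \<open>rqfac\<close> it vanishes for |r| > N.\<close>

definition jacobi_coeff :: "complex \<Rightarrow> nat \<Rightarrow> int \<Rightarrow> complex" where
  "jacobi_coeff q N r = qfac q (2 * N) * rqfac q (int N + r) * rqfac q (int N - r)"

text \<open>Passing from N to N + 1 multiplies the finite product by (1 - x q^N)(1 - q^(N+1) / x) =
  1 + q^(2N+1) - x q^N - q^(N+1) / x. The recursion compares coefficients of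
  \<open>theta_term\<close>, where a shift of the index by one costs q^(1-r) or q^r.\<close>

lemma jacobi_coeff_rec:
  assumes "0 < norm q" "norm q < 1"
  shows "jacobi_coeff q (Suc N) r =
    (1 + q ^ (2 * N + 1)) * jacobi_coeff q N r
    + q ^ N * q powi (1 - r) * jacobi_coeff q N (r - 1)
    + q ^ (N + 1) * q powi r * jacobi_coeff q N (r + 1)"
proof -
  have q0: "q \<noteq> 0" using assms by auto
  define u X where "u = q ^ (N + 1)" and "X = q powi r"
  define r1 r2 where "r1 = rqfac q (int (Suc N) + r)" and "r2 = rqfac q (int (Suc N) - r)"
  have X0: "X \<noteq> 0" using q0 by (simp add: X_def)
  have e1: "q powi (int N + r + 1) = u * X"
    using q0 by (simp add: u_def X_def power_int_add flip: power_int_of_nat)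
  have e2: "q powi (int N - r + 1) = u / X"
    using q0 by (simp add: u_def X_def power_int_add power_int_diff flip: power_int_of_nat)
  have e3: "q powi (int N + r) = u * X / q"
    using q0 by (simp add: u_def X_def power_int_add)
  have e4: "q powi (int N - r) = u / (X * q)"
    using q0 by (simp add: u_def X_def power_int_diff)
  have e5: "q ^ (2 * N + 1) = u\<^sup>2 / q"
    using q0 by (simp add: u_def power2_eq_square power_mult power_mult_distrib)
  have e6: "q ^ N = u / q" using q0 by (simp add: u_def)
  have a1: "rqfac q (int N + r) = (1 - u * X) * r1"
    using rqfac_rec[OF assms(2), of "int N + r"] e1 by (simp add: r1_def algebra_simps)
  have a2: "rqfac q (int N - r) = (1 - u / X) * r2"
    using rqfac_rec[OF assms(2), of "int N - r"] e2 by (simp add: r2_def algebra_simps)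
  have a3: "rqfac q (int N + (r - 1)) = (1 - u * X / q) * ((1 - u * X) * r1)"
    using rqfac_rec[OF assms(2), of "int N + (r - 1)"]
    by (simp only: e3 a1 add.assoc diff_add_cancel)
  have a4: "rqfac q (int N - (r + 1)) = (1 - u / (X * q)) * ((1 - u / X) * r2)"
  proof -
    have "int N - (r + 1) + 1 = int N - r" by simp
    with rqfac_rec[OF assms(2), of "int N - (r + 1)"] show ?thesis by (simp only: e4 a2)
  qed
  have a5: "rqfac q (int N - (r - 1)) = r2" "rqfac q (int N + (r + 1)) = r1"
    by (simp_all add: r1_def r2_def algebra_simps)
  have f: "qfac q (2 * Suc N) = qfac q (2 * N) * (1 - u\<^sup>2 / q) * (1 - u\<^sup>2)"
  proof -
    have "qfac q (2 * Suc N) = qfac q (2 * N) * (1 - q * q ^ (2 * N)) * (1 - q * q ^ (2 * N + 1))"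
      by (simp add: qfac_def)
    moreover have "q * q ^ (2 * N) = u\<^sup>2 / q" using e5 by simp
    moreover have "q * q ^ (2 * N + 1) = u\<^sup>2" unfolding e5 using q0 by simp
    ultimately show ?thesis by simp
  qed
  \<comment> \<open>Without the common factors \<open>qfac q (2 * N)\<close>, \<open>r1\<close> and
    \<open>r2\<close> the recursion is a rational identity in \<open>u\<close>, \<open>X\<close> and
    \<open>q\<close>. Multiplying them back in needs no case distinction on whether
    \<open>r1\<close> or \<open>r2\<close> is 0.\<close>
  have "(1 - u\<^sup>2 / q) * (1 - u\<^sup>2) = (1 + u\<^sup>2 / q) * (1 - u * X) * (1 - u / X)
     + u / q * (q / X) * (1 - u * X / q) * (1 - u * X) + u * X * (1 - u / (X * q)) * (1 - u / X)"
    using X0 q0 by (simp add: field_simps power2_eq_square)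
  hence "qfac q (2 * N) * r1 * r2 * ((1 - u\<^sup>2 / q) * (1 - u\<^sup>2)) = 
     qfac q (2 * N) * r1 * r2 * ((1 + u\<^sup>2 / q) * (1 - u * X) * (1 - u / X)
     + u / q * (q / X) * (1 - u * X / q) * (1 - u * X) + u * X * (1 - u / (X * q)) * (1 - u / X))"
    by simp
  moreover have "q powi (1 - r) = q / X" "q ^ (N + 1) = u"
    using q0 by (simp_all add: X_def u_def power_int_diff)
  moreover have "rqfac q (int (Suc N) + r) = r1" "rqfac q (int (Suc N) - r) = r2"
    by (simp_all add: r1_def r2_def)
  ultimately show ?thesis
    unfolding jacobi_coeff_def a1 a2 a3 a4 a5 f e5 e6 X_def[symmetric]
    by (simp only: algebra_simps)
qed

text \<open>Summing over all integers, although few terms are nonzero, lets the index shifts by 1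
  and -1 in the induction act on the same sum.\<close>

lemma finite_jacobi:
  assumes "0 < norm q" "norm q < 1" "x \<noteq> 0"
  shows "((\<lambda>r. jacobi_coeff q N r * theta_term q x r) has_sum
    (\<Prod>k<N. 1 - x * q ^ k) * (\<Prod>k<N. 1 - q / x * q ^ k)) UNIV"
proof (induction N)
  case 0
  have "jacobi_coeff q 0 r * theta_term q x r = (if r = 0 then 1 else 0)" for r
    by (auto simp: jacobi_coeff_def rqfac_def qfac_def theta_term_def)
  moreover have "((\<lambda>r::int. if r = 0 then 1 else (0::complex)) has_sum (\<Sum>r\<in>{0::int}. 1)) UNIV"
    using has_sum_cong_neutral[of "UNIV" "{0::int}" "\<lambda>r. if r = 0 then 1 else (0::complex)" "\<lambda>_. 1"]
    by (smt (verit, best) DiffE Int_iff UNIV_I finite.emptyI finite.insertI has_sum_cong_neutral has_sum_finite singleton_iff)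
  ultimately show ?case by simp
next
  case (Suc N)
  have q0: "q \<noteq> 0" using assms by auto
  let ?P = "(\<Prod>k<N. 1 - x * q ^ k) * (\<Prod>k<N. 1 - q / x * q ^ k)"
  let ?T = "\<lambda>r. jacobi_coeff q N r * theta_term q x r"
  have "((\<lambda>r. (1 + q ^ (2 * N + 1)) * ?T r + (- (q ^ N) * x) * ?T (r + - 1) + (- (q ^ (N + 1)) / x) * ?T (r + 1))
     has_sum ((1 + q ^ (2 * N + 1)) * ?P + (- (q ^ N) * x) * ?P + (- (q ^ (N + 1)) / x) * ?P)) UNIV"
    by (intro has_sum_add has_sum_cmult_right has_sum_int_shift Suc.IH)
  moreover have "(1 + q ^ (2 * N + 1)) * ?T r + (- (q ^ N) * x) * ?T (r + - 1) + (- (q ^ (N + 1)) / x) * ?T (r + 1)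
      = jacobi_coeff q (Suc N) r * theta_term q x r" for r
  proof -
    have 1: "- x * theta_term q x (r + - 1) = q powi (1 - r) * theta_term q x r"
    proof -
      have "choose2 (r - 1) = choose2 r + (1 - r)"
        using two_choose2[of "r - 1"] two_choose2[of r] by (simp add: algebra_simps)
      thus ?thesis using q0 assms(3)
        by (simp add: theta_term_def power_int_add power_int_diff)
    qed
    have 2: "- theta_term q x (r + 1) / x = q powi r * theta_term q x r"
      using q0 assms(3) by (simp add: theta_term_def choose2_add power_int_add)
    have "(- (q ^ N) * x) * ?T (r + - 1) = q ^ N * jacobi_coeff q N (r - 1) * (- x * theta_term q x (r + - 1))"
      by simp
    moreover have "(- (q ^ (N + 1)) / x) * ?T (r + 1) = q ^ (N + 1) * jacobi_coeff q N (r + 1) * (- theta_term q x (r + 1) / x)"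
      by simp
    ultimately show ?thesis
      unfolding 1 2 jacobi_coeff_rec[OF assms(1,2)] by (simp only: algebra_simps)
  qed
  moreover have "(1 + q ^ (2 * N + 1)) * ?P + (- (q ^ N) * x) * ?P + (- (q ^ (N + 1)) / x) * ?P
     = (\<Prod>k<Suc N. 1 - x * q ^ k) * (\<Prod>k<Suc N. 1 - q / x * q ^ k)"
  proof -
    have "(1 + q ^ (2 * N + 1)) + (- (q ^ N) * x) + (- (q ^ (N + 1)) / x) = (1 - x * q ^ N) * (1 - q / x * q ^ N)"
      using assms(3) by (simp add: field_simps power_add mult_2 mult_2_right)
    hence "?P * ((1 + q ^ (2 * N + 1)) + (- (q ^ N) * x) + (- (q ^ (N + 1)) / x)) = ?P * ((1 - x * q ^ N) * (1 - q / x * q ^ N))"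
      by simp
    thus ?thesis by (simp only: algebra_simps prod.lessThan_Suc)
  qed
  ultimately show ?case by simp
qed

text \<open>Tannery's argument: as N grows, each coefficient of the finite identity tends to 1 / (q;
  q)_\<infinity>, and the coefficients are bounded uniformly, so limit and sum may be
  exchanged.\<close>

lemma jacobi_triple_product:
  assumes "0 < norm q" "norm q < 1" "x \<noteq> 0"
  shows "(theta_term q x has_sum jtheta x q) UNIV"
proof -
  define c where "c = qpoch_inf q q"
  have c0: "c \<noteq> 0" unfolding c_def by (rule qpoch_inf_self_nonzero[OF assms(2)])
  have lf: "qfac q \<longlonglongrightarrow> c"
    unfolding qfac_def[abs_def] c_def by (rule qpoch_inf_LIMSEQ[OF assms(2)])
  obtain B where B: "\<And>m. norm (qfac q m) \<le> B"
    using convergent_imp_Bseq[OF convergentI[OF lf]] unfolding Bseq_def by blast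
  have lr: "(\<lambda>m. 1 / qfac q m) \<longlonglongrightarrow> 1 / c"
    by (intro tendsto_divide lf c0 tendsto_const)
  obtain B' where B': "\<And>m. norm (1 / qfac q m) \<le> B'" "B' > 0"
    using convergent_imp_Bseq[OF convergentI[OF lr]] unfolding Bseq_def by blast
  have Br: "norm (rqfac q i) \<le> B'" for i
    using B' by (auto simp: rqfac_def)
  \<comment> \<open>The majorant is independent of N; this is what makes the convergence in the
    summation variable uniform.\<close>
  have bound: "norm (jacobi_coeff q N r * theta_term q x r) \<le> B * B' * B' * norm (theta_term q x r)" for N r
    unfolding jacobi_coeff_def norm_mult
    by (intro mult_mono mult_nonneg_nonneg B Br norm_ge_zero order.refl order_trans[OF norm_ge_zero B]
              less_imp_le[OF B'(2)])
  have 1: "uniform_limit UNIV (\<lambda>X N. \<Sum>r\<in>X. jacobi_coeff q N r * theta_term q x r)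
      (\<lambda>N. \<Prod>k<N. (1 - x * q ^ k) * (1 - q / x * q ^ k)) (finite_subsets_at_top UNIV)"
    by (rule Weierstrass_m_test_general'[where M = "\<lambda>r. B * B' * B' * norm (theta_term q x r)"])
       (use bound finite_jacobi[OF assms] in \<open>auto simp: prod.distrib intro!: summable_on_cmult_right theta_term_abs_summable assms\<close>)
  have 2: "\<forall>\<^sub>F X in finite_subsets_at_top UNIV.
     ((\<lambda>N. \<Sum>r\<in>X. jacobi_coeff q N r * theta_term q x r) \<longlongrightarrow> (\<Sum>r\<in>X. 1 / c * theta_term q x r)) sequentially"
  proof (intro always_eventually allI tendsto_sum tendsto_mult_right)
    fix r :: int
    have l1: "(\<lambda>N. qfac q (2 * N)) \<longlonglongrightarrow> c"
      using LIMSEQ_subseq_LIMSEQ[OF lf, of "\<lambda>N. 2 * N"] by (simp add: o_def strict_mono_def)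
    have l2: "(\<lambda>N. rqfac q (int N + s)) \<longlonglongrightarrow> 1 / c" for s
    proof -
      have f: "filterlim (\<lambda>N. nat (int N + s)) at_top sequentially"
      proof (rule filterlim_at_top[THEN iffD2], intro allI)
        fix Z :: nat
        show "\<forall>\<^sub>F N in sequentially. Z \<le> nat (int N + s)"
          using eventually_ge_at_top[of "Z + nat (- s)"] by eventually_elim linarith
      qed
      have "(\<lambda>N. 1 / qfac q (nat (int N + s))) \<longlonglongrightarrow> 1 / c"
        by (rule filterlim_compose[OF lr f])
      moreover have "\<forall>\<^sub>F N in sequentially. 1 / qfac q (nat (int N + s)) = rqfac q (int N + s)"
        using eventually_ge_at_top[of "nat (- s)"] by eventually_elim (auto simp: rqfac_def)
      ultimately show ?thesis by (rule Lim_transform_eventually)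
    qed
    have "(\<lambda>N. qfac q (2 * N) * rqfac q (int N + r) * rqfac q (int N - r)) \<longlonglongrightarrow> c * (1 / c) * (1 / c)"
      using l2[of "- r"] by (intro tendsto_mult l1 l2) simp
    thus "(\<lambda>N. jacobi_coeff q N r) \<longlonglongrightarrow> 1 / c"
      using c0 by (simp add: jacobi_coeff_def)
  qed
  have 3: "((\<lambda>X. \<Sum>r\<in>X. 1 / c * theta_term q x r) \<longlongrightarrow> 1 / c * infsum (theta_term q x) UNIV) (finite_subsets_at_top UNIV)"
    using has_sum_cmult_right[OF has_sum_infsum[OF theta_term_summable[OF assms]], of "1 / c"]
    unfolding has_sum_def .
  have "(\<lambda>N. \<Prod>k<N. (1 - x * q ^ k) * (1 - q / x * q ^ k)) \<longlonglongrightarrow> 1 / c * infsum (theta_term q x) UNIV"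
    by (rule swap_uniform_limit'[OF 2 3 1]) simp_all
  moreover have "(\<lambda>N. \<Prod>k<N. (1 - x * q ^ k) * (1 - q / x * q ^ k)) \<longlonglongrightarrow> qpoch_inf x q * qpoch_inf (q / x) q"
    unfolding prod.distrib by (intro tendsto_mult qpoch_inf_LIMSEQ assms)
  ultimately have "1 / c * infsum (theta_term q x) UNIV = qpoch_inf x q * qpoch_inf (q / x) q"
    using LIMSEQ_unique by blast
  hence "infsum (theta_term q x) UNIV = jtheta x q"
    using c0 by (simp add: jtheta_def c_def field_simps)
  thus ?thesis using has_sum_infsum[OF theta_term_summable[OF assms]] by simp
qed

section \<open>Theta functions\<close>

text \<open>Weierstrass M-test over an arbitrary index set. A summable majorant on a closed ball
  makes the finite partial sums converge uniformly there, and holomorphy passes to the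
  limit.\<close>

lemma infsum_holomorphic:
  fixes f :: "'a \<Rightarrow> complex \<Rightarrow> complex"
  assumes "open U" and hol: "\<And>k. k \<in> X \<Longrightarrow> f k holomorphic_on U"
    and bound: "\<And>z. z \<in> U \<Longrightarrow> \<exists>r>0. \<exists>M. cball z r \<subseteq> U \<and> M summable_on X \<and>
      (\<forall>k\<in>X. \<forall>w\<in>cball z r. norm (f k w) \<le> M k)"
  shows "(\<lambda>z. \<Sum>\<^sub>\<infinity>k\<in>X. f k z) holomorphic_on U"
proof -
  have "(\<lambda>z. \<Sum>\<^sub>\<infinity>k\<in>X. f k z) analytic_on U"
    unfolding analytic_on_def
  proof
    fix z assume "z \<in> U"
    from bound[OF this] obtain r M where r: "r > 0" "cball z r \<subseteq> U" "M summable_on X"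
      "\<And>k w. k \<in> X \<Longrightarrow> w \<in> cball z r \<Longrightarrow> norm (f k w) \<le> M k" by blast
    have ul: "uniform_limit (cball z r) (\<lambda>Y w. \<Sum>k\<in>Y. f k w) (\<lambda>w. \<Sum>\<^sub>\<infinity>k\<in>X. f k w) (finite_subsets_at_top X)"
      using r by (intro Weierstrass_m_test_general) auto
    have ev: "\<forall>\<^sub>F Y in finite_subsets_at_top X. continuous_on (cball z r) (\<lambda>w. \<Sum>k\<in>Y. f k w)
        \<and> (\<lambda>w. \<Sum>k\<in>Y. f k w) holomorphic_on ball z r"
    proof (rule eventually_finite_subsets_at_top_weakI)
      fix Y assume "finite Y" "Y \<subseteq> X"
      hence "(\<lambda>w. \<Sum>k\<in>Y. f k w) holomorphic_on U"
        by (intro holomorphic_on_sum hol) auto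
      moreover have "ball z r \<subseteq> U" using r(2) ball_subset_cball by blast
      ultimately show "continuous_on (cball z r) (\<lambda>w. \<Sum>k\<in>Y. f k w)
        \<and> (\<lambda>w. \<Sum>k\<in>Y. f k w) holomorphic_on ball z r"
        using r(2) by (meson holomorphic_on_imp_continuous_on holomorphic_on_subset)
    qed
    have "(\<lambda>w. \<Sum>\<^sub>\<infinity>k\<in>X. f k w) holomorphic_on ball z r"
      by (rule holomorphic_uniform_limit[OF ev ul]) auto
    thus "\<exists>e>0. (\<lambda>w. \<Sum>\<^sub>\<infinity>k\<in>X. f k w) holomorphic_on ball z e"
      using r(1) by blast
  qed
  thus ?thesis by (rule analytic_imp_holomorphic)
qed

text \<open>Gives a bound free of \<open>w\<close> for both signs of \<open>r\<close>: the upper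
  bound on \<open>norm w\<close> controls nonnegative powers and the lower bound negative ones, so
  the sum of both serves as a majorant.\<close>

lemma norm_power_int_le:
  fixes w z :: complex
  assumes "norm z / 2 \<le> norm w" "norm w \<le> 2 * norm z" "z \<noteq> 0"
  shows "norm (w powi r) \<le> (2 * norm z) powi r + (norm z / 2) powi r"
proof (cases "r \<ge> 0")
  case True
  have "norm (w powi r) \<le> (2 * norm z) powi r"
    unfolding norm_power_int using assms True by (intro power_int_mono) auto
  thus ?thesis using assms by (simp add: add_increasing2)
next
  case False
  have "norm w powi r \<le> (norm z / 2) powi r"
    using assms False by (intro power_int_antimono) auto
  thus ?thesis using assms by (simp add: add_increasing norm_power_int)
qed

lemma norm_ball_bounds:
  fixes w z :: complex
  assumes "dist z w \<le> norm z / 2"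
  shows "norm z / 2 \<le> norm w" "norm w \<le> 2 * norm z"
proof -
  have "norm z \<le> norm w + dist z w" "norm w \<le> norm z + dist z w"
    using norm_triangle_ineq2[of z w] norm_triangle_ineq2[of w z] 
    by (auto simp: dist_norm norm_minus_commute)
  thus "norm z / 2 \<le> norm w" "norm w \<le> 2 * norm z" using assms by auto
qed

lemma isCont_eventually_dist:
  fixes f :: "'a::metric_space \<Rightarrow> 'b::metric_space"
  assumes "isCont f z" "e > 0"
  shows "\<forall>\<^sub>F w in nhds z. dist (f w) (f z) < e"
  using assms unfolding continuous_at_eps_delta eventually_nhds_metric by blast

lemma norm_powi_less_1:
  fixes q :: complex
  assumes "0 < norm q" "norm q < 1" "a > 0"
  shows "0 < norm (q powi a)" "norm (q powi a) < 1"
  using assms by (auto simp: norm_power_int power_int_def power_less_one_iff norm_power)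

lemma holomorphic_jtheta:
  assumes "0 < norm q" "norm q < 1"
  shows "(\<lambda>x. jtheta x q) holomorphic_on (- {0})"
proof -
  have "(\<lambda>x. \<Sum>\<^sub>\<infinity>r. theta_term q x r) holomorphic_on (- {0})"
  proof (rule infsum_holomorphic)
    show "(\<lambda>x. theta_term q x r) holomorphic_on - {0}" for r
      unfolding theta_term_def by (intro holomorphic_intros) auto
    fix z :: complex assume z: "z \<in> - {0}"
    let ?M = "\<lambda>r. norm q powi choose2 r * (2 * norm z) powi r + norm q powi choose2 r * (norm z / 2) powi r"
    have "?M summable_on UNIV"
      using assms z by (intro summable_on_add summable_gauss) auto
    moreover have "norm (theta_term q w r) \<le> ?M r" if "w \<in> cball z (norm z / 2)" for w r
    proof -
      have "norm (w powi r) \<le> (2 * norm z) powi r + (norm z / 2) powi r"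
        using norm_ball_bounds[of z w] that z by (intro norm_power_int_le) auto
      hence "norm (theta_term q w r) \<le> norm q powi choose2 r * ((2 * norm z) powi r + (norm z / 2) powi r)"
        unfolding norm_theta_term norm_power_int[symmetric] by (intro mult_left_mono) auto
      thus ?thesis by (simp add: algebra_simps)
    qed
    moreover have "cball z (norm z / 2) \<subseteq> - {0}" "norm z / 2 > 0" using z by auto
    ultimately show "\<exists>r>0. \<exists>M. cball z r \<subseteq> - {0} \<and> M summable_on UNIV \<and> (\<forall>k\<in>UNIV. \<forall>w\<in>cball z r. norm (theta_term q w k) \<le> M k)"
      by blast
  qed auto
  moreover have "(\<Sum>\<^sub>\<infinity>r. theta_term q x r) = jtheta x q" if "x \<in> - {0}" for x
    using infsumI[OF jacobi_triple_product[OF assms, of x]] that by simp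
  ultimately show ?thesis
    using holomorphic_cong[of "- {0}" "- {0}" "\<lambda>x. \<Sum>\<^sub>\<infinity>r. theta_term q x r" "\<lambda>x. jtheta x q"] by blast
qed

lemma holomorphic_jtheta_compose:
  assumes "0 < norm q" "norm q < 1" "f holomorphic_on A" "\<And>z. z \<in> A \<Longrightarrow> f z \<noteq> 0"
  shows "(\<lambda>z. jtheta (f z) q) holomorphic_on A"
proof -
  have "(\<lambda>x. jtheta x q) \<circ> f holomorphic_on A"
    by (rule holomorphic_on_compose_gen[OF assms(3) holomorphic_jtheta[OF assms(1,2)]]) (use assms(4) in auto)
  thus ?thesis by (simp add: o_def)
qed

section \<open>Functional equations, zeros and product identities of theta functions\<close>

lemma jtheta_reflect: "x \<noteq> 0 \<Longrightarrow> q \<noteq> 0 \<Longrightarrow> jtheta (q / x) q = jtheta x q"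
  by (simp add: jtheta_def)

lemma jtheta_shift:
  assumes "0 < norm q" "norm q < 1" "x \<noteq> 0"
  shows "jtheta (q * x) q = - jtheta x q / x"
proof -
  have q0: "q \<noteq> 0" using assms by auto
  have 1: "qpoch_inf x q = (1 - x) * qpoch_inf (q * x) q"
    using qpoch_inf_split[OF assms(2), of x] by (simp add: mult.commute)
  have 2: "qpoch_inf (1 / x) q = (1 - 1 / x) * qpoch_inf (q / x) q"
    using qpoch_inf_split[OF assms(2), of "1 / x"] by simp
  show ?thesis
    unfolding jtheta_def 1 using q0 assms(3) by (simp add: 2 field_simps)
qed

lemma jtheta_shift_powi:
  assumes "0 < norm q" "norm q < 1" "x \<noteq> 0"
  shows "jtheta (q powi k * x) q = (-1) powi k * q powi (- choose2 k) * x powi (- k) * jtheta x q"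
proof -
  have q0: "q \<noteq> 0" using assms by auto
  have step: "jtheta (q powi (k + 1) * x) q = - jtheta (q powi k * x) q * q powi (- k) / x" for k
  proof -
    have "jtheta (q * (q powi k * x)) q = - jtheta (q powi k * x) q / (q powi k * x)"
      using q0 assms by (intro jtheta_shift) auto
    thus ?thesis using q0 by (simp add: power_int_add power_int_minus field_simps)
  qed
  have rec: "(-1) powi (k + 1) * q powi (- choose2 (k + 1)) * x powi (- (k + 1)) * jtheta x q =
     - ((-1) powi k * q powi (- choose2 k) * x powi (- k) * jtheta x q) * q powi (- k) / x" for k
  proof -
    have "q powi (- choose2 (k + 1)) = q powi (- choose2 k) * q powi (- k)"
      using q0 by (simp add: choose2_add flip: power_int_add)
    moreover have "x powi (- (k + 1)) = x powi (- k) / x"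
      using assms(3) power_int_diff[of x "- k" 1] by simp
    moreover have "(-1) powi (k + 1) = - ((-1) powi k :: complex)"
      by (simp add: power_int_add)
    ultimately show ?thesis by simp
  qed
  show ?thesis
  proof (induction k rule: int_induct[where k = 0])
    case base
    show ?case by simp
  next
    case (step1 i)
    show ?case unfolding step rec step1.IH by simp
  next
    \<comment> \<open>Downward induction: \<open>step\<close> and \<open>rec\<close> at i - 1 have
      the same form, so the common nonzero factor can be divided out.\<close>
    case (step2 i)
    have "- jtheta (q powi (i - 1) * x) q * q powi (- (i - 1)) / x =
          - ((-1) powi (i - 1) * q powi (- choose2 (i - 1)) * x powi (- (i - 1)) * jtheta x q) * q powi (- (i - 1)) / x"
      using step[of "i - 1"] rec[of "i - 1"] step2.IH by simp
    thus ?case using q0 assms(3) by simp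
  qed
qed

lemma jtheta_inverse:
  assumes "0 < norm q" "norm q < 1" "x \<noteq> 0"
  shows "jtheta (1 / x) q = - jtheta x q / x"
proof -
  have q0: "q \<noteq> 0" using assms by auto
  have "jtheta (1 / x) q = jtheta (q / (1 / x)) q"
    using q0 assms(3) by (intro jtheta_reflect[symmetric]) auto
  thus ?thesis using jtheta_shift[OF assms] by simp
qed

text \<open>Zeros of the first product give the exponents k \<le> 0, those of the second the
  exponents k > 0; (q; q)_\<infinity> never vanishes.\<close>

lemma jtheta_eq_0_iff:
  assumes "0 < norm q" "norm q < 1" "x \<noteq> 0"
  shows "jtheta x q = 0 \<longleftrightarrow> (\<exists>k::int. x = q powi k)"
proof
  have q0: "q \<noteq> 0" using assms by auto
  assume "jtheta x q = 0"
  hence "qpoch_inf x q = 0 \<or> qpoch_inf (q / x) q = 0"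
    using qpoch_inf_self_nonzero[OF assms(2)] by (auto simp: jtheta_def)
  then consider k where "x * q ^ k = 1" | k where "q / x * q ^ k = 1"
    using qpoch_inf_eq_0_iff[OF assms(2)] by blast
  thus "\<exists>k::int. x = q powi k"
  proof cases
    case (1 k)
    hence "x = q powi (- int k)" using q0 by (simp add: power_int_minus field_simps)
    thus ?thesis by blast
  next
    case (2 k)
    hence "x = q ^ Suc k" using assms(3) by (simp add: field_simps)
    hence "x = q powi int (Suc k)" by (simp only: power_int_of_nat)
    thus ?thesis by blast
  qed
next
  assume "\<exists>k::int. x = q powi k"
  then obtain k where "x = q powi k" by blast
  hence "jtheta x q = c * jtheta 1 q" if "c = (-1) powi k * q powi (- choose2 k) * 1 powi (- k)" for c
    using jtheta_shift_powi[OF assms(1,2), of 1 k] that by simp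
  moreover have "jtheta 1 q = 0"
    using qpoch_inf_eq_0_iff[OF assms(2), of 1] power_0[of q] by (auto simp: jtheta_def intro: exI[of _ "0::nat"])
  ultimately show "jtheta x q = 0" by simp
qed

text \<open>The zero at 1 comes from the first factor of (v; q)_\<infinity>. Cancelling it leaves
  three copies of (q; q)_\<infinity>, the leading coefficient in the residue computations.\<close>

lemma tendsto_jtheta_div:
  assumes "0 < norm q" "norm q < 1"
  shows "((\<lambda>v. jtheta v q / (1 - v)) \<longlongrightarrow> qpoch_inf q q ^ 3) (at 1)"
proof -
  have "isCont (\<lambda>v. qpoch_inf (v * q) q * qpoch_inf (q / v) q * qpoch_inf q q) 1"
    by (intro continuous_intros isCont_o2[OF _ continuous_qpoch_inf[OF assms(2)]]) auto
  hence "((\<lambda>v. qpoch_inf (v * q) q * qpoch_inf (q / v) q * qpoch_inf q q) \<longlongrightarrow> qpoch_inf q q ^ 3) (at 1)"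
    by (simp add: isCont_def power3_eq_cube)
  moreover have "\<forall>\<^sub>F v in at 1. qpoch_inf (v * q) q * qpoch_inf (q / v) q * qpoch_inf q q = jtheta v q / (1 - v)"
    unfolding eventually_at_filter
  proof (intro always_eventually allI impI)
    fix v :: complex assume "v \<noteq> 1"
    thus "qpoch_inf (v * q) q * qpoch_inf (q / v) q * qpoch_inf q q = jtheta v q / (1 - v)"
      unfolding jtheta_def by (subst (4) qpoch_inf_split[OF assms(2)]) simp
  qed
  ultimately show ?thesis by (rule Lim_transform_eventually)
qed

text \<open>The product of the factors for w and -w lives in base q^2, and the third theta function
  supplies the missing odd powers, restoring base q. Exactly these four values meet at a pole of the
  theta quotient.\<close>

lemma jtheta_quadruple:
  assumes "0 < norm q" "norm q < 1" "w \<noteq> 0"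
  shows "jtheta w q * jtheta (- w) q * jtheta (q * w\<^sup>2) (q\<^sup>2) * jtheta q (q\<^sup>2) =
    jtheta (w\<^sup>2) q * qpoch_inf q q ^ 3"
proof -
  have q0: "q \<noteq> 0" using assms by auto
  note mm = qpoch_inf_mult_minus[OF assms(2)] and bi = qpoch_inf_bisect[OF assms(2)]
  have 1: "qpoch_inf w q * qpoch_inf (- w) q * qpoch_inf (q * w\<^sup>2) (q\<^sup>2) = qpoch_inf (w\<^sup>2) q"
    using mm[of w] bi[of "w\<^sup>2"] by (simp add: mult.commute)
  have 2: "qpoch_inf (q / w) q * qpoch_inf (q / (- w)) q * qpoch_inf (q\<^sup>2 / (q * w\<^sup>2)) (q\<^sup>2) = qpoch_inf (q / w\<^sup>2) q"
    using mm[of "q / w"] bi[of "q / w\<^sup>2"] q0 assms(3)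
    by (simp add: power_divide power2_eq_square mult.commute)
  have 3: "qpoch_inf q (q\<^sup>2) * qpoch_inf (q\<^sup>2) (q\<^sup>2) = qpoch_inf q q"
    using bi[of q] by (simp add: power2_eq_square)
  have 4: "q\<^sup>2 / q = q" using q0 by (simp add: power2_eq_square)
  have "jtheta w q * jtheta (- w) q * jtheta (q * w\<^sup>2) (q\<^sup>2) * jtheta q (q\<^sup>2) =
     (qpoch_inf w q * qpoch_inf (- w) q * qpoch_inf (q * w\<^sup>2) (q\<^sup>2)) *
     (qpoch_inf (q / w) q * qpoch_inf (q / (- w)) q * qpoch_inf (q\<^sup>2 / (q * w\<^sup>2)) (q\<^sup>2)) *
     (qpoch_inf q (q\<^sup>2) * qpoch_inf (q\<^sup>2) (q\<^sup>2)) ^ 2 * qpoch_inf q q ^ 2"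
    unfolding jtheta_def 4 by (simp only: power2_eq_square mult_ac)
  also have "\<dots> = jtheta (w\<^sup>2) q * qpoch_inf q q ^ 3"
    unfolding 1 2 3 jtheta_def by (simp add: power2_eq_square power3_eq_cube)
  finally show ?thesis .
qed

text \<open>Here q / X = -X, so the two products pair up to (-q; q^2)_\<infinity>; the rest is
  sorting by parity. In base q^n this value is the constant J_{2n,4n} of the theorem.\<close>

lemma jtheta_at_root:
  assumes "0 < norm q" "norm q < 1" "X\<^sup>2 = - q"
  shows "jtheta X q = jtheta (q\<^sup>2) (q ^ 4)"
proof -
  have q0: "q \<noteq> 0" using assms by auto
  hence X0: "X \<noteq> 0" using assms by auto
  have q2: "norm (q\<^sup>2) < 1"
    using assms by (simp add: norm_power power_less_one_iff)
  note mm = qpoch_inf_mult_minus[OF assms(2)] and bi = qpoch_inf_bisect[OF assms(2)]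
  have "q / X = - X" using assms(3) X0 by (simp add: field_simps power2_eq_square)
  hence 1: "jtheta X q = qpoch_inf (- q) (q\<^sup>2) * qpoch_inf q q"
    unfolding jtheta_def using mm[of X] assms(3) by simp
  have 2: "qpoch_inf q (q\<^sup>2) * qpoch_inf (q\<^sup>2) (q\<^sup>2) = qpoch_inf q q"
    using bi[of q] by (simp add: power2_eq_square)
  have 3: "qpoch_inf (q\<^sup>2) (q ^ 4) * qpoch_inf (q ^ 4) (q ^ 4) = qpoch_inf (q\<^sup>2) (q\<^sup>2)"
    using qpoch_inf_bisect[OF q2, of "q\<^sup>2"] by (simp flip: power_mult power_add)
  have 4: "qpoch_inf q (q\<^sup>2) * qpoch_inf (- q) (q\<^sup>2) = qpoch_inf (q\<^sup>2) (q ^ 4)"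
    using qpoch_inf_mult_minus[OF q2, of q] by (simp flip: power_mult)
  have 5: "q ^ 4 / q\<^sup>2 = q\<^sup>2" using q0 by (simp add: power4_eq_xxxx power2_eq_square)
  have "jtheta (q\<^sup>2) (q ^ 4) = qpoch_inf (q\<^sup>2) (q ^ 4) * qpoch_inf (q\<^sup>2) (q\<^sup>2)"
    unfolding jtheta_def 5 by (simp only: 3 mult.assoc)
  also have "\<dots> = qpoch_inf (- q) (q\<^sup>2) * qpoch_inf q q"
    unfolding 4[symmetric] 2[symmetric] by (simp only: mult_ac)
  finally show ?thesis using 1 by simp
qed

section \<open>Quasi-periodic functions on the punctured plane\<close>

lemma holomorphic_on_imp_isCont:
  assumes "f holomorphic_on U" "open U" "z \<in> U"
  shows "isCont f z"
  using assms holomorphic_on_imp_continuous_on continuous_on_eq_continuous_at by blast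

text \<open>Identity theorem on the connected punctured plane: one nonzero value prevents the zeros
  from accumulating at \<open>z\<close>.\<close>

lemma eventually_nonzero_punctured:
  assumes H: "H holomorphic_on - {0}" "z0 \<noteq> 0" "H z0 \<noteq> 0" and "z \<noteq> 0"
  shows "\<forall>\<^sub>F u in at z. H u \<noteq> 0"
proof -
  have conn: "connected (- {0::complex})"
    by (rule connected_punctured_universe) auto
  have "\<not> z islimpt {u. u \<noteq> 0 \<and> H u = 0}"
  proof
    assume l: "z islimpt {u. u \<noteq> 0 \<and> H u = 0}"
    have "H z0 = 0"
      by (rule analytic_continuation[OF H(1) _ conn _ _ l]) (use assms in auto)
    with H show False by simp
  qed
  hence "\<forall>\<^sub>F u in at z. u \<notin> {u. u \<noteq> 0 \<and> H u = 0}"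
    by (simp add: islimpt_iff_eventually)
  moreover have "\<forall>\<^sub>F u in at z. u \<in> - {0} - {z}"
    using assms by (intro eventually_at_in_open) auto
  ultimately show ?thesis by eventually_elim auto
qed

text \<open>The zeros of \<open>H\<close> mark the points where \<open>S\<close> may be singular. It
  is enough to control one translate of each such point, because quasi-periodicity carries the
  estimate to the others. The extended function is bounded as |c| = 1, hence constant, and d = c d
  with c \<noteq> 1 forces d = 0.\<close>

lemma quasi_periodic_zero:
  fixes S H :: "complex \<Rightarrow> complex" and p c :: complex
  assumes p: "0 < norm p" "norm p < 1" and c: "norm c = 1" "c \<noteq> 1"
    and H: "H holomorphic_on - {0}" "z0 \<noteq> 0" "H z0 \<noteq> 0"
    and S: "S holomorphic_on {z. z \<noteq> 0 \<and> H z \<noteq> 0}"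
    and per: "\<And>z. z \<noteq> 0 \<Longrightarrow> H z \<noteq> 0 \<Longrightarrow> H (p * z) \<noteq> 0 \<and> S (p * z) = c * S z"
    and per0: "\<And>z. z \<noteq> 0 \<Longrightarrow> H z = 0 \<Longrightarrow> H (p * z) = 0"
    and sing: "\<And>z. z \<noteq> 0 \<Longrightarrow> H z = 0 \<Longrightarrow>
      \<exists>i::int. ((\<lambda>u. (u - p powi i * z) * S u) \<longlongrightarrow> 0) (at (p powi i * z))"
    and x: "x \<noteq> 0" "H x \<noteq> 0"
  shows "S x = 0"
proof -
  have p0: "p \<noteq> 0" and c0: "c \<noteq> 0" using p c by auto
  let ?U = "{z. z \<noteq> 0 \<and> H z \<noteq> 0}"
  have iso: "\<forall>\<^sub>F u in at z. u \<in> ?U" if "z \<noteq> 0" for z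
  proof -
    have "\<forall>\<^sub>F u in at z. u \<in> - {0} - {z}"
      using that by (intro eventually_at_in_open) auto
    with eventually_nonzero_punctured[OF H that] show ?thesis by eventually_elim auto
  qed
  have op: "open ?U"
  proof -
    have "open (- {0} \<inter> H -` (- {0}))"
      by (rule continuous_open_preimage) (use H holomorphic_on_imp_continuous_on in auto)
    moreover have "- {0} \<inter> H -` (- {0}) = ?U" by auto
    ultimately show ?thesis by simp
  qed
  have pow: "H (p powi i * z) \<noteq> 0 \<and> S (p powi i * z) = c powi i * S z" if "z \<noteq> 0" "H z \<noteq> 0" for i z
  proof (induction i rule: int_induct[where k = 0])
    case base
    show ?case using that by simp
  next
    case (step1 i)
    have "H (p * (p powi i * z)) \<noteq> 0 \<and> S (p * (p powi i * z)) = c * S (p powi i * z)"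
      using step1 that p0 by (intro per) auto
    thus ?case using step1 p0 c0 by (simp add: power_int_add mult_ac)
  next
    case (step2 i)
    let ?z = "p powi (i - 1) * z"
    have e: "p * ?z = p powi i * z" using p0 by (simp add: power_int_diff)
    have z: "?z \<noteq> 0" using that p0 by simp
    have "H ?z \<noteq> 0" using per0[OF z] step2 unfolding e by blast
    with per[OF z] step2 e show ?case using c0 by (simp add: power_int_diff field_simps)
  qed
  \<comment> \<open>The estimate \<open>sing\<close> at p^i z is pulled back to z, at the price of
    the factor c^i; Riemann's theorem on removable singularities then gives the limit.\<close>
  have ext: "\<exists>l. S \<midarrow>z\<rightarrow> l" and isol: "isolated_singularity_at S z" if z: "z \<noteq> 0" for z
  proof -
    obtain r where r: "r > 0" "ball z r - {z} \<subseteq> ?U"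
    proof -
      from iso[OF z] obtain r where "r > 0" "\<And>u. u \<noteq> z \<Longrightarrow> dist u z < r \<Longrightarrow> u \<in> ?U"
        unfolding eventually_at by blast
      thus ?thesis using that[of r] by (force simp: dist_commute)
    qed
    have hol: "S holomorphic_on ball z r - {z}"
      using S r by (rule_tac holomorphic_on_subset)
    hence ana: "S analytic_on ball z r - {z}"
      by (simp add: analytic_on_open open_Diff)
    thus "isolated_singularity_at S z"
      unfolding isolated_singularity_at_def using r by blast
    show "\<exists>l. S \<midarrow>z\<rightarrow> l"
    proof (cases "H z = 0")
      case False
      have "isCont S z"
        using S False z op holomorphic_on_imp_continuous_on continuous_on_eq_continuous_at by blast
      thus ?thesis unfolding isCont_def by blast
    next
      case True
      from sing[OF z True] obtain i where
        i: "((\<lambda>u. (u - p powi i * z) * S u) \<longlongrightarrow> 0) (at (p powi i * z))" by blast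
      let ?a = "p powi i"
      have a0: "?a \<noteq> 0" using p0 by simp
      have f: "filterlim (\<lambda>u. ?a * u) (at (?a * z)) (at z)"
      proof (rule filterlim_atI)
        show "((\<lambda>u. ?a * u) \<longlongrightarrow> ?a * z) (at z)" by (intro tendsto_intros)
        show "\<forall>\<^sub>F u in at z. ?a * u \<noteq> ?a * z"
          using a0 by (auto simp: eventually_at_filter)
      qed
      have "((\<lambda>u. (?a * u - ?a * z) * S (?a * u)) \<longlongrightarrow> 0) (at z)"
        using filterlim_compose[OF i f] by simp
      hence "((\<lambda>u. (?a * u - ?a * z) * S (?a * u) / (?a * c powi i)) \<longlongrightarrow> 0 / (?a * c powi i)) (at z)"
        using a0 c0 by (intro tendsto_divide tendsto_const) auto
      hence "((\<lambda>u. (?a * u - ?a * z) * S (?a * u) / (?a * c powi i)) \<longlongrightarrow> 0) (at z)"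
        by simp
      moreover have "\<forall>\<^sub>F u in at z. (?a * u - ?a * z) * S (?a * u) / (?a * c powi i) = (u - z) * S u"
        using iso[OF z] by eventually_elim (use pow a0 c0 in \<open>auto simp: field_simps\<close>)
      ultimately have lim: "((\<lambda>u. (u - z) * S u) \<longlongrightarrow> 0) (at z)"
        by (rule Lim_transform_eventually)
      have "\<exists>g. g holomorphic_on ball z r \<and> (\<forall>u\<in>ball z r - {z}. g u = S u)"
        using holomorphic_on_extend_lim[of S "ball z r" z] hol r lim by auto
      then obtain g where g: "g holomorphic_on ball z r" "\<And>u. u \<in> ball z r - {z} \<Longrightarrow> g u = S u"
        by blast
      have "isCont g z"
        using g(1) r(1) holomorphic_on_imp_continuous_on continuous_on_eq_continuous_at
        by (metis centre_in_ball open_ball)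
      hence gz: "g \<midarrow>z\<rightarrow> g z" by (simp add: isCont_def)
      have "\<forall>\<^sub>F u in at z. u \<in> ball z r - {z}"
        using r(1) by (intro eventually_at_in_open) auto
      hence "\<forall>\<^sub>F u in at z. g u = S u"
        by eventually_elim (rule g(2))
      from Lim_transform_eventually[OF gz this] show ?thesis ..
    qed
  qed
  define R where "R = remove_sings S"
  have Rana: "R analytic_on - {0}"
    unfolding R_def using ext isol remove_sings_analytic_at
    by (subst analytic_on_analytic_at) blast
  hence Rhol: "R holomorphic_on - {0}" by (rule analytic_imp_holomorphic)
  have RS: "\<forall>\<^sub>F u in at z. R u = S u" if "z \<noteq> 0" for z
    unfolding R_def using isol[OF that] by (rule eventually_remove_sings_eq_at)
  have Rlim: "R \<midarrow>z\<rightarrow> R z" if "z \<noteq> 0" for z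
  proof -
    have "R analytic_on {z}" using that by (intro analytic_on_subset[OF Rana]) auto
    thus ?thesis using analytic_at_imp_isCont isCont_def by metis
  qed
  \<comment> \<open>At zeros of \<open>H\<close> the hypothesis \<open>per\<close> says nothing, so
    the equation is obtained as a limit from nearby points.\<close>
  have Rper: "R (p * z) = c * R z" if z: "z \<noteq> 0" for z
  proof -
    have f: "filterlim (\<lambda>u. p * u) (at (p * z)) (at z)"
    proof (rule filterlim_atI)
      show "((\<lambda>u. p * u) \<longlongrightarrow> p * z) (at z)" by (intro tendsto_intros)
      show "\<forall>\<^sub>F u in at z. p * u \<noteq> p * z"
        using p0 by (auto simp: eventually_at_filter)
    qed
    have 1: "((\<lambda>u. R (p * u)) \<longlongrightarrow> R (p * z)) (at z)"
      using filterlim_compose[OF Rlim f] z p0 by simp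
    have 2: "((\<lambda>u. c * R u) \<longlongrightarrow> c * R z) (at z)"
      by (intro tendsto_intros Rlim z)
    have "\<forall>\<^sub>F u in at z. R (p * u) = S (p * u)"
      using z p0 by (intro eventually_compose_filterlim[OF RS f]) auto
    hence "\<forall>\<^sub>F u in at z. R (p * u) = c * R u"
      using RS[OF z] iso[OF z] by eventually_elim (use per in auto)
    from Lim_transform_eventually[OF 1 this] have "((\<lambda>u. c * R u) \<longlongrightarrow> R (p * z)) (at z)" .
    from tendsto_unique[OF at_neq_bot this 2] show ?thesis .
  qed
  have Rpow: "norm (R (p powi i * z)) = norm (R z)" if "z \<noteq> 0" for i z
  proof (induction i rule: int_induct[where k = 0])
    case base
    show ?case by simp
  next
    case (step1 i)
    show ?case using step1 Rper[of "p powi i * z"] p0 that c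
      by (simp add: power_int_add norm_mult mult_ac)
  next
    case (step2 i)
    show ?case using step2 Rper[of "p powi (i - 1) * z"] p0 that c
      by (simp add: power_int_diff norm_mult)
  qed
  \<comment> \<open>A fundamental annulus for multiplication by \<open>p\<close>; translation by
    powers of \<open>p\<close> preserves \<open>norm (R z)\<close>.\<close>
  let ?K = "cball 0 1 - ball 0 (norm p) :: complex set"
  have "compact (R ` ?K)"
  proof (rule compact_continuous_image)
    show "compact ?K" by (intro compact_diff) auto
    show "continuous_on ?K R"
      by (rule continuous_on_subset[OF holomorphic_on_imp_continuous_on[OF Rhol]]) (use p in auto)
  qed
  then obtain B where B: "\<And>u. u \<in> ?K \<Longrightarrow> norm (R u) \<le> B"
    using compact_imp_bounded bounded_iff by (metis imageI)
  have bnd: "norm (R z) \<le> B" if z: "z \<noteq> 0" for z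
  proof -
    \<comment> \<open>The exponent for which p^(-i) z falls into the annulus. As
      \<open>ln (norm p)\<close> is negative, dividing by it reverses the inequalities.\<close>
    define i where "i = \<lfloor>ln (norm z) / ln (norm p)\<rfloor>"
    have lp: "ln (norm p) < 0" using p by simp
    have i1: "of_int i \<le> ln (norm z) / ln (norm p)" "ln (norm z) / ln (norm p) < of_int i + 1"
      unfolding i_def by linarith+
    have "norm (p powi (- i) * z) = exp (- of_int i * ln (norm p) + ln (norm z))"
    proof -
      have "norm p powi (- i) = norm p powr (of_int (- i))"
        using p by (subst powr_real_of_int') auto
      thus ?thesis using p z unfolding exp_add
        by (simp add: norm_mult norm_power_int powr_def)
    qed
    moreover have "- of_int i * ln (norm p) + ln (norm z) \<le> 0"
      using i1(1) lp by (simp add: field_simps)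
    moreover have "norm p \<le> exp (- of_int i * ln (norm p) + ln (norm z))"
    proof -
      have "norm p = exp (ln (norm p))" using p by simp
      also have "\<dots> \<le> exp (- of_int i * ln (norm p) + ln (norm z))"
        using i1(2) lp by (subst exp_le_cancel_iff) (simp add: field_simps)
      finally show ?thesis .
    qed
    ultimately have "norm (p powi (- i) * z) \<le> 1" "norm (p powi (- i) * z) \<ge> norm p"
      using p by simp_all
    hence "p powi (- i) * z \<in> ?K" by auto
    from B[OF this] Rpow[OF z] show ?thesis by simp
  qed
  \<comment> \<open>The exponential covers the punctured plane, so a bounded function there becomes
    a bounded entire one.\<close>
  have "(\<lambda>s. R (exp s)) constant_on UNIV"
  proof (rule Liouville_theorem)
    have "R \<circ> exp holomorphic_on UNIV"
      by (rule holomorphic_on_compose_gen[OF _ Rhol]) (auto intro: holomorphic_intros)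
    thus "(\<lambda>s. R (exp s)) holomorphic_on UNIV" by (simp add: o_def)
    show "bounded (range (\<lambda>s. R (exp s)))"
      using bnd by (auto simp: bounded_iff intro!: exI[of _ B])
  qed
  then obtain d where "\<And>s. R (exp s) = d" unfolding constant_on_def by auto
  hence d: "R z = d" if "z \<noteq> 0" for z using that by (metis exp_Ln)
  have "d = c * d" using Rper[of 1] d p0 by simp
  hence "d = 0" using c(2) by auto
  have "\<forall>\<^sub>F u in at x. u \<in> - {0} - {x}"
    using x by (intro eventually_at_in_open) auto
  with RS[OF x(1)] have ev: "\<forall>\<^sub>F u in at x. S u = 0"
    by eventually_elim (use d \<open>d = 0\<close> in auto)
  have lx: "S \<midarrow>x\<rightarrow> S x"
  proof -
    have "isCont S x"
      using S x op holomorphic_on_imp_continuous_on continuous_on_eq_continuous_at by blast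
    thus ?thesis unfolding isCont_def .
  qed
  from Lim_transform_eventually[OF lx ev] show "S x = 0"
    by (simp add: tendsto_const_iff)
qed

section \<open>Hecke-type double sums\<close>

lemma summable_on_product_nonneg:
  fixes f g :: "'a \<Rightarrow> real"
  assumes "f summable_on UNIV" "g summable_on UNIV" "\<And>x. f x \<ge> 0" "\<And>x. g x \<ge> 0"
  shows "(\<lambda>(x, y). f x * g y) summable_on UNIV"
proof -
  have "(\<lambda>z. norm (case z of (x, y) \<Rightarrow> f x * g y)) summable_on Sigma UNIV (\<lambda>_. UNIV)"
    by (rule Infinite_Sum.abs_summable_on_Sigma_iff[THEN iffD2])
      (use assms in \<open>auto simp: infsum_cmult_right' infsum_nonneg
        intro!: summable_on_cmult_right summable_on_cmult_left\<close>)
  moreover have "(\<lambda>z. norm (case z of (x, y) \<Rightarrow> f x * g y)) = (\<lambda>(x, y). f x * g y)"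
    using assms by (auto simp: fun_eq_iff)
  ultimately show ?thesis by simp
qed

text \<open>Absorbs both the sign and the condition sg(r) = sg(s), so that the sum runs over all
  pairs of integers and can be reindexed by bijections of the whole lattice.\<close>

definition hsign :: "int \<Rightarrow> int \<Rightarrow> complex" where
  "hsign r s = (if r \<ge> 0 \<and> s \<ge> 0 then 1 else if r < 0 \<and> s < 0 then - 1 else 0)"

definition hterm :: "int \<Rightarrow> int \<Rightarrow> int \<Rightarrow> complex \<Rightarrow> complex \<Rightarrow> complex \<Rightarrow> int \<Rightarrow> int \<Rightarrow> complex" where
  "hterm a b c x y q r s =
     (-1) powi (r + s) * x powi r * y powi s * q powi (a * choose2 r + b * r * s + c * choose2 s)"

lemma hecke_f_eq:
  "hecke_f a b c x y q = (\<Sum>\<^sub>\<infinity>(r, s). hsign r s * hterm a b c x y q r s)"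
  unfolding hecke_f_def
  by (rule infsum_cong_neutral) (auto simp: sg_def hsign_def hterm_def split: if_splits)

text \<open>Where \<open>hsign\<close> is nonzero, r s \<ge> 0, so the mixed exponent b r s only
  makes the term smaller. Dropping it leaves a product of two Gaussian series.\<close>

lemma norm_hterm_le:
  assumes "0 < norm q" "norm q < 1" "a > 0" "b \<ge> 0" "c > 0" "x \<noteq> 0" "y \<noteq> 0"
  shows "norm (hsign r s * hterm a b c x y q r s) \<le>
    (norm (q powi a) powi choose2 r * norm (x powi r)) * (norm (q powi c) powi choose2 s * norm (y powi s))"
proof (cases "hsign r s = 0")
  case True
  thus ?thesis by simp
next
  case False
  hence rs: "r * s \<ge> 0" and h1: "norm (hsign r s) = 1"
    by (auto simp: hsign_def mult_nonpos_nonpos split: if_splits)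
  have "norm q powi (b * r * s) \<le> norm q powi 0"
    using assms rs by (intro power_int_decreasing) (auto simp: mult.assoc)
  hence "norm q powi (a * choose2 r + b * r * s + c * choose2 s) \<le> norm q powi (a * choose2 r) * 1 * norm q powi (c * choose2 s)"
    using assms by (simp add: power_int_add mult_right_mono mult_left_le)
  hence "norm (x powi r) * norm (y powi s) * norm q powi (a * choose2 r + b * r * s + c * choose2 s) \<le> 
      norm (x powi r) * norm (y powi s) * (norm q powi (a * choose2 r) * 1 * norm q powi (c * choose2 s))"
    by (intro mult_left_mono) auto
  thus ?thesis using h1
    by (simp add: hterm_def norm_mult norm_power_int power_int_mult mult_ac)
qed

lemma hterm_summable:
  assumes "0 < norm q" "norm q < 1" "a > 0" "b \<ge> 0" "c > 0" "x \<noteq> 0" "y \<noteq> 0"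
  shows "(\<lambda>(r, s). hsign r s * hterm a b c x y q r s) summable_on UNIV"
proof (rule abs_summable_summable[OF Infinite_Sum.abs_summable_on_comparison_test'])
  show "(\<lambda>(r, s). (norm (q powi a) powi choose2 r * norm (x powi r)) *
      (norm (q powi c) powi choose2 s * norm (y powi s))) summable_on UNIV"
    unfolding norm_power_int using assms norm_powi_less_1[OF assms(1,2)]
    by (intro summable_on_product_nonneg summable_gauss) (auto simp: norm_power_int)
  show "norm (case z of (r, s) \<Rightarrow> hsign r s * hterm a b c x y q r s) \<le>
     (case z of (r, s) \<Rightarrow> (norm (q powi a) powi choose2 r * norm (x powi r)) *
      (norm (q powi c) powi choose2 s * norm (y powi s)))" for z
    using norm_hterm_le[OF assms] by (cases z) auto
qed

text \<open>Formulated along a holomorphic curve, so that it covers both the line y = w x and the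
  variation of y with x fixed.\<close>

lemma hecke_f_holomorphic:
  assumes "0 < norm q" "norm q < 1" "a > 0" "b \<ge> 0" "c > 0"
    and "open U" "X holomorphic_on U" "Y holomorphic_on U"
    and nz: "\<And>z. z \<in> U \<Longrightarrow> X z \<noteq> 0" "\<And>z. z \<in> U \<Longrightarrow> Y z \<noteq> 0"
  shows "(\<lambda>z. hecke_f a b c (X z) (Y z) q) holomorphic_on U"
  unfolding hecke_f_eq
proof (rule infsum_holomorphic[OF \<open>open U\<close>])
  show "(\<lambda>z. case k of (r, s) \<Rightarrow> hsign r s * hterm a b c (X z) (Y z) q r s) holomorphic_on U" for k
    using assms by (cases k) (auto simp: hterm_def intro!: holomorphic_intros)
  fix z assume z: "z \<in> U"
  have "\<forall>\<^sub>F w in nhds z. w \<in> U \<and> dist (X z) (X w) \<le> norm (X z) / 2 \<and> dist (Y z) (Y w) \<le> norm (Y z) / 2"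
  proof -
    have cont: "isCont X z" "isCont Y z"
      using assms z holomorphic_on_imp_continuous_on continuous_on_eq_continuous_at by blast+
    have "\<forall>\<^sub>F w in nhds z. dist (X w) (X z) < norm (X z) / 2" "\<forall>\<^sub>F w in nhds z. dist (Y w) (Y z) < norm (Y z) / 2"
      using cont nz[OF z] by (intro isCont_eventually_dist; simp)+
    moreover have "\<forall>\<^sub>F w in nhds z. w \<in> U"
      using assms z by (intro eventually_nhds_in_open)
    ultimately show ?thesis by eventually_elim (auto simp: dist_commute)
  qed
  then obtain e where e: "e > 0" "\<And>w. dist w z < e \<Longrightarrow> w \<in> U \<and> dist (X z) (X w) \<le> norm (X z) / 2 \<and> dist (Y z) (Y w) \<le> norm (Y z) / 2"
    unfolding eventually_nhds_metric by blast
  let ?g = "\<lambda>d (x::complex) r. norm (q powi d) powi choose2 r * ((2 * norm x) powi r + (norm x / 2) powi r)"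
  let ?M = "\<lambda>(r, s). ?g a (X z) r * ?g c (Y z) s"
  have "?g d x summable_on UNIV" if "x \<noteq> 0" "d > 0" for d x
    unfolding distrib_left using that norm_powi_less_1[OF assms(1,2) that(2)]
    by (intro summable_on_add summable_gauss) auto
  hence "?M summable_on UNIV"
    using nz[OF z] assms by (intro summable_on_product_nonneg) auto
  moreover have "norm (case k of (r, s) \<Rightarrow> hsign r s * hterm a b c (X w) (Y w) q r s) \<le> ?M k"
    if w: "w \<in> cball z (e/2)" for k w
  proof -
    obtain r s where k: "k = (r, s)" by force
    have w': "w \<in> U" "dist (X z) (X w) \<le> norm (X z) / 2" "dist (Y z) (Y w) \<le> norm (Y z) / 2"
      using e(2)[of w] e(1) w by (auto simp: dist_commute)
    have "norm (hsign r s * hterm a b c (X w) (Y w) q r s) \<le>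
      (norm (q powi a) powi choose2 r * norm (X w powi r)) * (norm (q powi c) powi choose2 s * norm (Y w powi s))"
      using assms nz w' by (intro norm_hterm_le) auto
    also have "\<dots> \<le> ?g a (X z) r * ?g c (Y z) s"
      using norm_ball_bounds[OF w'(2)] norm_ball_bounds[OF w'(3)] nz[OF z]
      by (intro mult_mono mult_left_mono norm_power_int_le) auto
    finally show ?thesis by (simp add: k)
  qed
  moreover have "cball z (e/2) \<subseteq> U" using e by (force simp: dist_commute)
  ultimately show "\<exists>r>0. \<exists>M. cball z r \<subseteq> U \<and> M summable_on UNIV \<and>
     (\<forall>k\<in>UNIV. \<forall>w\<in>cball z r. norm (case k of (r, s) \<Rightarrow> hsign r s * hterm a b c (X w) (Y w) q r s) \<le> M k)"
    using e(1) by (intro exI[of _ "e/2"] conjI exI[of _ ?M]) auto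
qed

lemma hecke_f_swap: "hecke_f a b a x y q = hecke_f a b a y x q"
proof -
  have "bij_betw (\<lambda>(r, s). (s, r)) (UNIV :: (int \<times> int) set) UNIV"
    by (rule bij_betwI[where g = "\<lambda>(r, s). (s, r)"]) auto
  from infsum_reindex_bij_betw[OF this, of "\<lambda>(r, s). hsign r s * hterm a b a x y q r s"]
  have "(\<Sum>\<^sub>\<infinity>(r, s). hsign s r * hterm a b a x y q s r) = hecke_f a b a x y q"
    unfolding hecke_f_eq by (simp add: case_prod_unfold)
  moreover have "hsign s r * hterm a b a x y q s r = hsign r s * hterm a b a y x q r s" for r s
    by (auto simp: hsign_def hterm_def mult_ac add_ac)
  ultimately show ?thesis unfolding hecke_f_eq by simp
qed

text \<open>The involution \<open>(r, s) \<mapsto> (- 1 - s, - 1 - r)\<close> reverses the sign of every term.\<close>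

lemma hecke_f_zero:
  assumes "0 < norm q" "norm q < 1" "x \<noteq> 0" "y \<noteq> 0" "x * y = q powi (2 * a + b)"
  shows "hecke_f a b a x y q = 0"
proof -
  have q0: "q \<noteq> 0" using assms by auto
  let ?F = "\<lambda>(r, s). hsign r s * hterm a b a x y q r s"
  have "bij_betw (\<lambda>(r, s). (- 1 - s, - 1 - r)) (UNIV :: (int \<times> int) set) UNIV"
    by (rule bij_betwI[where g = "\<lambda>(r, s). (- 1 - s, - 1 - r)"]) auto
  from infsum_reindex_bij_betw[OF this, of ?F]
  have "(\<Sum>\<^sub>\<infinity>(r, s). ?F (- 1 - s, - 1 - r)) = hecke_f a b a x y q"
    unfolding hecke_f_eq by (simp add: case_prod_unfold)
  moreover have "?F (- 1 - s, - 1 - r) = - ?F (r, s)" for r s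
  proof -
    have h: "hsign (- 1 - s) (- 1 - r) = - hsign r s"
      by (auto simp: hsign_def)
    have c: "choose2 (- 1 - t) = choose2 t + 2 * t + 1" for t
      using two_choose2[of "- 1 - t"] two_choose2[of t] by (simp add: algebra_simps)
    have "x powi (- 1 - s) * y powi (- 1 - r) = (x * y) powi (- 1 - r - s) * (x powi r * y powi s)"
    proof -
      have "x powi (- 1 - s) = x powi (- 1 - r - s) * x powi r" "y powi (- 1 - r) = y powi (- 1 - r - s) * y powi s"
        using assms by (simp_all flip: power_int_add)
      thus ?thesis by (simp add: power_int_mult_distrib)
    qed
    also have "(x * y) powi (- 1 - r - s) = q powi ((2 * a + b) * (- 1 - r - s))"
      unfolding assms(5) by (simp add: power_int_mult)
    finally have 1: "x powi (- 1 - s) * y powi (- 1 - r) * q powi E =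
       x powi r * y powi s * q powi ((2 * a + b) * (- 1 - r - s) + E)" for E
      using q0 by (simp add: power_int_add)
    have "(2 * a + b) * (- 1 - r - s) + (a * choose2 (- 1 - s) + b * (- 1 - s) * (- 1 - r) + a * choose2 (- 1 - r))
       = a * choose2 r + b * r * s + a * choose2 s"
      unfolding c by (simp add: algebra_simps)
    note 2 = 1[of "a * choose2 (- 1 - s) + b * (- 1 - s) * (- 1 - r) + a * choose2 (- 1 - r)", unfolded this]
    have 3: "(-1) powi (- 1 - s + (- 1 - r)) = ((-1) powi (r + s) :: complex)"
    proof -
      have "- 1 - s + (- 1 - r) = - (r + s + 2)" by simp
      thus ?thesis by (simp only: power_int_minus_one_minus) (simp add: power_int_add)
    qed
    have "hterm a b a x y q (- 1 - s) (- 1 - r) = hterm a b a x y q r s"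
      unfolding hterm_def 3 using 2 by (simp only: mult.assoc)
    thus ?thesis by (simp add: h)
  qed
  ultimately have "hecke_f a b a x y q = - hecke_f a b a x y q"
    unfolding hecke_f_eq by (simp add: case_prod_unfold infsum_uminus)
  thus ?thesis by simp
qed

lemma has_sum_axis:
  assumes "((\<lambda>r. g r) has_sum S) (UNIV :: int set)"
  shows "((\<lambda>(r, s). if s = 0 then g r else 0) has_sum S) (UNIV :: (int \<times> int) set)"
    and "((\<lambda>(s, r). if s = 0 then g r else 0) has_sum S) (UNIV :: (int \<times> int) set)"
proof -
  have "((\<lambda>(r, s). g r) has_sum S) ((\<lambda>r. (r, 0::int)) ` UNIV)"
    by (subst has_sum_reindex) (use assms in \<open>auto simp: inj_on_def o_def\<close>)
  thus "((\<lambda>(r, s). if s = 0 then g r else 0) has_sum S) (UNIV :: (int \<times> int) set)"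
    by (subst has_sum_cong_neutral[where T = "(\<lambda>r. (r, 0::int)) ` UNIV" and g = "\<lambda>(r, s). g r"]) auto
  have "((\<lambda>(s, r). g r) has_sum S) ((\<lambda>r. (0::int, r)) ` UNIV)"
    by (subst has_sum_reindex) (use assms in \<open>auto simp: inj_on_def o_def\<close>)
  thus "((\<lambda>(s, r). if s = 0 then g r else 0) has_sum S) (UNIV :: (int \<times> int) set)"
    by (subst has_sum_cong_neutral[where T = "(\<lambda>r. (0::int, r)) ` UNIV" and g = "\<lambda>(s, r). g r"]) auto
qed

text \<open>The diagonal translation (r, s) -> (r + 1, s + 1) moves the two quadrants; what it
  uncovers is the two coordinate axes, each carrying a complete theta series.\<close>

lemma hecke_f_shift:
  assumes "0 < norm q" "norm q < 1" "a > 0" "b \<ge> 0" "x \<noteq> 0" "y \<noteq> 0"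
  shows "hecke_f a b a x y q =
    q powi b * x * y * hecke_f a b a (q powi (a + b) * x) (q powi (a + b) * y) q
    + jtheta x (q powi a) + jtheta y (q powi a)"
proof -
  have q0: "q \<noteq> 0" using assms by auto
  let ?h = "hterm a b a x y q" and ?p = "q powi (a + b)"
  have p0: "?p \<noteq> 0" using q0 by simp
  have "((\<lambda>(r, s). hsign r s * hterm a b a (?p * x) (?p * y) q r s) has_sum hecke_f a b a (?p * x) (?p * y) q) UNIV"
    unfolding hecke_f_eq using assms p0 by (intro has_sum_infsum hterm_summable) auto
  hence "((\<lambda>z. (q powi b * x * y) * (\<lambda>(r, s). hsign r s * hterm a b a (?p * x) (?p * y) q r s) z) has_sum
      (q powi b * x * y) * hecke_f a b a (?p * x) (?p * y) q) UNIV"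
    by (rule has_sum_cmult_right)
  moreover have "(q powi b * x * y) * (hsign r s * hterm a b a (?p * x) (?p * y) q r s) = hsign r s * ?h (r + 1) (s + 1)" for r s
  proof -
    have "a * choose2 (r + 1) + b * (r + 1) * (s + 1) + a * choose2 (s + 1) =
       (a * choose2 r + b * r * s + a * choose2 s) + b + (a + b) * r + (a + b) * s"
      by (simp add: choose2_add algebra_simps)
    hence "q powi (a * choose2 (r + 1) + b * (r + 1) * (s + 1) + a * choose2 (s + 1)) =
       q powi (a * choose2 r + b * r * s + a * choose2 s) * q powi b * ?p powi r * ?p powi s"
      using q0 by (simp only: power_int_add power_int_mult simp_thms)
    moreover have "(-1) powi (r + 1 + (s + 1)) = ((-1) powi (r + s) :: complex)"
      by (simp add: power_int_add)
    ultimately show ?thesis unfolding hterm_def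
      using assms by (simp add: power_int_mult_distrib power_int_add_1)
  qed
  ultimately have "((\<lambda>(r, s). hsign r s * ?h (r + 1) (s + 1)) has_sum
      (q powi b * x * y) * hecke_f a b a (?p * x) (?p * y) q) UNIV"
    by (simp add: case_prod_unfold)
  moreover have bij: "bij_betw (\<lambda>(r, s). (r - 1, s - 1)) (UNIV :: (int \<times> int) set) UNIV"
    by (rule bij_betwI[where g = "\<lambda>(r, s). (r + 1, s + 1)"]) auto
  ultimately have A: "((\<lambda>(r, s). hsign (r - 1) (s - 1) * ?h r s) has_sum
      (q powi b * x * y) * hecke_f a b a (?p * x) (?p * y) q) UNIV"
    using has_sum_reindex_bij_betw[OF bij, of "\<lambda>(r, s). hsign r s * ?h (r + 1) (s + 1)"]
    by (simp add: case_prod_unfold)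
  have qa: "0 < norm (q powi a)" "norm (q powi a) < 1"
    using norm_powi_less_1[OF assms(1-3)] by auto
  have hx: "?h r 0 = theta_term (q powi a) x r" and hy: "?h 0 r = theta_term (q powi a) y r" for r
    by (simp_all add: hterm_def theta_term_def power_int_mult)
  have B: "((\<lambda>(r, s). if s = 0 then ?h r 0 else 0) has_sum jtheta x (q powi a)) (UNIV :: (int \<times> int) set)"
    unfolding hx by (rule has_sum_axis(1)[OF jacobi_triple_product[OF qa assms(5)]])
  have C: "((\<lambda>(r, s). if r = 0 then ?h 0 s else 0) has_sum jtheta y (q powi a)) (UNIV :: (int \<times> int) set)"
    unfolding hy by (rule has_sum_axis(2)[OF jacobi_triple_product[OF qa assms(6)]])
  \<comment> \<open>The sign jumps by 1 along each axis in both directions; at the origin it jumps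
    from -1 to 1, which accounts for both axes.\<close>
  have "hsign r s * ?h r s = hsign (r - 1) (s - 1) * ?h r s + (if s = 0 then ?h r 0 else 0) + (if r = 0 then ?h 0 s else 0)" for r s
    by (auto simp: hsign_def)
  hence "((\<lambda>(r, s). hsign r s * ?h r s) has_sum
     (q powi b * x * y) * hecke_f a b a (?p * x) (?p * y) q + jtheta x (q powi a) + jtheta y (q powi a)) UNIV"
    using has_sum_add[OF has_sum_add[OF A B] C] by (simp add: case_prod_unfold)
  thus ?thesis unfolding hecke_f_eq[of a b a x y] by (simp add: infsumI)
qed

section \<open>Bilateral Lambert sums\<close>

text \<open>The numerator of m, with \<open>v\<close> in the role of the product x z. The index set
  is a parameter so that a singular term can be split off.\<close>

definition lerch_on :: "int set \<Rightarrow> complex \<Rightarrow> complex \<Rightarrow> complex \<Rightarrow> complex" where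
  "lerch_on X Q v z = (\<Sum>\<^sub>\<infinity>r\<in>X. theta_term Q z r / (1 - Q powi (r - 1) * v))"

abbreviation lerch :: "complex \<Rightarrow> complex \<Rightarrow> complex \<Rightarrow> complex" where
  "lerch \<equiv> lerch_on UNIV"

lemma appell_m_eq_lerch: "appell_m x q z = lerch q (x * z) z / jtheta z q"
  by (simp add: appell_m_def lerch_on_def theta_term_def mult.assoc)

text \<open>For large |r - 1| one of the two summands of the denominator dominates, and a minimum
  covers the finitely many other indices. The weight 1 + |Q|^(r-1) is kept so that the bound
  survives a perturbation of \<open>v\<close>.\<close>

lemma lerch_denom_bound:
  fixes Q v :: complex
  assumes Q: "0 < norm Q" "norm Q < 1" and v: "v \<noteq> 0"
    and nz: "\<And>r. r \<in> X \<Longrightarrow> 1 - Q powi (r - 1) * v \<noteq> 0"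
  obtains \<delta> where "\<delta> > 0"
    "\<And>r. r \<in> X \<Longrightarrow> \<delta> * (1 + norm Q powi (r - 1)) \<le> norm (1 - Q powi (r - 1) * v)"
proof -
  define c where "c = (\<lambda>r. norm Q powi (r - 1))"
  have c: "c r > 0" for r using Q by (simp add: c_def)
  have up: "norm (1 - Q powi (r - 1) * v) \<ge> 1 - c r * norm v"
    and lo: "norm (1 - Q powi (r - 1) * v) \<ge> c r * norm v - 1" for r
    using norm_triangle_ineq2[of 1 "Q powi (r - 1) * v"] norm_triangle_ineq3[of 1 "Q powi (r - 1) * v"]
    by (auto simp: c_def norm_mult norm_power_int)
  \<comment> \<open>The bounds 1 and 1 / (2 |v|) give |Q^(r-1) v| \<le> 1/2 for large r; 1 and |v| /
    2 give |Q^(r-1) v| \<ge> 2 for very negative r.\<close>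
  obtain N where N: "norm Q ^ N < min 1 (min (1 / (2 * norm v)) (norm v / 2))"
    using real_arch_pow_inv[of "min 1 (min (1 / (2 * norm v)) (norm v / 2))" "norm Q"] Q v by auto
  have big: "norm (1 - Q powi (r - 1) * v) \<ge> 1/4 * (1 + c r)" if "r - 1 \<ge> int N" for r
  proof -
    have "c r \<le> norm Q powi (int N)"
      unfolding c_def using that Q by (intro power_int_decreasing) auto
    hence 1: "c r < 1" "c r < 1 / (2 * norm v)" using N by auto
    hence "c r * norm v \<le> 1/2" using v by (simp add: field_simps)
    with up[of r] 1 show ?thesis by simp
  qed
  have small: "norm (1 - Q powi (r - 1) * v) \<ge> norm v / 4 * (1 + c r)" if "r - 1 \<le> - int N" for r
  proof -
    have "norm Q powi (- int N) \<le> c r"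
      unfolding c_def using that Q by (intro power_int_decreasing) auto
    hence 1: "1 \<le> c r * norm Q ^ N"
      using Q by (simp add: power_int_minus field_simps)
    have "c r * norm Q ^ N \<le> c r * 1" "c r * norm Q ^ N \<le> c r * (norm v / 2)"
      using N c[of r] by (intro mult_left_mono; simp)+
    moreover have "c r * (norm v / 2) = c r * norm v / 2" by simp
    ultimately have 2: "c r \<ge> 1" "c r * norm v \<ge> 2" using 1 by linarith+
    have "norm v / 4 * (1 + c r) \<le> norm v / 4 * (c r + c r)"
      using 2 by (intro mult_left_mono) auto
    also have "\<dots> \<le> c r * norm v - 1" using 2 by (simp add: field_simps)
    finally show ?thesis using lo[of r] by simp
  qed
  define F where "F = {- int N..int N + 1} \<inter> X"
  define g where "g = (\<lambda>r. norm (1 - Q powi (r - 1) * v) / (1 + c r))"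
  have c1: "1 + c r > 0" for r using c[of r] by simp
  have gpos: "g r > 0" if "r \<in> X" for r using nz[OF that] c1[of r] by (simp add: g_def)
  define d where "d = Min (insert (1/4) (insert (norm v / 4) (g ` F)))"
  have fin: "finite (insert (1/4) (insert (norm v / 4) (g ` F)))" by (simp add: F_def)
  have "d > 0"
    unfolding d_def using v gpos by (subst Min_gr_iff) (auto simp: F_def)
  moreover have "d * (1 + norm Q powi (r - 1)) \<le> norm (1 - Q powi (r - 1) * v)" if "r \<in> X" for r
  proof -
    have "r - 1 \<ge> int N \<or> r - 1 \<le> - int N \<or> r \<in> F"
      using that by (auto simp: F_def)
    then consider "r - 1 \<ge> int N" | "r - 1 \<le> - int N" | "r \<in> F" by blast
    thus ?thesis
    proof cases
      case 1
      have "d \<le> 1/4" unfolding d_def by (rule Min_le[OF fin]) auto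
      hence "d * (1 + c r) \<le> 1/4 * (1 + c r)" using c1[of r] by (intro mult_right_mono) auto
      thus ?thesis using big[OF 1] by (simp add: c_def)
    next
      case 2
      have "d \<le> norm v / 4" unfolding d_def by (rule Min_le[OF fin]) auto
      hence "d * (1 + c r) \<le> norm v / 4 * (1 + c r)" using c1[of r] by (intro mult_right_mono) auto
      thus ?thesis using small[OF 2] by (simp add: c_def)
    next
      case 3
      hence "d \<le> g r" unfolding d_def by (intro Min_le[OF fin]) auto
      hence "d * (1 + c r) \<le> g r * (1 + c r)" using c1[of r] by (intro mult_right_mono) auto
      also have "\<dots> = norm (1 - Q powi (r - 1) * v)" using c1[of r] by (simp add: g_def)
      finally show ?thesis by (simp add: c_def)
    qed
  qed
  ultimately show ?thesis by (rule that)
qed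

text \<open>Moving \<open>v\<close> to \<open>w\<close> changes the denominator by at most |Q|^(r-1)
  \<delta> / 2, half of the growing part of the weighted bound, hence uniformly in
  \<open>r\<close>.\<close>

lemma lerch_denom_perturb:
  fixes Q v w :: complex
  assumes "\<delta> > 0" "norm Q > 0" "\<delta> * (1 + norm Q powi (r - 1)) \<le> norm (1 - Q powi (r - 1) * v)"
    and "dist v w \<le> \<delta> / 2"
  shows "\<delta> / 2 \<le> norm (1 - Q powi (r - 1) * w)"
proof -
  let ?c = "norm Q powi (r - 1)"
  have c: "?c > 0" using assms by simp
  have "norm (Q powi (r - 1) * (w - v)) = ?c * dist v w"
    by (simp add: norm_mult norm_power_int dist_norm norm_minus_commute)
  also have "\<dots> \<le> ?c * (\<delta> / 2)" using c assms by (intro mult_left_mono) auto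
  finally have "norm (Q powi (r - 1) * (w - v)) \<le> ?c * (\<delta> / 2)" .
  moreover have "norm (1 - Q powi (r - 1) * v) \<le> norm (1 - Q powi (r - 1) * w) + norm (Q powi (r - 1) * (w - v))"
    using norm_triangle_ineq[of "1 - Q powi (r - 1) * w" "Q powi (r - 1) * (w - v)"]
    by (simp add: algebra_simps)
  moreover have "\<delta> * ?c \<ge> 0" using assms c by simp
  moreover have "\<delta> * (1 + ?c) = \<delta> + \<delta> * ?c" "?c * (\<delta> / 2) = \<delta> * ?c / 2"
    by (simp_all add: algebra_simps)
  ultimately show ?thesis using assms(1,3) by linarith
qed

lemma lerch_summable:
  assumes Q: "0 < norm Q" "norm Q < 1" and "v \<noteq> 0" "z \<noteq> 0"
    and nz: "\<And>r. r \<in> X \<Longrightarrow> 1 - Q powi (r - 1) * v \<noteq> 0"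
  shows "(\<lambda>r. theta_term Q z r / (1 - Q powi (r - 1) * v)) summable_on X"
proof -
  obtain \<delta> where d: "\<delta> > 0"
    "\<And>r. r \<in> X \<Longrightarrow> \<delta> * (1 + norm Q powi (r - 1)) \<le> norm (1 - Q powi (r - 1) * v)"
    using lerch_denom_bound[OF Q assms(3) nz] by blast
  have "(\<lambda>r. norm (theta_term Q z r) * (1 / (\<delta> / 2))) summable_on X"
    using theta_term_abs_summable[OF Q assms(4)]
    by (intro summable_on_cmult_left) (auto intro: summable_on_subset_banach)
  moreover have "norm (theta_term Q z r / (1 - Q powi (r - 1) * v)) \<le> norm (theta_term Q z r) * (1 / (\<delta> / 2))"
    if "r \<in> X" for r
    using lerch_denom_perturb[OF d(1) Q(1) d(2)[OF that], of v] d(1) nz[OF that]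
    unfolding norm_divide divide_inverse[of "norm (theta_term Q z r)"]
    by (intro mult_left_mono) (auto simp: field_simps)
  ultimately show ?thesis
    by (rule abs_summable_summable[OF Infinite_Sum.abs_summable_on_comparison_test'])
qed

lemma holomorphic_lerch_on:
  assumes Q: "0 < norm Q" "norm Q < 1" and "open U" "V holomorphic_on U" "Z holomorphic_on U"
    and nz: "\<And>s. s \<in> U \<Longrightarrow> V s \<noteq> 0" "\<And>s. s \<in> U \<Longrightarrow> Z s \<noteq> 0"
      "\<And>s r. s \<in> U \<Longrightarrow> r \<in> X \<Longrightarrow> 1 - Q powi (r - 1) * V s \<noteq> 0"
  shows "(\<lambda>s. lerch_on X Q (V s) (Z s)) holomorphic_on U"
  unfolding lerch_on_def
proof (rule infsum_holomorphic[OF \<open>open U\<close>])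
  show "(\<lambda>s. theta_term Q (Z s) r / (1 - Q powi (r - 1) * V s)) holomorphic_on U" if "r \<in> X" for r
    unfolding theta_term_def using assms that by (intro holomorphic_intros) auto
  fix s assume s: "s \<in> U"
  obtain \<delta> where d: "\<delta> > 0"
    "\<And>r. r \<in> X \<Longrightarrow> \<delta> * (1 + norm Q powi (r - 1)) \<le> norm (1 - Q powi (r - 1) * V s)"
    using lerch_denom_bound[OF Q nz(1)[OF s] nz(3)[OF s]] by blast
  have "\<forall>\<^sub>F w in nhds s. w \<in> U \<and> dist (V s) (V w) \<le> \<delta> / 2 \<and> dist (Z s) (Z w) \<le> norm (Z s) / 2"
  proof -
    have cont: "isCont V s" "isCont Z s"
      using assms s holomorphic_on_imp_continuous_on continuous_on_eq_continuous_at by blast+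
    have "\<forall>\<^sub>F w in nhds s. dist (V w) (V s) < \<delta> / 2" "\<forall>\<^sub>F w in nhds s. dist (Z w) (Z s) < norm (Z s) / 2"
      using cont nz(2)[OF s] d(1) by (intro isCont_eventually_dist; simp)+
    moreover have "\<forall>\<^sub>F w in nhds s. w \<in> U"
      using assms s by (intro eventually_nhds_in_open)
    ultimately show ?thesis by eventually_elim (auto simp: dist_commute)
  qed
  then obtain e where e: "e > 0" "\<And>w. dist w s < e \<Longrightarrow> w \<in> U \<and> dist (V s) (V w) \<le> \<delta> / 2 \<and> dist (Z s) (Z w) \<le> norm (Z s) / 2"
    unfolding eventually_nhds_metric by blast
  let ?M = "\<lambda>r. norm Q powi choose2 r * ((2 * norm (Z s)) powi r + (norm (Z s) / 2) powi r) * (1 / (\<delta> / 2))"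
  have "(\<lambda>r. norm Q powi choose2 r * ((2 * norm (Z s)) powi r + (norm (Z s) / 2) powi r)) summable_on UNIV"
    unfolding distrib_left using nz(2)[OF s] Q
    by (intro summable_on_add summable_gauss) auto
  hence "?M summable_on X"
    by (intro summable_on_cmult_left) (auto intro: summable_on_subset_banach)
  moreover have "norm (theta_term Q (Z w) r / (1 - Q powi (r - 1) * V w)) \<le> ?M r"
    if w: "w \<in> cball s (e/2)" and r: "r \<in> X" for w r
  proof -
    have w': "w \<in> U" "dist (V s) (V w) \<le> \<delta> / 2" "dist (Z s) (Z w) \<le> norm (Z s) / 2"
      using e(2)[of w] e(1) w by (auto simp: dist_commute)
    have 1: "norm (theta_term Q (Z w) r) \<le> norm Q powi choose2 r * ((2 * norm (Z s)) powi r + (norm (Z s) / 2) powi r)"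
      unfolding norm_theta_term norm_power_int[symmetric]
      using norm_ball_bounds[OF w'(3)] nz(2)[OF s] by (intro mult_left_mono norm_power_int_le) auto
    have 2: "1 / norm (1 - Q powi (r - 1) * V w) \<le> 1 / (\<delta> / 2)"
      using lerch_denom_perturb[OF d(1) Q(1) d(2)[OF r] w'(2)] d(1) nz(3)[OF w'(1) r]
      by (intro divide_left_mono mult_pos_pos) auto
    have "norm (theta_term Q (Z w) r) * (1 / norm (1 - Q powi (r - 1) * V w)) \<le> ?M r"
      using nz(2)[OF s] by (intro mult_mono 1 2) auto
    thus ?thesis by (simp add: norm_divide)
  qed
  moreover have "cball s (e/2) \<subseteq> U" using e by (force simp: dist_commute)
  ultimately show "\<exists>r>0. \<exists>M. cball s r \<subseteq> U \<and> M summable_on X \<and>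
     (\<forall>k\<in>X. \<forall>w\<in>cball s r. norm (theta_term Q (Z w) k / (1 - Q powi (k - 1) * V w)) \<le> M k)"
    using e(1) by (intro exI[of _ "e/2"] conjI exI[of _ ?M]) auto
qed

section \<open>Transformations and poles of Lambert sums\<close>

lemma lerch_shift:
  assumes Q: "0 < norm Q" "norm Q < 1" and "v \<noteq> 0" "z \<noteq> 0"
    and nz: "\<And>r. 1 - Q powi (r - 1) * v \<noteq> 0"
  shows "lerch Q (v / Q) z = - (z * Q / v) * (lerch Q v z - jtheta z Q)"
proof -
  have Q0: "Q \<noteq> 0" using Q by auto
  let ?T = "\<lambda>r. theta_term Q z r / (1 - Q powi (r - 1) * v)"
  have "(?T has_sum lerch Q v z) UNIV"
    unfolding lerch_on_def by (intro has_sum_infsum lerch_summable assms)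
  from has_sum_cmult_right[OF has_sum_add[OF this has_sum_uminusI[OF jacobi_triple_product[OF Q \<open>z \<noteq> 0\<close>]]], of "- (z * Q / v)"]
  have "((\<lambda>r. - (z * Q / v) * (?T r - theta_term Q z r)) has_sum
     - (z * Q / v) * (lerch Q v z - jtheta z Q)) UNIV" by simp
  \<comment> \<open>With d = Q^(r-1) v, moving the index by one puts a factor proportional to d into
    the numerator, and d / (1 - d) = 1 / (1 - d) - 1. The term -1 sums to the theta
    function.\<close>
  moreover have "- (z * Q / v) * (?T r - theta_term Q z r) =
      theta_term Q z (r + 1) / (1 - Q powi (r + 1 - 1) * (v / Q))" for r
  proof -
    define d where "d = Q powi (r - 1) * v"
    have e: "Q powi (r + 1 - 1) * (v / Q) = d" 
      using Q0 by (simp add: d_def power_int_diff)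
    have "theta_term Q z (r + 1) = - z * Q powi r * theta_term Q z r"
      using Q0 assms by (simp add: theta_term_def choose2_add power_int_add)
    moreover have "Q powi r = d * Q / v"
      using Q0 assms by (simp add: d_def power_int_diff)
    moreover have "1 - d \<noteq> 0" using nz[of r] by (simp add: d_def)
    ultimately show ?thesis unfolding e d_def[symmetric] using assms
      by (simp add: field_simps)
  qed
  ultimately have "((\<lambda>r. theta_term Q z (r + 1) / (1 - Q powi (r + 1 - 1) * (v / Q))) has_sum
     - (z * Q / v) * (lerch Q v z - jtheta z Q)) UNIV" by simp
  from has_sum_int_shift[OF this, of "-1"]
  show ?thesis unfolding lerch_on_def by (simp add: infsumI)
qed

text \<open>The reversal r -> 2 - r is centred at r = 1, where the power of Q in the denominator is
  trivial; it turns Q^(r-1) into its inverse.\<close>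

lemma lerch_invert:
  assumes Q: "Q \<noteq> 0" and "v \<noteq> 0" "z \<noteq> 0"
  shows "lerch Q v z = - (z\<^sup>2 / v) * lerch Q (1 / v) (1 / z)"
proof -
  let ?T = "\<lambda>r. theta_term Q z r / (1 - Q powi (r - 1) * v)"
  have "bij_betw (\<lambda>r::int. 2 - r) UNIV UNIV"
    by (rule bij_betwI[where g = "\<lambda>r. 2 - r"]) auto
  from infsum_reindex_bij_betw[OF this, of ?T]
  have "lerch Q v z = (\<Sum>\<^sub>\<infinity>r. ?T (2 - r))" by (simp add: lerch_on_def)
  moreover have "?T (2 - r) = - (z\<^sup>2 / v) * (theta_term Q (1 / z) r / (1 - Q powi (r - 1) * (1 / v)))" for r
  proof -
    have c: "choose2 (2 - r) = choose2 r + (1 - r)"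
      using two_choose2[of "2 - r"] two_choose2[of r] by (simp add: algebra_simps)
    have "z powi (2 - r) = z\<^sup>2 * (1 / z) powi r"
      using assms by (simp add: power_int_diff power_int_divide_distrib)
    moreover have "(-1) powi (2 - r) = ((-1) powi r :: complex)"
      by (simp add: power_int_diff) (simp add: field_simps flip: power_int_add)
    ultimately have 1: "theta_term Q z (2 - r) = z\<^sup>2 * Q powi (1 - r) * theta_term Q (1 / z) r"
      unfolding theta_term_def c using Q by (simp add: power_int_add)
    define d where "d = Q powi (1 - r)"
    have d0: "d \<noteq> 0" using Q by (simp add: d_def)
    have "Q powi (r - 1) = 1 / d"
      using Q by (simp add: d_def power_int_diff)
    moreover have "Q powi (2 - r - 1) = d" by (simp add: d_def)
    moreover have "1 - d * v = - (d * v) * (1 - 1 / d * (1 / v))"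
      using d0 assms by (simp add: field_simps)
    ultimately show ?thesis unfolding 1 d_def[symmetric]
      using d0 assms by simp
  qed
  ultimately show ?thesis by (simp only: infsum_cmult_right' lerch_on_def)
qed

lemma isCont_lerch_on:
  assumes Q: "0 < norm Q" "norm Q < 1" and "z \<noteq> 0" "v \<noteq> 0"
    and nz: "\<And>r. r \<in> X \<Longrightarrow> 1 - Q powi (r - 1) * v \<noteq> 0"
  shows "isCont (\<lambda>v. lerch_on X Q v z) v"
    and "\<forall>\<^sub>F u in at v. (\<lambda>r. theta_term Q z r / (1 - Q powi (r - 1) * u)) summable_on X"
proof -
  obtain \<delta> where d: "\<delta> > 0"
    "\<And>r. r \<in> X \<Longrightarrow> \<delta> * (1 + norm Q powi (r - 1)) \<le> norm (1 - Q powi (r - 1) * v)"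
    using lerch_denom_bound[OF Q \<open>v \<noteq> 0\<close> nz] by blast
  define U where "U = ball v (min (\<delta> / 2) (norm v))"
  have U: "open U" "v \<in> U" using d(1) \<open>v \<noteq> 0\<close> by (auto simp: U_def)
  have U0: "u \<noteq> 0" if "u \<in> U" for u using that by (auto simp: U_def)
  have nz': "1 - Q powi (r - 1) * u \<noteq> 0" if "u \<in> U" "r \<in> X" for u r
    using lerch_denom_perturb[OF d(1) Q(1) d(2)[OF that(2)], of u] that d(1) by (auto simp: U_def)
  have "(\<lambda>v. lerch_on X Q v z) holomorphic_on U"
    using U U0 nz' assms by (intro holomorphic_lerch_on) auto
  thus "isCont (\<lambda>v. lerch_on X Q v z) v"
    using U holomorphic_on_imp_continuous_on continuous_on_eq_continuous_at by blast
  have "\<forall>\<^sub>F u in at v. u \<in> U - {v}"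
    using U by (intro eventually_at_in_open) auto
  thus "\<forall>\<^sub>F u in at v. (\<lambda>r. theta_term Q z r / (1 - Q powi (r - 1) * u)) summable_on X"
    by eventually_elim (use nz' U0 assms in \<open>auto intro!: lerch_summable\<close>)
qed

lemma power_int_inject_less_1:
  fixes q :: complex
  assumes "0 < norm q" "norm q < 1" "q powi a = q powi b"
  shows "a = b"
proof -
  have "norm q powi a = norm q powi b" using assms(3) by (metis norm_power_int)
  thus ?thesis
    using power_int_strict_decreasing[of a b "norm q"] power_int_strict_decreasing[of b a "norm q"] assms
    by (cases a b rule: linorder_cases) auto
qed

text \<open>Only the term r = 1 is singular at v = 1, and its numerator is -z; the remaining sum is
  continuous there.\<close>

lemma lerch_pole:
  assumes Q: "0 < norm Q" "norm Q < 1" and "z \<noteq> 0"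
  shows "((\<lambda>v. (1 - v) * lerch Q v z) \<longlongrightarrow> - z) (at 1)"
proof -
  have nz: "1 - Q powi (r - 1) * 1 \<noteq> 0" if "r \<in> UNIV - {1}" for r
    using power_int_inject_less_1[OF Q, of "r - 1" 0] that by auto
  have c: "isCont (\<lambda>v. lerch_on (UNIV - {1}) Q v z) 1"
    "\<forall>\<^sub>F u in at 1. (\<lambda>r. theta_term Q z r / (1 - Q powi (r - 1) * u)) summable_on UNIV - {1}"
    using isCont_lerch_on[OF Q \<open>z \<noteq> 0\<close> one_neq_zero nz] by blast+
  have "((\<lambda>v. - z + (1 - v) * lerch_on (UNIV - {1}) Q v z) \<longlongrightarrow> - z + (1 - 1) * lerch_on (UNIV - {1}) Q 1 z) (at 1)"
    using c(1) unfolding isCont_def by (intro tendsto_intros)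
  hence lim: "((\<lambda>v. - z + (1 - v) * lerch_on (UNIV - {1}) Q v z) \<longlongrightarrow> - z) (at 1)" by simp
  have "\<forall>\<^sub>F v in at 1. v \<noteq> (1::complex)" by (simp add: eventually_at_filter)
  with c(2) have "\<forall>\<^sub>F v in at 1. - z + (1 - v) * lerch_on (UNIV - {1}) Q v z = (1 - v) * lerch Q v z"
  proof eventually_elim
    case (elim v)
    let ?T = "\<lambda>r. theta_term Q z r / (1 - Q powi (r - 1) * v)"
    have "infsum ?T (insert 1 (UNIV - {1})) = ?T 1 + infsum ?T (UNIV - {1})"
      using elim by (intro infsum_insert) auto
    hence "lerch Q v z = - z / (1 - v) + lerch_on (UNIV - {1}) Q v z"
      by (simp add: lerch_on_def theta_term_def insert_absorb)
    thus ?case using elim by (simp add: field_simps)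
  qed
  from Lim_transform_eventually[OF lim this] show ?thesis .
qed

text \<open>The value -1 is never a zero of theta, since -1 = q^k would give q^(2k) = 1 and so k =
  0. One point with this value starts the identity theorem.\<close>

lemma eventually_jtheta_nonzero:
  assumes "0 < norm q" "norm q < 1" "f holomorphic_on - {0}" "\<And>z. z \<noteq> 0 \<Longrightarrow> f z \<noteq> 0"
    and "z0 \<noteq> 0" "f z0 = - 1" "z \<noteq> 0"
  shows "\<forall>\<^sub>F u in at z. jtheta (f u) q \<noteq> 0"
proof (rule eventually_nonzero_punctured[where ?z0.0 = z0])
  show "(\<lambda>z. jtheta (f z) q) holomorphic_on - {0}"
    using assms by (intro holomorphic_jtheta_compose) auto
  show "jtheta (f z0) q \<noteq> 0"
  proof
    assume "jtheta (f z0) q = 0"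
    then obtain k where k: "- 1 = q powi k"
      using assms jtheta_eq_0_iff[OF assms(1,2), of "- 1"] by auto
    hence "q powi (2 * k) = q powi 0" by (simp add: power_int_mult mult.commute[of 2] flip: k)
    hence "2 * k = 0" by (rule power_int_inject_less_1[OF assms(1,2)])
    with k show False by simp
  qed
qed (use assms in auto)

section \<open>The Appell-Lerch side\<close>

lemma sum_int_rotate:
  fixes f :: "int \<Rightarrow> complex"
  assumes "n > 0"
  shows "(\<Sum>t = 0..n - 1. f (t + 1)) = (\<Sum>t = 0..n - 1. f t) - f 0 + f n"
proof -
  have "(\<Sum>t = 0..n - 1. f (t + 1)) = (\<Sum>t = 1..n. f t)"
    by (rule sum.reindex_bij_witness[where i = "\<lambda>t. t - 1" and j = "\<lambda>t. t + 1"]) auto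
  moreover have "(\<Sum>t = 0..n. f t) = f 0 + (\<Sum>t = 1..n. f t)"
  proof -
    have "{0..n} = insert 0 {1..n}" using assms by auto
    thus ?thesis by simp
  qed
  moreover have "(\<Sum>t = 0..n. f t) = f n + (\<Sum>t = 0..n - 1. f t)"
  proof -
    have "{0..n} = insert n {0..n - 1}" using assms by auto
    thus ?thesis by simp
  qed
  ultimately show ?thesis by (simp add: algebra_simps)
qed

lemma sum_int_reverse:
  fixes f :: "int \<Rightarrow> complex"
  shows "(\<Sum>t = 0..n - 1. f (n - 1 - t)) = (\<Sum>t = 0..n - 1. f t)"
  by (rule sum.reindex_bij_witness[where i = "\<lambda>t. n - 1 - t" and j = "\<lambda>t. n - 1 - t"]) auto

text \<open>The parity of n enters through \<open>l\<close>, the middle index of 0..n-1: it is fixed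
  by t -> n - 1 - t and carries the normalised pole.\<close>

locale hecke_n2 =
  fixes q :: complex and n l :: int
  assumes q_pos: "0 < norm q" and q_less: "norm q < 1"
    and l_nonneg: "l \<ge> 0" and n_eq: "n = 2 * l + 1"
begin

lemma q0 [simp]: "q \<noteq> 0" using q_pos by auto

lemma n_pos: "n > 0" and n_odd: "odd n" using l_nonneg n_eq by auto

text \<open>\<open>qn\<close> is the base of the theta coefficients of g and \<open>Q\<close> that
  of its Appell-Lerch sums; \<open>qD\<close>, the square of \<open>p\<close>, is the base of the
  theta quotient and of the pole lattice.\<close>

abbreviation "qn \<equiv> q powi n"
abbreviation "qD \<equiv> q powi (4 * (n + 1))"
abbreviation "Q \<equiv> q powi (4 * n * (n + 1))"
abbreviation "p \<equiv> q powi (2 * n + 2)"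

lemma qn: "0 < norm qn" "norm qn < 1"
  by (rule norm_powi_less_1[OF q_pos q_less n_pos])+

lemma qD: "0 < norm qD" "norm qD < 1"
  using norm_powi_less_1[OF q_pos q_less, of "4 * (n + 1)"] n_pos by auto

lemma Q: "0 < norm Q" "norm Q < 1"
  using norm_powi_less_1[OF q_pos q_less, of "4 * n * (n + 1)"] n_pos by auto

lemma p: "0 < norm p" "norm p < 1"
  using norm_powi_less_1[OF q_pos q_less, of "2 * n + 2"] n_pos by auto

lemma p_square: "p * p = qD"
  by (simp flip: power_int_add)

section \<open>The summands of g and their poles\<close>

definition gcoef :: "int \<Rightarrow> complex \<Rightarrow> complex \<Rightarrow> complex" where
  "gcoef t x y = (- y) powi t * q powi (n * choose2 t) * jtheta (q powi ((n + 2) * t) * x) qn"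

text \<open>The t-th first argument of m multiplied by its z-parameter, after the powers of
  \<open>y\<close> have cancelled.\<close>

definition garg :: "int \<Rightarrow> complex \<Rightarrow> complex" where
  "garg t x = - (q powi (n * (2 * n + 3) - t * (4 * (n + 1)))) / x\<^sup>2"

text \<open>\<open>half_g\<close> is the first of the two sums in \<open>g\<^bsub>n,n+2,n\<^esub>\<close>; the second arises by exchanging \<open>x\<close> and \<open>y\<close>.\<close>

definition half_g :: "complex \<Rightarrow> complex \<Rightarrow> complex" where
  "half_g x y = (\<Sum>t = 0..n - 1. gcoef t x y * lerch Q (garg t x) ((x / y) powi n)) / jtheta ((x / y) powi n) Q"

text \<open>A denominator of the theta quotient that also vanishes wherever a Lambert denominator of
  \<open>half_g\<close> in the same variable does.\<close>

definition jA :: "complex \<Rightarrow> complex" where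
  "jA x = jtheta (- (q powi (n + 2)) * x\<^sup>2) qD"

lemma garg_nonzero [simp]: "x \<noteq> 0 \<Longrightarrow> garg t x \<noteq> 0"
  by (simp add: garg_def)

text \<open>The middle index produces the exponent 3n + 2, the constant that also governs the
  reflection x y = q^(3n+2).\<close>

lemma garg_l: "garg l x = - (q powi (3 * n + 2)) / x\<^sup>2"
proof -
  have "n * (2 * n + 3) - l * (4 * (n + 1)) = 3 * n + 2"
    unfolding n_eq by (simp add: algebra_simps)
  thus ?thesis unfolding garg_def by (simp only:)
qed

lemma tendsto_garg: "k \<noteq> 0 \<Longrightarrow> (garg t \<longlongrightarrow> garg t k) (at k)"
  unfolding garg_def[abs_def] by (intro tendsto_intros) auto

text \<open>Makes \<open>garg l\<close> a local coordinate at \<open>k\<close>, so that limits at v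
  = 1 can be pulled back. It is even in x, hence the neighbourhood avoids -k.\<close>

lemma filterlim_garg_l:
  assumes "k\<^sup>2 = - (q powi (3 * n + 2))"
  shows "garg l k = 1" "filterlim (garg l) (at 1) (at k)"
proof -
  have k0: "k \<noteq> 0" using assms by auto
  show vk: "garg l k = 1" unfolding garg_l assms by simp
  show "filterlim (garg l) (at 1) (at k)"
  proof (rule filterlim_atI)
    show "(garg l \<longlongrightarrow> 1) (at k)" using tendsto_garg[OF k0, of l] vk by simp
    have "\<forall>\<^sub>F x in at k. x \<in> - {0, - k} - {k}"
      using k0 by (intro eventually_at_in_open) (auto simp: eq_neg_iff_add_eq_0)
    thus "\<forall>\<^sub>F x in at k. garg l x \<noteq> 1"
    proof eventually_elim
      case (elim x)
      have "x\<^sup>2 \<noteq> k\<^sup>2" using elim by (auto simp: power2_eq_iff)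
      thus ?case unfolding garg_l using elim assms by (auto simp: field_simps)
    qed
  qed
qed

lemma Q_powi_garg: "Q powi (r - 1) * garg t x =
    - (q powi (4 * n * (n + 1) * (r - 1) + n * (2 * n + 3) - t * (4 * (n + 1)))) / x\<^sup>2"
proof -
  have "Q powi (r - 1) = q powi (4 * n * (n + 1) * (r - 1))" by (simp only: power_int_mult)
  moreover have "q powi (4 * n * (n + 1) * (r - 1)) * q powi (n * (2 * n + 3) - t * (4 * (n + 1))) =
     q powi (4 * n * (n + 1) * (r - 1) + n * (2 * n + 3) - t * (4 * (n + 1)))"
    by (simp add: algebra_simps flip: power_int_add)
  ultimately show ?thesis unfolding garg_def by simp
qed

text \<open>For all r and t the exponents ?e are congruent to 3n + 2 modulo 4(n + 1), so one theta
  function in base \<open>qD\<close> sees every possible pole.\<close>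

lemma jA_nonzero_imp:
  assumes "x \<noteq> 0" "jA x \<noteq> 0"
  shows "1 - Q powi (r - 1) * garg t x \<noteq> 0"
proof
  let ?e = "4 * n * (n + 1) * (r - 1) + n * (2 * n + 3) - t * (4 * (n + 1))"
  assume "1 - Q powi (r - 1) * garg t x = 0"
  hence "1 + q powi ?e / x\<^sup>2 = 0" unfolding Q_powi_garg by simp
  hence "x\<^sup>2 = - (q powi ?e)" using assms(1) by (simp add: field_simps eq_neg_iff_add_eq_0)
  hence "- (q powi (n + 2)) * x\<^sup>2 = q powi (n + 2 + ?e)" by (simp add: power_int_add)
  also have "n + 2 + ?e = 4 * (n + 1) * (l + 1 + n * (r - 1) - t)"
    unfolding n_eq by (simp add: algebra_simps)
  also have "q powi \<dots> = qD powi (l + 1 + n * (r - 1) - t)" by (simp only: power_int_mult)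
  finally have "jA x = 0" unfolding jA_def
    by (intro jtheta_eq_0_iff[OF qD, THEN iffD2]) (use assms(1) in auto)
  with assms(2) show False by simp
qed

lemma appell_g_eq:
  assumes "x \<noteq> 0" "y \<noteq> 0"
  shows "appell_g n (n + 2) n x y q (y powi n / x powi n) (x powi n / y powi n) = half_g x y + half_g y x"
proof -
  have d: "n * ((n + 2)\<^sup>2 - n * n) = 4 * n * (n + 1)" "(n + 2)\<^sup>2 - n * n = 4 * (n + 1)"
    by (simp_all add: algebra_simps power2_eq_square)
  have "n * choose2 (n + 2 + 1) - n * choose2 (n + 1) = n * (2 * n + 3)"
  proof -
    have "choose2 (n + 2 + 1) = choose2 (n + 1) + (2 * n + 3)"
      using two_choose2[of "n + 2 + 1"] two_choose2[of "n + 1"] by (simp add: algebra_simps)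
    thus ?thesis by (simp add: distrib_left)
  qed
  note e = this
  \<comment> \<open>Since n is odd, both powers contribute a sign and the signs cancel.
    Multiplication by (x/y)^n removes \<open>y\<close> and leaves 1 / x^2.\<close>
  have arg: "g_arg n (n + 2) n x y q t * (x powi n / y powi n) = garg t x" if "x \<noteq> 0" "y \<noteq> 0" for x y t
  proof -
    have o: "(- y) powi n = - (y powi n)" "(- x) powi (n + 2) = - (x powi n * x\<^sup>2)"
      using n_odd that by (simp_all add: power_int_add)
    have c: "- c * (- Y / - (X * s)) * (X / Y) = - c / s" if "X \<noteq> 0" "Y \<noteq> 0" for c X Y s :: complex
      using that by simp
    have "x powi n \<noteq> 0" "y powi n \<noteq> 0" using that by auto
    thus ?thesis unfolding g_arg_def d garg_def o e by (rule c)
  qed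
  have h: "(\<Sum>t = 0..n - 1. (- y) powi t * q powi (n * choose2 t) * jtheta (q powi ((n + 2) * t) * x) qn *
        appell_m (g_arg n (n + 2) n x y q t) (q powi (n * ((n + 2)\<^sup>2 - n * n))) (x powi n / y powi n)) = half_g x y"
    if "x \<noteq> 0" "y \<noteq> 0" for x y
    unfolding half_g_def sum_divide_distrib d(1)
    by (intro sum.cong refl)
      (simp only: appell_m_eq_lerch arg[OF that] gcoef_def power_int_divide_distrib, simp)
  show ?thesis unfolding appell_g_def using h[OF assms] h[OF assms(2,1)] by simp
qed

text \<open>As (n + 2) t + 2n + 2 = n + (n + 2)(t + 1), scaling by \<open>p\<close> amounts to t ->
  t + 1 together with one period of theta in base q^n.\<close>

lemma gcoef_shift:
  assumes "x \<noteq> 0" "y \<noteq> 0"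
  shows "q powi (n + 2) * x * y * gcoef t (p * x) (p * y) = gcoef (t + 1) x y"
proof -
  let ?X = "q powi ((n + 2) * (t + 1)) * x"
  have "(n + 2) * t + (2 * n + 2) = n + (n + 2) * (t + 1)" by (simp add: algebra_simps)
  hence "q powi ((n + 2) * t) * p = qn * q powi ((n + 2) * (t + 1))"
    by (simp only: power_int_add[symmetric] q0 simp_thms)
  hence 1: "q powi ((n + 2) * t) * (p * x) = qn * ?X" by (simp add: mult_ac)
  have 2: "jtheta (qn * ?X) qn = - jtheta ?X qn / ?X"
    using assms by (intro jtheta_shift[OF qn]) auto
  have 3: "(- (p * y)) powi t = q powi ((2 * n + 2) * t) * (- y) powi t"
    unfolding minus_mult_right by (simp only: power_int_mult_distrib power_int_mult)
  have "n + 2 + (2 * n + 2) * t + n * choose2 t = n * choose2 (t + 1) + (n + 2) * (t + 1)"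
    by (simp add: choose2_add algebra_simps)
  hence 4: "q powi (n + 2) * q powi ((2 * n + 2) * t) * q powi (n * choose2 t) =
      q powi (n * choose2 (t + 1)) * q powi ((n + 2) * (t + 1))"
    by (simp only: power_int_add[symmetric] q0 simp_thms)
  have 5: "(- y) powi (t + 1) = - y * (- y) powi t"
    using assms by (simp add: power_int_add)
  have "q powi (n + 2) * x * y * gcoef t (p * x) (p * y) =
     - y * (- y) powi t * x * (q powi (n + 2) * q powi ((2 * n + 2) * t) * q powi (n * choose2 t)) * jtheta ?X qn / ?X"
    unfolding gcoef_def 1 2 3 by (simp add: mult_ac)
  also have "\<dots> = gcoef (t + 1) x y"
    unfolding 4 gcoef_def 5 using assms by (simp add: field_simps)
  finally show ?thesis .
qed

lemma garg_shift: "x \<noteq> 0 \<Longrightarrow> garg t (p * x) = garg (t + 1) x"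
proof -
  have "n * (2 * n + 3) - t * (4 * (n + 1)) = n * (2 * n + 3) - (t + 1) * (4 * (n + 1)) + 4 * (n + 1)"
    by (simp add: algebra_simps)
  hence "q powi (n * (2 * n + 3) - t * (4 * (n + 1))) = q powi (n * (2 * n + 3) - (t + 1) * (4 * (n + 1))) * qD"
    by (simp only: power_int_add[symmetric] q0 simp_thms)
  moreover have "(p * x)\<^sup>2 = qD * x\<^sup>2"
    using p_square by (simp add: power2_eq_square mult_ac)
  ultimately show ?thesis unfolding garg_def by simp
qed

text \<open>After n steps the argument has moved by exactly one period of the Lambert sum, so
  \<open>lerch_shift\<close> closes the cycle.\<close>

lemma garg_n: "garg n x = garg 0 x / Q"
proof -
  have "n * (2 * n + 3) - n * (4 * (n + 1)) = n * (2 * n + 3) - 0 * (4 * (n + 1)) - 4 * n * (n + 1)"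
    by (simp add: algebra_simps)
  thus ?thesis unfolding garg_def by (simp only: power_int_diff q0 simp_thms) simp
qed

text \<open>The second factor is the multiplier of \<open>lerch_shift\<close> at
  \<open>garg 0 x\<close>, and the right side is \<open>gcoef 0 x y\<close>: going once around the
  cycle reproduces the initial coefficient.\<close>

lemma gcoef_n:
  assumes "x \<noteq> 0" "y \<noteq> 0"
  shows "gcoef n x y * (- ((x / y) powi n * Q / garg 0 x)) = jtheta x qn"
proof -
  have 1: "jtheta (q powi ((n + 2) * n) * x) qn = (-1) powi (n + 2) * qn powi (- choose2 (n + 2)) * x powi (- (n + 2)) * jtheta x qn"
    using jtheta_shift_powi[OF qn assms(1), of "n + 2"] by (simp only: power_int_mult[symmetric] mult.commute)
  have "choose2 (n + 2) = choose2 n + (2 * n + 1)"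
    using two_choose2[of "n + 2"] two_choose2[of n] by (simp add: algebra_simps)
  hence "n * choose2 n + n * (- choose2 (n + 2)) + 4 * n * (n + 1) = n * (2 * n + 3) - 0 * (4 * (n + 1))"
    by (simp add: algebra_simps)
  hence 2: "q powi (n * choose2 n) * qn powi (- choose2 (n + 2)) * Q = q powi (n * (2 * n + 3) - 0 * (4 * (n + 1)))"
    by (simp only: power_int_mult[symmetric] power_int_add[symmetric] q0 simp_thms)
  have 3: "(-1) powi (n + 2) = (-1 :: complex)" "(- y) powi n = - (y powi n)"
    using n_odd by auto
  have 4: "x powi (- (n + 2)) * x powi n * x\<^sup>2 = 1"
  proof -
    have "x powi (- (n + 2)) * x powi n * x powi 2 = x powi (- (n + 2) + n + 2)"
      using assms by (simp only: power_int_add simp_thms)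
    thus ?thesis by simp
  qed
  have "gcoef n x y * (- ((x / y) powi n * Q / garg 0 x)) =
     (q powi (n * choose2 n) * qn powi (- choose2 (n + 2)) * Q) * (x powi (- (n + 2)) * x powi n * x\<^sup>2) * jtheta x qn
       / q powi (n * (2 * n + 3) - 0 * (4 * (n + 1)))"
    unfolding gcoef_def 1 3 garg_def using assms by (simp add: power_int_divide_distrib)
  also have "\<dots> = jtheta x qn" unfolding 2 4 by simp
  finally show ?thesis .
qed

text \<open>Scaling by \<open>p\<close> rotates the summands cyclically. The mismatch between the
  indices 0 and n is one theta function, the same as in \<open>hecke_f_shift\<close>.\<close>

lemma half_g_shift:
  assumes "x \<noteq> 0" "y \<noteq> 0" "jA x \<noteq> 0" "jtheta ((x / y) powi n) Q \<noteq> 0"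
  shows "half_g x y = q powi (n + 2) * x * y * half_g (p * x) (p * y) + jtheta x qn"
proof -
  let ?z = "(x / y) powi n"
  let ?f = "\<lambda>t. gcoef t x y * lerch Q (garg t x) ?z"
  have z: "(p * x / (p * y)) powi n = ?z" by simp
  have "q powi (n + 2) * x * y * half_g (p * x) (p * y) =
     (\<Sum>t = 0..n - 1. (q powi (n + 2) * x * y * gcoef t (p * x) (p * y)) * lerch Q (garg t (p * x)) ?z) / jtheta ?z Q"
    unfolding half_g_def z by (simp add: sum_distrib_left mult.assoc)
  also have "\<dots> = (\<Sum>t = 0..n - 1. ?f (t + 1)) / jtheta ?z Q"
    by (simp only: gcoef_shift[OF assms(1,2)] garg_shift[OF assms(1)])
  also have "\<dots> = (\<Sum>t = 0..n - 1. ?f t) / jtheta ?z Q + (?f n - ?f 0) / jtheta ?z Q"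
    unfolding sum_int_rotate[OF n_pos, of ?f] by (simp add: add_divide_distrib diff_divide_distrib)
  also have "?f n - ?f 0 = - jtheta x qn * jtheta ?z Q"
  proof -
    have "lerch Q (garg n x) ?z = - (?z * Q / garg 0 x) * (lerch Q (garg 0 x) ?z - jtheta ?z Q)"
      unfolding garg_n using assms jA_nonzero_imp by (intro lerch_shift[OF Q]) auto
    hence "?f n = jtheta x qn * (lerch Q (garg 0 x) ?z - jtheta ?z Q)"
      by (simp only: gcoef_n[OF assms(1,2), symmetric] mult.assoc)
    thus ?thesis by (simp add: gcoef_def algebra_simps)
  qed
  finally show ?thesis using assms(4) by (simp add: half_g_def)
qed

text \<open>With \<open>garg_reflect\<close> and \<open>lerch_invert\<close>, this pairs summand t
  of one half of g with summand n - 1 - t of the other, with opposite sign.\<close>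

lemma gcoef_reflect:
  assumes "x \<noteq> 0" "y \<noteq> 0" "x * y = q powi (3 * n + 2)"
  shows "gcoef t x y * ((x / y) powi n / garg t x) = - gcoef (n - 1 - t) y x"
proof -
  define X where "X = q powi ((n + 2) * t) * x"
  have X0: "X \<noteq> 0" using assms by (simp add: X_def)
  have y: "y = q powi (3 * n + 2) / x" using assms by (simp add: field_simps)
  have "(n + 2) * (n - 1 - t) + (3 * n + 2) = n * (n + 3) + n - (n + 2) * t" by (simp add: algebra_simps)
  hence "q powi ((n + 2) * (n - 1 - t)) * q powi (3 * n + 2) = q powi (n * (n + 3)) * qn / q powi ((n + 2) * t)"
    by (simp only: power_int_add[symmetric] power_int_diff[symmetric] q0 simp_thms)
  hence "q powi ((n + 2) * (n - 1 - t)) * y = q powi (n * (n + 3)) * (qn / X)"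
    unfolding y X_def by simp
  also have "q powi (n * (n + 3)) = qn powi (n + 3)" by (simp only: power_int_mult)
  finally have 1: "jtheta (q powi ((n + 2) * (n - 1 - t)) * y) qn =
      (-1) powi (n + 3) * qn powi (- choose2 (n + 3)) * (qn / X) powi (- (n + 3)) * jtheta X qn"
    using jtheta_shift_powi[OF qn, of "qn / X" "n + 3"] X0 jtheta_reflect[of X qn] by simp
  have sg: "(-1) powi (n + 3) = (1 :: complex)" "(-x) powi (n - 1 - t) = (-1) powi t * x powi (n - 1 - t)"
  proof -
    show "(-1) powi (n + 3) = (1 :: complex)" using n_odd by simp
    have "(-x) powi (n - 1 - t) = (-1) powi (n - 1 - t) * x powi (n - 1 - t)"
      using power_int_mult_distrib[of "-1" x "n - 1 - t"] by simp
    moreover have "(-1) powi (n - 1 - t) = ((-1) powi t :: complex)"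
    proof (cases "even t")
      case True
      hence "even (n - 1 - t)" using n_odd by simp
      thus ?thesis using True by simp
    next
      case False
      hence "odd (n - 1 - t)" using n_odd by simp
      thus ?thesis using False by simp
    qed
    ultimately show "(-x) powi (n - 1 - t) = (-1) powi t * x powi (n - 1 - t)" by simp
  qed
  have 2: "(qn / X) powi (- (n + 3)) = q powi (- (n * (n + 3)) + (n + 2) * t * (n + 3)) * x powi (n + 3)"
  proof -
    have "(qn / X) powi (- (n + 3)) = X powi (n + 3) / qn powi (n + 3)"
      by (simp only: power_int_minus power_int_divide_distrib inverse_divide)
    also have "X powi (n + 3) = q powi ((n + 2) * t * (n + 3)) * x powi (n + 3)"
      unfolding X_def by (simp only: power_int_mult_distrib power_int_mult)
    also have "qn powi (n + 3) = q powi (n * (n + 3))" by (simp only: power_int_mult)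
    finally show ?thesis by (simp only: power_int_add power_int_minus q0 simp_thms) (simp add: field_simps)
  qed
  let ?E1 = "n * choose2 (n - 1 - t) + n * (- choose2 (n + 3)) + (- (n * (n + 3)) + (n + 2) * t * (n + 3))"
  let ?E2 = "n * choose2 t - (n * (2 * n + 3) - t * (4 * (n + 1))) + (3 * n + 2) * (t - n)"
  \<comment> \<open>Doubling makes both exponents polynomial, since it removes the division hidden
    in \<open>choose2\<close>.\<close>
  have "2 * ?E1 = 2 * ?E2"
  proof -
    have "2 * ?E1 = n * (2 * choose2 (n - 1 - t)) - n * (2 * choose2 (n + 3)) + 2 * (- (n * (n + 3)) + (n + 2) * t * (n + 3))"
      by (simp add: algebra_simps)
    also have "\<dots> = n * (2 * choose2 t) - 2 * (n * (2 * n + 3) - t * (4 * (n + 1))) + 2 * ((3 * n + 2) * (t - n))"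
      unfolding two_choose2 by (simp add: algebra_simps)
    finally show ?thesis by (simp add: algebra_simps)
  qed
  hence E: "?E1 = ?E2" by simp
  have "gcoef (n - 1 - t) y x = (-1) powi t * (x powi (n - 1 - t) * x powi (n + 3)) *
     (q powi (n * choose2 (n - 1 - t)) * q powi (n * (- choose2 (n + 3))) * q powi (- (n * (n + 3)) + (n + 2) * t * (n + 3))) * jtheta X qn"
    unfolding gcoef_def 1 2 sg power_int_mult[symmetric] by (simp only: mult_ac mult_1_left)
  also have "\<dots> = (-1) powi t * x powi (2 * n + 2 - t) * q powi ?E1 * jtheta X qn"
  proof -
    have "n - 1 - t + (n + 3) = 2 * n + 2 - t" by simp
    hence "x powi (n - 1 - t) * x powi (n + 3) = x powi (2 * n + 2 - t)"
      using assms(1) by (simp only: power_int_add[symmetric] simp_thms)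
    thus ?thesis by (simp only: power_int_add q0 simp_thms)
  qed
  finally have L: "gcoef (n - 1 - t) y x = (-1) powi t * x powi (2 * n + 2 - t) * q powi ?E1 * jtheta X qn" .
  have y1: "y powi (t - n) = q powi ((3 * n + 2) * (t - n)) * x powi (n - t)"
  proof -
    have "y powi (t - n) = q powi ((3 * n + 2) * (t - n)) / x powi (t - n)"
      unfolding y by (simp only: power_int_divide_distrib power_int_mult)
    moreover have "x powi (n - t) = 1 / x powi (t - n)"
      using assms(1) by (simp add: power_int_diff)
    ultimately show ?thesis by simp
  qed
  have y2: "(- y) powi t * (x / y) powi n = (-1) powi t * y powi (t - n) * x powi n"
  proof -
    have "(- y) powi t = (-1) powi t * y powi t"
      using power_int_mult_distrib[of "-1" y t] by simp
    thus ?thesis using assms by (simp add: power_int_divide_distrib power_int_diff)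
  qed
  have x2: "x powi (n - t) * x powi n * x\<^sup>2 = x powi (2 * n + 2 - t)"
  proof -
    have "x powi (n - t) * x powi n * x powi 2 = x powi (2 * n + 2 - t)"
      using assms(1) by (simp only: power_int_add[symmetric] simp_thms) (simp add: algebra_simps)
    thus ?thesis by simp
  qed
  have "gcoef t x y * ((x / y) powi n / garg t x) =
     - (((- y) powi t * (x / y) powi n) * x\<^sup>2) * (q powi (n * choose2 t) / q powi (n * (2 * n + 3) - t * (4 * (n + 1)))) * jtheta X qn"
    unfolding gcoef_def garg_def X_def by simp
  also have "\<dots> = - ((-1) powi t) * (x powi (n - t) * x powi n * x\<^sup>2) *
     (q powi (n * choose2 t) / q powi (n * (2 * n + 3) - t * (4 * (n + 1))) * q powi ((3 * n + 2) * (t - n))) * jtheta X qn"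
    unfolding y1 y2 by simp
  also have "\<dots> = - ((-1) powi t) * x powi (2 * n + 2 - t) * q powi ?E2 * jtheta X qn"
    unfolding x2 by (simp only: power_int_add power_int_diff q0 simp_thms)
  finally show ?thesis unfolding L E by simp
qed

lemma garg_reflect:
  assumes "x \<noteq> 0" "y \<noteq> 0" "x * y = q powi (3 * n + 2)"
  shows "1 / garg t x = garg (n - 1 - t) y"
proof -
  have y: "y = q powi (3 * n + 2) / x" using assms by (simp add: field_simps)
  have "garg t x * garg (n - 1 - t) y =
     q powi (n * (2 * n + 3) - t * (4 * (n + 1))) * q powi (n * (2 * n + 3) - (n - 1 - t) * (4 * (n + 1)))
     / (q powi (3 * n + 2) * q powi (3 * n + 2))"
    unfolding garg_def y using assms by (simp add: power2_eq_square)
  also have "\<dots> = q powi (n * (2 * n + 3) - t * (4 * (n + 1)) + (n * (2 * n + 3) - (n - 1 - t) * (4 * (n + 1))) - (3 * n + 2 + (3 * n + 2)))"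
    by (simp only: power_int_add power_int_diff q0 simp_thms)
  also have "\<dots> = q powi 0"
    by (rule arg_cong[where f = "\<lambda>k. q powi k"]) (simp add: algebra_simps)
  finally have "garg t x * garg (n - 1 - t) y = 1" by simp
  thus ?thesis using assms(1) by (simp add: field_simps)
qed

lemma half_g_antisym:
  assumes "x \<noteq> 0" "y \<noteq> 0" "x * y = q powi (3 * n + 2)"
  shows "half_g x y + half_g y x = 0"
proof -
  let ?z = "(x / y) powi n"
  have z0: "?z \<noteq> 0" using assms by simp
  have z1: "1 / ?z = (y / x) powi n" by (simp add: power_int_divide_distrib)
  \<comment> \<open>Inverting the Lambert sum gives -z^2 / v and inverting its theta denominator
    gives -z; the quotient z / v is the factor in \<open>gcoef_reflect\<close>.\<close>
  have "lerch Q (garg t x) ?z / jtheta ?z Q = (?z / garg t x) * lerch Q (garg (n - 1 - t) y) ((y / x) powi n) / jtheta ((y / x) powi n) Q" for t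
  proof -
    have 1: "lerch Q (garg t x) ?z = - (?z\<^sup>2 / garg t x) * lerch Q (garg (n - 1 - t) y) ((y / x) powi n)"
      using lerch_invert[of Q "garg t x" ?z] assms z0 unfolding garg_reflect[OF assms] z1 by simp
    have 2: "jtheta ?z Q = - ?z * jtheta ((y / x) powi n) Q"
      using jtheta_inverse[OF Q z0] z0 unfolding z1 by simp
    show ?thesis unfolding 1 2 using z0 by (simp add: power2_eq_square)
  qed
  hence "half_g x y = (\<Sum>t = 0..n - 1. gcoef t x y * (?z / garg t x) * lerch Q (garg (n - 1 - t) y) ((y / x) powi n)) / jtheta ((y / x) powi n) Q"
    unfolding half_g_def sum_divide_distrib
    by (intro sum.cong refl) (simp only: times_divide_eq_right[symmetric] mult.assoc)
  also have "\<dots> = - (\<Sum>t = 0..n - 1. gcoef (n - 1 - t) y x * lerch Q (garg (n - 1 - t) y) ((y / x) powi n)) / jtheta ((y / x) powi n) Q"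
    unfolding gcoef_reflect[OF assms] by (simp add: sum_negf)
  also have "\<dots> = - half_g y x"
    unfolding half_g_def sum_int_reverse[of "\<lambda>t. gcoef t y x * lerch Q (garg t y) ((y / x) powi n)" n] by simp
  finally show ?thesis by simp
qed

lemma holomorphic_half_g:
  assumes "open U" "X holomorphic_on U" "Y holomorphic_on U"
    and "\<And>s. s \<in> U \<Longrightarrow> X s \<noteq> 0" "\<And>s. s \<in> U \<Longrightarrow> Y s \<noteq> 0" "\<And>s. s \<in> U \<Longrightarrow> jA (X s) \<noteq> 0"
    and "\<And>s. s \<in> U \<Longrightarrow> jtheta ((X s / Y s) powi n) Q \<noteq> 0"
  shows "(\<lambda>s. half_g (X s) (Y s)) holomorphic_on U"
  unfolding half_g_def gcoef_def
  by (intro holomorphic_on_divide holomorphic_on_sum holomorphic_on_mult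
      holomorphic_jtheta_compose[OF qn] holomorphic_jtheta_compose[OF Q] holomorphic_lerch_on[OF Q])
     (use assms jA_nonzero_imp in \<open>auto simp: garg_def[abs_def] intro!: holomorphic_intros\<close>)

text \<open>A residue in the local coordinate 1 - \<open>garg l x\<close>. At k the term t = l, r =
  1 is singular and no other one is.\<close>

lemma half_g_pole:
  assumes "k\<^sup>2 = - (q powi (3 * n + 2))" "w \<noteq> 0"
  shows "((\<lambda>x. (1 - garg l x) * half_g x (w * x)) \<longlongrightarrow> gcoef l k (w * k) / jtheta (w powi n) Q) (at k)"
proof -
  have k0: "k \<noteq> 0" using assms by auto
  let ?z = "(1 / w) powi n"
  have z0: "?z \<noteq> 0" using assms by simp
  note vt = tendsto_garg[OF k0] and vk = filterlim_garg_l(1)[OF assms(1)]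
  have gcoef: "((\<lambda>x. gcoef t x (w * x)) \<longlongrightarrow> gcoef t k (w * k)) (at k)" for t
  proof -
    have "(\<lambda>x. gcoef t x (w * x)) holomorphic_on - {0}"
      unfolding gcoef_def using assms by (intro holomorphic_intros holomorphic_jtheta_compose[OF qn]) auto
    hence "isCont (\<lambda>x. gcoef t x (w * x)) k"
      using k0 by (rule_tac holomorphic_on_imp_isCont) auto
    thus ?thesis by (simp add: isCont_def)
  qed
  have main: "((\<lambda>x. (1 - garg l x) * lerch Q (garg t x) ?z) \<longlongrightarrow> (if t = l then - ?z else 0)) (at k)"
    if t: "t \<in> {0..n - 1}" for t
  proof (cases "t = l")
    case True
    from filterlim_compose[OF lerch_pole[OF Q z0] filterlim_garg_l(2)[OF assms(1)]] show ?thesis using True by simp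
  next
    case False
    have "1 - Q powi (r - 1) * garg t k \<noteq> 0" for r
    proof
      let ?e = "4 * n * (n + 1) * (r - 1) + n * (2 * n + 3) - t * (4 * (n + 1))"
      assume "1 - Q powi (r - 1) * garg t k = 0"
      hence "q powi ?e = q powi (3 * n + 2)" unfolding Q_powi_garg assms(1) by simp
      hence "?e = 3 * n + 2" by (rule power_int_inject_less_1[OF q_pos q_less])
      \<comment> \<open>A second singular term would force n to divide t - l, although 0 < |t - l| <
        n.\<close>
      moreover have "?e - (3 * n + 2) = 4 * (n + 1) * (n * (r - 1) - (t - l))"
        unfolding n_eq by (simp add: algebra_simps)
      ultimately have "n * (r - 1) = t - l" using n_pos by auto
      hence "n dvd t - l" by (metis dvd_triv_left)
      moreover have "\<bar>t - l\<bar> < n" using t l_nonneg n_eq by auto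
      ultimately show False using False zdvd_imp_le[of n "\<bar>t - l\<bar>"] by auto
    qed
    hence "isCont (\<lambda>v. lerch Q v ?z) (garg t k)"
      using k0 z0 by (intro isCont_lerch_on[OF Q]) auto
    from isCont_tendsto_compose[OF this vt[of t]]
    have "((\<lambda>x. (1 - garg l x) * lerch Q (garg t x) ?z) \<longlongrightarrow> (1 - garg l k) * lerch Q (garg t k) ?z) (at k)"
      by (intro tendsto_intros vt)
    thus ?thesis using vk False by simp
  qed
  have "((\<lambda>x. (\<Sum>t = 0..n - 1. gcoef t x (w * x) * ((1 - garg l x) * lerch Q (garg t x) ?z)) * (1 / jtheta ?z Q)) \<longlongrightarrow>
     (\<Sum>t = 0..n - 1. gcoef t k (w * k) * (if t = l then - ?z else 0)) * (1 / jtheta ?z Q)) (at k)"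
    by (intro tendsto_mult_right tendsto_sum tendsto_mult[OF gcoef main])
  moreover have "(\<Sum>t = 0..n - 1. gcoef t k (w * k) * (if t = l then - ?z else 0)) * (1 / jtheta ?z Q) = gcoef l k (w * k) / jtheta (w powi n) Q"
  proof -
    have "(\<Sum>t = 0..n - 1. gcoef t k (w * k) * (if t = l then - ?z else 0)) = (\<Sum>t = 0..n - 1. (if t = l then gcoef t k (w * k) * - ?z else 0))"
      by (intro sum.cong) auto
    also have "\<dots> = gcoef l k (w * k) * - ?z"
      using l_nonneg n_eq by (subst sum.delta) auto
    finally have s: "(\<Sum>t = 0..n - 1. gcoef t k (w * k) * (if t = l then - ?z else 0)) = gcoef l k (w * k) * - ?z" .
    \<comment> \<open>The residue -z of the Lambert sum is absorbed by inverting the theta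
      denominator, which leaves w^n in place of z.\<close>
    have "?z = 1 / w powi n" by (simp add: power_int_divide_distrib)
    moreover have "jtheta (1 / w powi n) Q = - jtheta (w powi n) Q / w powi n"
      using assms by (intro jtheta_inverse[OF Q]) auto
    ultimately show ?thesis unfolding s using assms by simp
  qed
  moreover have "\<forall>\<^sub>F x in at k. (\<Sum>t = 0..n - 1. gcoef t x (w * x) * ((1 - garg l x) * lerch Q (garg t x) ?z)) * (1 / jtheta ?z Q)
      = (1 - garg l x) * half_g x (w * x)"
  proof -
    have "\<forall>\<^sub>F x in at k. x \<in> - {0} - {k}"
      using k0 by (intro eventually_at_in_open) auto
    thus ?thesis
    proof eventually_elim
      case (elim x)
      have z: "(x / (w * x)) powi n = ?z" using elim by simp
      show ?case unfolding half_g_def z by (simp add: sum_distrib_left sum_divide_distrib mult_ac)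
    qed
  qed
  ultimately show ?thesis by (auto intro: Lim_transform_eventually)
qed

section \<open>The theta quotient\<close>

abbreviation "Q2 \<equiv> q powi (8 * (n + 1))"
abbreviation "J1 \<equiv> jtheta (q powi (2 * n)) (q powi (4 * n))"
abbreviation "J2 \<equiv> jtheta qD Q2"

text \<open>The quotient of the theorem with the halved exponents written as polynomials in
  \<open>l\<close>.\<close>

definition Theta_quot :: "complex \<Rightarrow> complex \<Rightarrow> complex" where
  "Theta_quot x y = y powi (l + 1) * J1 * J2 * jtheta (y / x) qD * jtheta (q powi (n + 2) * x * y) qD *
      jtheta (q powi (2 * n) / (x\<^sup>2 * y\<^sup>2)) Q2 /
     (q powi (2 * l * l + 2 * l - 1) * x powi (l - 1) * jtheta ((y / x) powi n) Q * jA x * jA y)"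

lemma Theta_n2_eq: "Theta_n2 n x y q = Theta_quot x y"
proof -
  have "(n + 1) div 2 = l + 1" "(n - 3) div 2 = l - 1" unfolding n_eq by auto
  moreover have "(n\<^sup>2 - 3) div 2 = 2 * l * l + 2 * l - 1"
  proof -
    have "n\<^sup>2 - 3 = 2 * (2 * l * l + 2 * l - 1)"
      unfolding n_eq by (simp add: power2_eq_square algebra_simps)
    thus ?thesis by simp
  qed
  ultimately show ?thesis
    unfolding Theta_n2_def Theta_quot_def jA_def Jtheta_def by (simp add: power_int_divide_distrib)
qed

lemma Q2: "0 < norm Q2" "norm Q2 < 1"
  using norm_powi_less_1[OF q_pos q_less, of "8 * (n + 1)"] n_pos by auto

lemma qD_square: "qD * qD = Q2"
  by (simp flip: power_int_add)

lemma jA_shift: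
  assumes "x \<noteq> 0"
  shows "jA (p * x) = jA x / (q powi (n + 2) * x\<^sup>2)"
proof -
  have e: "- (q powi (n + 2)) * (p * x)\<^sup>2 = qD * (- (q powi (n + 2)) * x\<^sup>2)"
    unfolding p_square[symmetric] by (simp add: power2_eq_square)
  show ?thesis unfolding jA_def e
    using jtheta_shift[OF qD, of "- (q powi (n + 2)) * x\<^sup>2"] assms by simp
qed

text \<open>Factors in y / x do not change, and the others each contribute one quasi-period. The
  quotient thus satisfies the homogeneous form of the equation for f and g.\<close>

lemma Theta_quot_shift:
  assumes "x \<noteq> 0" "y \<noteq> 0"
  shows "q powi (n + 2) * x * y * Theta_quot (p * x) (p * y) = Theta_quot x y"
proof -
  define c where "c = q powi (n + 2)"
  define P where "P = p"
  have c0: "c \<noteq> 0" and P0: "P \<noteq> 0" by (simp_all add: c_def P_def)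
  have 1: "jtheta (c * (P * x) * (P * y)) qD = - jtheta (c * x * y) qD / (c * x * y)"
  proof -
    have "c * (P * x) * (P * y) = qD * (c * x * y)"
      unfolding p_square[symmetric] P_def by (simp only: mult_ac)
    moreover have "jtheta (qD * (c * x * y)) qD = - jtheta (c * x * y) qD / (c * x * y)"
      using assms c0 by (intro jtheta_shift[OF qD]) auto
    ultimately show ?thesis by (simp only:)
  qed
  let ?X = "q powi (2 * n) / (x\<^sup>2 * y\<^sup>2)"
  \<comment> \<open>The argument is divided by p^4 = \<open>Q2\<close>, exactly one period of its
    base.\<close>
  have 2: "jtheta (q powi (2 * n) / ((P * x)\<^sup>2 * (P * y)\<^sup>2)) Q2 = - ?X / Q2 * jtheta ?X Q2"
  proof -
    have "Q2 = P\<^sup>2 * P\<^sup>2"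
      unfolding qD_square[symmetric] p_square[symmetric] P_def power2_eq_square by (simp only: mult_ac)
    hence "q powi (2 * n) / ((P * x)\<^sup>2 * (P * y)\<^sup>2) = ?X / Q2" by (simp add: power_mult_distrib)
    moreover have "jtheta (Q2 * (?X / Q2)) Q2 = - jtheta (?X / Q2) Q2 / (?X / Q2)"
      using assms by (intro jtheta_shift[OF Q2]) auto
    ultimately show ?thesis using assms by simp
  qed
  have 3: "(P * y) powi (l + 1) / (P * x) powi (l - 1) = P\<^sup>2 * (y powi (l + 1) / x powi (l - 1))"
  proof -
    have "P powi (l + 1) / P powi (l - 1) = P powi (l + 1 - (l - 1))"
      using P0 by (simp only: power_int_diff simp_thms)
    thus ?thesis using P0 by (simp add: power_int_mult_distrib field_simps)
  qed
  \<comment> \<open>All constants meet here: P^2 from the monomials, c^2 from the two factors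
    \<open>jA\<close>, q^(2n) from the last theta argument.\<close>
  have 4: "q powi (2 * n) * P\<^sup>2 * c\<^sup>2 = Q2"
  proof -
    have "q powi (2 * n) * (q powi (2 * n + 2) * q powi (2 * n + 2)) * (q powi (n + 2) * q powi (n + 2)) =
       q powi (2 * n + (2 * n + 2 + (2 * n + 2)) + (n + 2 + (n + 2)))"
      by (simp only: power_int_add q0 simp_thms)
    also have "2 * n + (2 * n + 2 + (2 * n + 2)) + (n + 2 + (n + 2)) = 8 * (n + 1)" by simp
    finally show ?thesis by (simp only: P_def c_def power2_eq_square)
  qed
  have J: "jA (P * x) = jA x / (c * x\<^sup>2)" "jA (P * y) = jA y / (c * y\<^sup>2)"
    unfolding P_def c_def by (rule jA_shift[OF assms(1)], rule jA_shift[OF assms(2)])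
  define R where "R = J1 * J2 * jtheta (y / x) qD * jtheta (c * x * y) qD * jtheta ?X Q2 /
     (q powi (2 * l * l + 2 * l - 1) * jtheta ((y / x) powi n) Q * jA x * jA y)"
  have yx: "P * y / (P * x) = y / x" using P0 by simp
  have alg: "c * x * y * (W * j1 * j2 * a * (- b / (c * x * y)) * (- X / D * d) / (m * K * t * (A / (c * x\<^sup>2)) * (B / (c * y\<^sup>2)))) =
      c * x * y * (W / K) * (- 1 / (c * x * y)) * (- X / D) * (c * x\<^sup>2) * (c * y\<^sup>2) * (j1 * j2 * a * b * d / (m * t * A * B))"
    for W j1 j2 a b X D d m K t A B :: complex
    by (simp add: divide_inverse mult_ac)
  have "c * x * y * Theta_quot (P * x) (P * y) = c * x * y * ((P * y) powi (l + 1) / (P * x) powi (l - 1)) *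
     (- 1 / (c * x * y)) * (- ?X / Q2) * (c * x\<^sup>2) * (c * y\<^sup>2) * R"
    unfolding Theta_quot_def c_def[symmetric] 1 2 J R_def yx by (rule alg)
  also have "\<dots> = (y powi (l + 1) / x powi (l - 1)) * ((q powi (2 * n) * P\<^sup>2 * c\<^sup>2) / Q2) * R"
    unfolding 3 using assms c0 by (simp add: field_simps power2_eq_square)
  also have "\<dots> = (y powi (l + 1) / x powi (l - 1)) * R" unfolding 4 by simp
  also have "\<dots> = Theta_quot x y"
    unfolding Theta_quot_def R_def c_def by (simp add: mult_ac)
  finally show ?thesis by (simp add: c_def P_def)
qed

text \<open>Makes the whole difference symmetric, so that poles in y = w x reduce to poles in
  x.\<close>

lemma Theta_quot_sym:
  assumes "x \<noteq> 0" "y \<noteq> 0"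
  shows "Theta_quot x y = Theta_quot y x"
proof -
  have 1: "jtheta (x / y) qD = - (x / y) * jtheta (y / x) qD"
    using jtheta_inverse[OF qD, of "y / x"] assms by simp
  have 2: "jtheta ((x / y) powi n) Q = - ((x / y) powi n) * jtheta ((y / x) powi n) Q"
  proof -
    have "1 / (y / x) powi n = (x / y) powi n" by (simp add: power_int_divide_distrib)
    thus ?thesis using jtheta_inverse[OF Q, of "(y / x) powi n"] assms
      by (simp add: power_int_divide_distrib)
  qed
  \<comment> \<open>The monomials balance because (l + 1) + 1 + (l - 1) = n.\<close>
  have 3: "x powi (l + 1) / y powi (l - 1) * (x / y) / (x / y) powi n = y powi (l + 1) / x powi (l - 1)"
  proof -
    have "x powi (l + 1) * x powi 1 * x powi (l - 1) = x powi n" "y powi (l + 1) * y powi 1 * y powi (l - 1) = y powi n"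
      unfolding n_eq using assms by (simp_all only: power_int_add[symmetric] simp_thms) (simp_all add: algebra_simps)
    hence "x powi n = x powi (l + 1) * x * x powi (l - 1)" "y powi n = y powi (l + 1) * y * y powi (l - 1)"
      by simp_all
    thus ?thesis using assms by (simp add: power_int_divide_distrib)
  qed
  have 4: "q powi (n + 2) * y * x = q powi (n + 2) * x * y" "y\<^sup>2 * x\<^sup>2 = x\<^sup>2 * y\<^sup>2" by simp_all
  define R where "R = J1 * J2 * jtheta (y / x) qD * jtheta (q powi (n + 2) * x * y) qD * jtheta (q powi (2 * n) / (x\<^sup>2 * y\<^sup>2)) Q2 /
     (q powi (2 * l * l + 2 * l - 1) * jtheta ((y / x) powi n) Q * jA x * jA y)"
  have "Theta_quot y x = x powi (l + 1) / y powi (l - 1) * (x / y) / (x / y) powi n * R"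
    unfolding Theta_quot_def 1 2 R_def 4 by (simp add: mult_ac)
  also have "\<dots> = Theta_quot x y"
    unfolding 3 Theta_quot_def R_def by (simp add: mult_ac)
  finally show ?thesis by simp
qed

lemma Theta_quot_zero:
  assumes "x * y = q powi (3 * n + 2)"
  shows "Theta_quot x y = 0"
proof -
  have "q powi (n + 2) * x * y = q powi (n + 2 + (3 * n + 2))"
    unfolding mult.assoc assms by (simp only: power_int_add q0 simp_thms)
  also have "n + 2 + (3 * n + 2) = 4 * (n + 1)" by simp
  finally have "jtheta (q powi (n + 2) * x * y) qD = 0"
    using jtheta_eq_0_iff[OF qD, of qD] by (auto intro: exI[of _ 1])
  thus ?thesis by (simp add: Theta_quot_def)
qed

lemma holomorphic_jA:
  assumes "X holomorphic_on U" "\<And>s. s \<in> U \<Longrightarrow> X s \<noteq> 0"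
  shows "(\<lambda>s. jA (X s)) holomorphic_on U"
  unfolding jA_def using assms by (intro holomorphic_jtheta_compose[OF qD] holomorphic_intros) auto

lemma holomorphic_Th:
  assumes "X holomorphic_on U" "Y holomorphic_on U"
    and "\<And>s. s \<in> U \<Longrightarrow> X s \<noteq> 0" "\<And>s. s \<in> U \<Longrightarrow> Y s \<noteq> 0"
    and "\<And>s. s \<in> U \<Longrightarrow> jA (X s) \<noteq> 0" "\<And>s. s \<in> U \<Longrightarrow> jA (Y s) \<noteq> 0"
    and "\<And>s. s \<in> U \<Longrightarrow> jtheta ((Y s / X s) powi n) Q \<noteq> 0"
  shows "(\<lambda>s. Theta_quot (X s) (Y s)) holomorphic_on U"
  unfolding Theta_quot_def
  by (intro holomorphic_on_divide holomorphic_on_mult holomorphic_on_const holomorphic_jA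
      holomorphic_jtheta_compose[OF qD] holomorphic_jtheta_compose[OF Q] holomorphic_jtheta_compose[OF Q2])
     (use assms in \<open>auto intro!: holomorphic_intros\<close>)

text \<open>Expresses \<open>jA\<close> through the local coordinate, so that
  \<open>tendsto_jtheta_div\<close> gives its leading coefficient at the pole.\<close>

lemma jA_eq_jtheta_garg:
  assumes "x \<noteq> 0"
  shows "jA x = jtheta (garg l x) qD"
proof -
  have el: "n * (2 * n + 3) - l * (4 * (n + 1)) = 4 * (n + 1) - (n + 2)"
    unfolding n_eq by (simp add: algebra_simps)
  have "garg l x = qD / (- (q powi (n + 2)) * x\<^sup>2)"
    unfolding garg_def el by (simp only: power_int_diff q0 simp_thms) simp
  thus ?thesis unfolding jA_def using assms jtheta_reflect[of "- (q powi (n + 2)) * x\<^sup>2" qD] by simp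
qed

text \<open>At the pole the theta coefficient of the middle term is a power of \<open>qn\<close>
  away from a square root of -q^n, where \<open>jtheta_at_root\<close> evaluates it.\<close>

lemma gcoef_at_pole:
  assumes "k\<^sup>2 = - (q powi (3 * n + 2))" "w \<noteq> 0"
  shows "gcoef l k (w * k) = - (w powi l) * q powi (- (2 * l * l + 2 * l - 1) - 4 * (n + 1) + (3 * n + 2)) * J1"
proof -
  have k0: "k \<noteq> 0" using assms by auto
  \<comment> \<open>The exponent is dictated by (n + 2) l = n (l + 2) - (n + 1), which splits off
    whole periods; then X^2 = -q^n.\<close>
  define X where "X = q powi (- (n + 1)) * k"
  have X0: "X \<noteq> 0" using k0 by (simp add: X_def)
  have X2: "X\<^sup>2 = - qn"
  proof -
    have "X\<^sup>2 = q powi (- (n + 1)) * q powi (- (n + 1)) * k\<^sup>2"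
      unfolding X_def by (simp only: power2_eq_square mult_ac)
    also have "\<dots> = - (q powi (- (n + 1)) * q powi (- (n + 1)) * q powi (3 * n + 2))"
      unfolding assms(1) by simp
    also have "\<dots> = - (q powi (- (n + 1) + - (n + 1) + (3 * n + 2)))"
      by (simp only: power_int_add q0 simp_thms)
    finally show ?thesis by simp
  qed
  have j: "jtheta X qn = J1"
  proof -
    have "qn\<^sup>2 = q powi (2 * n)" "qn ^ 4 = q powi (4 * n)"
      by (simp_all add: mult.commute flip: power_int_mult power_int_numeral)
    thus ?thesis using jtheta_at_root[OF qn X2] by simp
  qed
  have "(n + 2) * l = n * (l + 2) + - (n + 1)" unfolding n_eq by (simp add: algebra_simps)
  hence "q powi ((n + 2) * l) * k = q powi (n * (l + 2)) * q powi (- (n + 1)) * k"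
    by (simp only: power_int_add q0 simp_thms)
  also have "\<dots> = qn powi (l + 2) * X" unfolding X_def by (simp only: power_int_mult mult.assoc)
  finally have 1: "jtheta (q powi ((n + 2) * l) * k) qn =
     (-1) powi (l + 2) * qn powi (- choose2 (l + 2)) * X powi (- (l + 2)) * J1"
    using jtheta_shift_powi[OF qn X0, of "l + 2"] j by simp
  have 2: "X powi (- (l + 2)) = q powi ((n + 1) * (l + 2)) * k powi (- (l + 2))"
  proof -
    have "- (n + 1) * - (l + 2) = (n + 1) * (l + 2)" by (simp only: minus_mult_minus)
    thus ?thesis unfolding X_def power_int_mult_distrib power_int_mult[symmetric] by (simp only:)
  qed
  have 3: "(- (w * k)) powi l = (-1) powi l * w powi l * k powi l"
    using power_int_mult_distrib[of "- 1" "w * k" l] by (simp add: power_int_mult_distrib)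
  have s: "(-1) powi l * (-1) powi (l + 2) = (1 :: complex)"
    by (simp add: power_int_add)
  have k: "k powi l * k powi (- (l + 2)) = - (q powi (- (3 * n + 2)))"
  proof -
    have "k powi l * k powi (- (l + 2)) = k powi (l + - (l + 2))"
      using k0 by (simp only: power_int_add simp_thms)
    also have "l + - (l + 2) = - 2" by simp
    also have "k powi (- 2) = inverse (k\<^sup>2)" by (simp add: power_int_minus)
    also have "\<dots> = - (q powi (- (3 * n + 2)))"
      unfolding assms(1) by (simp only: power_int_minus inverse_minus_eq)
    finally show ?thesis .
  qed
  \<comment> \<open>The right side stays unsimplified: its three pieces are the q-power of the
    quotient, the base \<open>qD\<close> and k^2, as they appear in
    \<open>Theta_quot_pole\<close>.\<close>
  have E: "n * choose2 l + n * (- choose2 (l + 2)) + (n + 1) * (l + 2) + - (3 * n + 2)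
     = - (2 * l * l + 2 * l - 1) - 4 * (n + 1) + (3 * n + 2)"
  proof -
    have "choose2 (l + 2) = choose2 l + (2 * l + 1)"
      using two_choose2[of "l + 2"] two_choose2[of l] by (simp add: algebra_simps)
    thus ?thesis unfolding n_eq by (simp add: algebra_simps)
  qed
  have "gcoef l k (w * k) = ((-1) powi l * (-1) powi (l + 2)) * w powi l * (k powi l * k powi (- (l + 2))) *
     (q powi (n * choose2 l) * qn powi (- choose2 (l + 2)) * q powi ((n + 1) * (l + 2))) * J1"
    unfolding gcoef_def 1 2 3 by (simp only: mult_ac)
  also have "\<dots> = - (w powi l) * (q powi (n * choose2 l) * q powi (n * (- choose2 (l + 2))) * q powi ((n + 1) * (l + 2)) * q powi (- (3 * n + 2))) * J1"
    unfolding s k by (simp only: power_int_mult) simp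
  also have "\<dots> = - (w powi l) * q powi (- (2 * l * l + 2 * l - 1) - 4 * (n + 1) + (3 * n + 2)) * J1"
    unfolding E[symmetric] by (simp only: power_int_add q0 simp_thms)
  finally show ?thesis .
qed

text \<open>The limit coincides with that of \<open>half_g_pole\<close>. As the two functions enter
  the difference with opposite signs, the poles cancel.\<close>

lemma Theta_quot_pole:
  assumes "k\<^sup>2 = - (q powi (3 * n + 2))" "w \<noteq> 0" "jtheta (w\<^sup>2) qD \<noteq> 0" "jtheta (w powi n) Q \<noteq> 0"
  shows "((\<lambda>x. (1 - garg l x) * Theta_quot x (w * x)) \<longlongrightarrow> gcoef l k (w * k) / jtheta (w powi n) Q) (at k)"
proof -
  have k0: "k \<noteq> 0" using assms by auto
  note fl = filterlim_garg_l(2)[OF assms(1)]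
  define P3 where "P3 = qpoch_inf qD qD ^ 3"
  have P30: "P3 \<noteq> 0" unfolding P3_def using qpoch_inf_self_nonzero[OF qD(2)] by simp
  have lim1: "((\<lambda>x. 1 / (jtheta (garg l x) qD / (1 - garg l x))) \<longlongrightarrow> 1 / P3) (at k)"
    using filterlim_compose[OF tendsto_jtheta_div[OF qD] fl] P30
    unfolding P3_def by (intro tendsto_divide tendsto_const) auto
  have c1: "- (q powi (n + 2)) * (w * k)\<^sup>2 = qD * w\<^sup>2" "q powi (n + 2) * k * (w * k) = qD * (- w)"
  proof -
    have "q powi (n + 2) * q powi (3 * n + 2) = q powi (n + 2 + (3 * n + 2))"
      by (simp only: power_int_add q0 simp_thms)
    also have "n + 2 + (3 * n + 2) = 4 * (n + 1)" by simp
    finally have e: "q powi (n + 2) * k\<^sup>2 = - qD" unfolding assms(1) by simp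
    have "- (q powi (n + 2)) * (w * k)\<^sup>2 = - (q powi (n + 2) * k\<^sup>2) * w\<^sup>2" "q powi (n + 2) * k * (w * k) = (q powi (n + 2) * k\<^sup>2) * w"
      by (simp_all add: power2_eq_square)
    thus "- (q powi (n + 2)) * (w * k)\<^sup>2 = qD * w\<^sup>2" "q powi (n + 2) * k * (w * k) = qD * (- w)"
      unfolding e by simp_all
  qed
  have jw: "jA (w * k) = - jtheta (w\<^sup>2) qD / w\<^sup>2"
    unfolding jA_def c1 using assms by (intro jtheta_shift[OF qD]) auto
  \<comment> \<open>Everything in the quotient except the two factors \<open>jA\<close>: regular at
    k, as its denominator is a monomial times a nonzero constant.\<close>
  define N where "N = (\<lambda>x. (w * x) powi (l + 1) * J1 * J2 * jtheta w qD * jtheta (q powi (n + 2) * x * (w * x)) qD *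
      jtheta (q powi (2 * n) / (x\<^sup>2 * (w * x)\<^sup>2)) Q2 /
     (q powi (2 * l * l + 2 * l - 1) * x powi (l - 1) * jtheta (w powi n) Q))"
  have "N holomorphic_on - {0}"
    unfolding N_def using assms
    by (intro holomorphic_on_divide holomorphic_on_mult holomorphic_on_const
      holomorphic_jtheta_compose[OF qD] holomorphic_jtheta_compose[OF Q2]) (auto intro!: holomorphic_intros)
  hence lim2: "N \<midarrow>k\<rightarrow> N k"
    using holomorphic_on_imp_isCont[of N "- {0}" k] k0 by (simp add: isCont_def open_Compl)
  have "(\<lambda>x. jA (w * x)) holomorphic_on - {0}"
    using assms by (intro holomorphic_jA holomorphic_intros) auto
  hence "isCont (\<lambda>x. jA (w * x)) k"
    using k0 by (rule_tac holomorphic_on_imp_isCont) auto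
  hence lim3: "((\<lambda>x. jA (w * x)) \<longlongrightarrow> jA (w * k)) (at k)" by (simp add: isCont_def)
  have "jA (w * k) \<noteq> 0" using assms by (simp add: jw)
  hence "((\<lambda>x. N x * (1 / (jtheta (garg l x) qD / (1 - garg l x))) / jA (w * x)) \<longlongrightarrow> N k * (1 / P3) / jA (w * k)) (at k)"
    by (intro tendsto_divide tendsto_mult lim1 lim2 lim3)
  moreover have "\<forall>\<^sub>F x in at k. N x * (1 / (jtheta (garg l x) qD / (1 - garg l x))) / jA (w * x) = (1 - garg l x) * Theta_quot x (w * x)"
  proof -
    have "\<forall>\<^sub>F x in at k. x \<in> - {0} - {k}"
      using k0 by (intro eventually_at_in_open) auto
    thus ?thesis
      by eventually_elim (simp add: N_def Theta_quot_def jA_eq_jtheta_garg mult_ac)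
  qed
  ultimately have lim: "((\<lambda>x. (1 - garg l x) * Theta_quot x (w * x)) \<longlongrightarrow> N k * (1 / P3) / jA (w * k)) (at k)"
    by (rule Lim_transform_eventually)
  have "N k * (1 / P3) / jA (w * k) = gcoef l k (w * k) / jtheta (w powi n) Q"
  proof -
    have a: "jtheta (q powi (n + 2) * k * (w * k)) qD = jtheta (- w) qD / w"
      unfolding c1 using jtheta_shift[OF qD, of "- w"] assms by simp
    have b: "jtheta (q powi (2 * n) / (k\<^sup>2 * (w * k)\<^sup>2)) Q2 = - jtheta (qD * w\<^sup>2) Q2 / (qD * w\<^sup>2)"
    proof -
      have "Q2 * qD * (q powi (2 * n)) = q powi (8 * (n + 1) + 4 * (n + 1) + 2 * n)"
        by (simp only: power_int_add q0 simp_thms)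
      also have "8 * (n + 1) + 4 * (n + 1) + 2 * n = (3 * n + 2) + (3 * n + 2) + 8 * (n + 1)" by simp
      also have "q powi \<dots> = q powi (3 * n + 2) * q powi (3 * n + 2) * Q2"
        by (simp only: power_int_add q0 simp_thms)
      finally have e: "qD * q powi (2 * n) = k\<^sup>2 * k\<^sup>2" unfolding assms(1) by simp
      have "Q2 / (Q2 * (qD * w\<^sup>2)) = q powi (2 * n) / ((qD * q powi (2 * n)) * w\<^sup>2)" by simp
      also have "\<dots> = q powi (2 * n) / (k\<^sup>2 * (w * k)\<^sup>2)" unfolding e by (simp add: power_mult_distrib)
      finally have "jtheta (q powi (2 * n) / (k\<^sup>2 * (w * k)\<^sup>2)) Q2 = jtheta (Q2 * (qD * w\<^sup>2)) Q2"
        using jtheta_reflect[of "Q2 * (qD * w\<^sup>2)" Q2] assms by simp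
      thus ?thesis using jtheta_shift[OF Q2, of "qD * w\<^sup>2"] assms by simp
    qed
    \<comment> \<open>On the right, j(w^2) will cancel against \<open>jA (w * k)\<close> and P3
      against the leading coefficient of the vanishing factor \<open>jA x\<close>.\<close>
    have quad: "jtheta w qD * jtheta (- w) qD * jtheta (qD * w\<^sup>2) Q2 * J2 = jtheta (w\<^sup>2) qD * P3"
    proof -
      have "qD\<^sup>2 = Q2" using qD_square by (simp only: power2_eq_square)
      thus ?thesis using jtheta_quadruple[OF qD assms(2)] unfolding P3_def by (simp only:)
    qed
    have kl: "(w * k) powi (l + 1) / k powi (l - 1) = - w * w powi l * q powi (3 * n + 2)"
    proof -
      have "k powi (l + 1) / k powi (l - 1) = k powi (l + 1 - (l - 1))"
        using k0 by (simp only: power_int_diff simp_thms)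
      also have "\<dots> = - (q powi (3 * n + 2))" using assms(1) by simp
      finally have "k powi (l + 1) / k powi (l - 1) = - (q powi (3 * n + 2))" .
      moreover have "(w * k) powi (l + 1) / k powi (l - 1) = w * w powi l * (k powi (l + 1) / k powi (l - 1))"
        using assms(2) by (simp add: power_int_mult_distrib power_int_add)
      ultimately show ?thesis by simp
    qed
    have alg: "(W * j1 * j2 * a * (b / w) * (- d / (D * w\<^sup>2)) / (m * K * t)) * (1 / P) / (- s / w\<^sup>2) =
        (W / K) * j1 * (a * b * d * j2) / (s * P) / (w * D * m * t)"
      if "D \<noteq> 0" "m \<noteq> 0" "K \<noteq> 0" "t \<noteq> 0" "P \<noteq> 0" "s \<noteq> 0"
      for W j1 j2 a b d D m K t P s :: complex
      using that \<open>w \<noteq> 0\<close> by (simp add: field_simps)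
    have "N k * (1 / P3) / jA (w * k) = ((w * k) powi (l + 1) / k powi (l - 1)) * J1 *
        (jtheta w qD * jtheta (- w) qD * jtheta (qD * w\<^sup>2) Q2 * J2) / (jtheta (w\<^sup>2) qD * P3) /
        (w * qD * q powi (2 * l * l + 2 * l - 1) * jtheta (w powi n) Q)"
      unfolding N_def a b jw using assms(3,4) P30 k0 by (intro alg) auto
    also have "\<dots> = - (w powi l) * (q powi (3 * n + 2) / (qD * q powi (2 * l * l + 2 * l - 1))) * J1 / jtheta (w powi n) Q"
      unfolding quad kl using assms P30 by (simp add: mult_ac)
    also have "q powi (3 * n + 2) / (qD * q powi (2 * l * l + 2 * l - 1)) = q powi (3 * n + 2 - (4 * (n + 1) + (2 * l * l + 2 * l - 1)))"
      by (simp only: power_int_add power_int_diff q0 simp_thms)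
    also have "3 * n + 2 - (4 * (n + 1) + (2 * l * l + 2 * l - 1)) = - (2 * l * l + 2 * l - 1) - 4 * (n + 1) + (3 * n + 2)"
      by simp
    finally show ?thesis unfolding gcoef_at_pole[OF assms(1,2)] .
  qed
  with lim show ?thesis by simp
qed

section \<open>The difference of the two sides\<close>

definition defect :: "complex \<Rightarrow> complex \<Rightarrow> complex" where
  "defect x y = hecke_f n (n + 2) n x y q - half_g x y - half_g y x + Theta_quot x y"

text \<open>One ratio is enough for both halves of g: \<open>jtheta_ratio_swap\<close> supplies the
  inverse one.\<close>

definition regular :: "complex \<Rightarrow> complex \<Rightarrow> bool" where
  "regular x y \<longleftrightarrow> x \<noteq> 0 \<and> y \<noteq> 0 \<and> jA x \<noteq> 0 \<and> jA y \<noteq> 0 \<and> jtheta ((y / x) powi n) Q \<noteq> 0"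

lemma jtheta_ratio_swap:
  assumes "x \<noteq> 0" "y \<noteq> 0" "jtheta ((y / x) powi n) Q \<noteq> 0"
  shows "jtheta ((x / y) powi n) Q \<noteq> 0"
proof -
  have "1 / (y / x) powi n = (x / y) powi n" by (simp add: power_int_divide_distrib)
  thus ?thesis using jtheta_inverse[OF Q, of "(y / x) powi n"] assms by auto
qed

lemma defect_sym: "x \<noteq> 0 \<Longrightarrow> y \<noteq> 0 \<Longrightarrow> defect x y = defect y x"
  unfolding defect_def using Theta_quot_sym[of x y] hecke_f_swap[of n "n + 2" x y q] by simp

text \<open>The inhomogeneous terms j(x; q^n) and j(y; q^n) of f are those produced by the two
  halves of g, so they cancel.\<close>

lemma defect_shift:
  assumes "regular x y"
  shows "q powi (n + 2) * x * y * defect (p * x) (p * y) = defect x y"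
proof -
  from assms have r: "x \<noteq> 0" "y \<noteq> 0" "jA x \<noteq> 0" "jA y \<noteq> 0" "jtheta ((y / x) powi n) Q \<noteq> 0"
    by (auto simp: regular_def)
  have f: "hecke_f n (n + 2) n x y q = q powi (n + 2) * x * y * hecke_f n (n + 2) n (p * x) (p * y) q + jtheta x qn + jtheta y qn"
  proof -
    have "n + (n + 2) = 2 * n + 2" by simp
    thus ?thesis using hecke_f_shift[OF q_pos q_less n_pos, of "n + 2" x y] r n_pos by simp
  qed
  note g1 = half_g_shift[OF r(1,2,3) jtheta_ratio_swap[OF r(1,2,5)]]
  note g2 = half_g_shift[OF r(2,1,4,5)]
  show ?thesis
    unfolding defect_def f g1 g2 Theta_quot_shift[OF r(1,2), symmetric] by (simp add: algebra_simps)
qed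

text \<open>The three parts vanish separately: f by its involution, g by pairing its halves, the
  quotient through its factor in q^(n+2) x y.\<close>

lemma defect_zero:
  assumes "x \<noteq> 0" "y \<noteq> 0" "x * y = q powi (3 * n + 2)"
  shows "defect x y = 0"
proof -
  have "2 * n + (n + 2) = 3 * n + 2" by simp
  hence "hecke_f n (n + 2) n x y q = 0"
    using hecke_f_zero[OF q_pos q_less assms(1,2), of n "n + 2"] assms(3) by simp
  moreover have "half_g y x = - half_g x y"
    using half_g_antisym[OF assms] by (simp add: eq_neg_iff_add_eq_0 add.commute)
  ultimately show ?thesis unfolding defect_def
    using Theta_quot_zero[OF assms(3)] by simp
qed

lemma holomorphic_defect:
  assumes "open U" "X holomorphic_on U" "Y holomorphic_on U" "\<And>s. s \<in> U \<Longrightarrow> regular (X s) (Y s)"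
  shows "(\<lambda>s. defect (X s) (Y s)) holomorphic_on U"
proof -
  have r: "X s \<noteq> 0" "Y s \<noteq> 0" "jA (X s) \<noteq> 0" "jA (Y s) \<noteq> 0" "jtheta ((Y s / X s) powi n) Q \<noteq> 0"
    "jtheta ((X s / Y s) powi n) Q \<noteq> 0" if "s \<in> U" for s
    using assms(4)[OF that] jtheta_ratio_swap by (auto simp: regular_def)
  show ?thesis unfolding defect_def
    using r assms n_pos q_pos q_less
    by (intro holomorphic_on_add holomorphic_on_diff hecke_f_holomorphic holomorphic_half_g holomorphic_Th) auto
qed

lemma open_regular:
  assumes "X holomorphic_on - {0}" "Y holomorphic_on - {0}" "\<And>s. s \<noteq> 0 \<Longrightarrow> X s \<noteq> 0" "\<And>s. s \<noteq> 0 \<Longrightarrow> Y s \<noteq> 0"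
  shows "open {s. s \<noteq> 0 \<and> regular (X s) (Y s)}"
proof -
  let ?h = "\<lambda>s. jA (X s) * jA (Y s) * jtheta ((Y s / X s) powi n) Q"
  have "?h holomorphic_on - {0}"
    using assms by (intro holomorphic_on_mult holomorphic_jA holomorphic_jtheta_compose[OF Q] holomorphic_intros) auto
  hence "open (- {0} \<inter> ?h -` (- {0}))"
    by (intro continuous_open_preimage holomorphic_on_imp_continuous_on) auto
  moreover have "- {0} \<inter> ?h -` (- {0}) = {s. s \<noteq> 0 \<and> regular (X s) (Y s)}"
  proof (rule set_eqI)
    show "s \<in> - {0} \<inter> ?h -` (- {0}) \<longleftrightarrow> s \<in> {s. s \<noteq> 0 \<and> regular (X s) (Y s)}" for s
      using assms(3,4)[of s] by (cases "s = 0") (simp_all add: regular_def)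
  qed
  ultimately show ?thesis by (simp only:)
qed

text \<open>Moves an arbitrary pole by powers of \<open>p\<close> to the normal form at which the
  residues are known.\<close>

lemma jA_eq_0_imp:
  assumes "x \<noteq> 0" "jA x = 0"
  obtains i :: int where "(p powi i * x)\<^sup>2 = - (q powi (3 * n + 2))"
proof -
  obtain i where i: "- (q powi (n + 2)) * x\<^sup>2 = qD powi i"
    using assms jtheta_eq_0_iff[OF qD, of "- (q powi (n + 2)) * x\<^sup>2"] by (auto simp: jA_def)
  have x2: "x\<^sup>2 = - (qD powi i / q powi (n + 2))" unfolding i[symmetric] by simp
  have "(p powi (1 - i) * x)\<^sup>2 = (p * p) powi (1 - i) * x\<^sup>2"
    by (simp add: power2_eq_square power_int_mult_distrib)
  also have "\<dots> = - ((qD powi (1 - i) * qD powi i) / q powi (n + 2))"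
    unfolding p_square x2 by simp
  also have "qD powi (1 - i) * qD powi i = qD powi (1 - i + i)"
    by (rule power_int_add[symmetric]) simp
  also have "qD powi (1 - i + i) / q powi (n + 2) = q powi (4 * (n + 1) - (n + 2))"
    by (simp only: power_int_diff q0 simp_thms) simp
  also have "4 * (n + 1) - (n + 2) = 3 * n + 2" by simp
  finally show ?thesis by (rule that)
qed

lemma jtheta_minus_nonzero:
  assumes "w \<noteq> 0" "jtheta (w\<^sup>2) qD \<noteq> 0"
  shows "jtheta (- w) qD \<noteq> 0"
proof
  assume "jtheta (- w) qD = 0"
  then obtain i where "- w = qD powi i" using jtheta_eq_0_iff[OF qD, of "- w"] assms by auto
  hence "w\<^sup>2 = (qD powi i)\<^sup>2" by (metis power2_minus)
  also have "\<dots> = qD powi (i * 2)" by (simp only: power_int_mult power_int_numeral)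
  finally show False using jtheta_eq_0_iff[OF qD, of "w\<^sup>2"] assms by auto
qed

text \<open>The condition on w^2 keeps \<open>jA (w * k)\<close> nonzero, so the other half of g is
  regular at k and the two computed residues are the only singular contributions.\<close>

lemma tendsto_defect_pole:
  assumes "k\<^sup>2 = - (q powi (3 * n + 2))" "w \<noteq> 0" "jtheta (w\<^sup>2) qD \<noteq> 0" "jtheta (w powi n) Q \<noteq> 0"
  shows "((\<lambda>x. (x - k) * defect x (w * x)) \<longlongrightarrow> 0) (at k)"
proof -
  have k0: "k \<noteq> 0" using assms by auto
  have vl: "garg l x = k\<^sup>2 / x\<^sup>2" for x
    unfolding garg_l assms(1) by simp
  have v1: "((\<lambda>x. 1 - garg l x) \<longlongrightarrow> 0) (at k)"
  proof -
    have "((\<lambda>x. 1 - k\<^sup>2 / x\<^sup>2) \<longlongrightarrow> 1 - k\<^sup>2 / k\<^sup>2) (at k)"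
      using k0 by (intro tendsto_intros) auto
    thus ?thesis unfolding vl using k0 by simp
  qed
  have "isCont (\<lambda>x. hecke_f n (n + 2) n x (w * x) q) k"
    by (rule holomorphic_on_imp_isCont[where U = "- {0}"])
       (use k0 assms n_pos q_pos q_less in \<open>auto intro!: hecke_f_holomorphic holomorphic_intros\<close>)
  hence f: "((\<lambda>x. (1 - garg l x) * hecke_f n (n + 2) n x (w * x) q) \<longlongrightarrow> 0 * hecke_f n (n + 2) n k (w * k) q) (at k)"
    unfolding isCont_def by (intro tendsto_mult v1)
  have jw: "jA (w * k) \<noteq> 0"
  proof
    assume "jA (w * k) = 0"
    then obtain i where i: "- (q powi (n + 2)) * (w * k)\<^sup>2 = qD powi i"
      using k0 assms jtheta_eq_0_iff[OF qD, of "- (q powi (n + 2)) * (w * k)\<^sup>2"] by (auto simp: jA_def)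
    have "- (q powi (n + 2)) * (w * k)\<^sup>2 = q powi (n + 2 + (3 * n + 2)) * w\<^sup>2"
      unfolding power_mult_distrib assms(1) by (simp only: power_int_add q0 simp_thms) simp
    also have "n + 2 + (3 * n + 2) = 4 * (n + 1)" by simp
    finally have "w\<^sup>2 = qD powi i / qD" using i by (simp add: field_simps)
    also have "\<dots> = qD powi (i - 1)" by (simp add: power_int_diff)
    finally show False using jtheta_eq_0_iff[OF qD, of "w\<^sup>2"] assms by auto
  qed
  have "isCont (\<lambda>x. half_g (w * x) x) k"
  proof (rule holomorphic_on_imp_isCont)
    let ?U = "- {0} \<inter> (\<lambda>x. jA (w * x)) -` (- {0})"
    have "(\<lambda>x. jA (w * x)) holomorphic_on - {0}"
      using assms by (intro holomorphic_jA holomorphic_intros) auto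
    thus op: "open ?U"
      by (intro continuous_open_preimage holomorphic_on_imp_continuous_on) auto
    show "k \<in> ?U" using k0 jw by auto
    show "(\<lambda>x. half_g (w * x) x) holomorphic_on ?U"
      using assms op by (intro holomorphic_half_g) (auto intro!: holomorphic_intros)
  qed
  hence g: "((\<lambda>x. (1 - garg l x) * half_g (w * x) x) \<longlongrightarrow> 0 * half_g (w * k) k) (at k)"
    unfolding isCont_def by (intro tendsto_mult v1)
  let ?c = "gcoef l k (w * k) / jtheta (w powi n) Q"
  have "((\<lambda>x. (1 - garg l x) * hecke_f n (n + 2) n x (w * x) q - (1 - garg l x) * half_g x (w * x)
       - (1 - garg l x) * half_g (w * x) x + (1 - garg l x) * Theta_quot x (w * x)) \<longlongrightarrow>
       0 * hecke_f n (n + 2) n k (w * k) q - ?c - 0 * half_g (w * k) k + ?c) (at k)"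
    by (intro tendsto_add tendsto_diff f g half_g_pole Theta_quot_pole assms)
  hence main: "((\<lambda>x. (1 - garg l x) * defect x (w * x)) \<longlongrightarrow> 0) (at k)"
    by (simp add: defect_def algebra_simps)
  \<comment> \<open>Returns from the coordinate 1 - \<open>garg l x\<close> = (x + k)(x - k) / x^2
    to x - k.\<close>
  have "((\<lambda>x. (x\<^sup>2 / (x + k)) * ((1 - garg l x) * defect x (w * x))) \<longlongrightarrow> (k\<^sup>2 / (k + k)) * 0) (at k)"
    using k0 by (intro tendsto_mult main tendsto_intros) auto
  hence lim: "((\<lambda>x. (x\<^sup>2 / (x + k)) * ((1 - garg l x) * defect x (w * x))) \<longlongrightarrow> 0) (at k)" by simp
  have "\<forall>\<^sub>F x in at k. x \<in> - {0, - k} - {k}"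
    using k0 by (intro eventually_at_in_open) (auto simp: eq_neg_iff_add_eq_0)
  hence "\<forall>\<^sub>F x in at k. (x\<^sup>2 / (x + k)) * ((1 - garg l x) * defect x (w * x)) = (x - k) * defect x (w * x)"
  proof eventually_elim
    case (elim x)
    have "x + k \<noteq> 0" using elim by (auto simp: eq_neg_iff_add_eq_0)
    moreover have "1 - garg l x = (x + k) * (x - k) / x\<^sup>2"
      unfolding vl using elim by (simp add: field_simps power2_eq_square)
    ultimately show ?case using elim by simp
  qed
  from Lim_transform_eventually[OF lim this] show ?thesis .
qed

text \<open>Away from the excluded ratios the exceptional points are of three separate kinds: poles
  in x, poles in y, and zeros of the divisor \<open>T\<close>, where the zero of the difference
  compensates.\<close>

lemma defect_generic_zero:
  assumes w: "w \<noteq> 0" "jtheta (w\<^sup>2) qD \<noteq> 0" "jtheta (w powi n) Q \<noteq> 0"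
    and x: "x \<noteq> 0" "jA x \<noteq> 0" "jA (w * x) \<noteq> 0" "jtheta (w * x\<^sup>2 / q powi (3 * n + 2)) qD \<noteq> 0"
  shows "defect x (w * x) = 0"
proof -
  define c where "c = q powi (3 * n + 2)"
  have c0: "c \<noteq> 0" by (simp add: c_def)
  define T where "T = (\<lambda>x. jtheta (w * x\<^sup>2 / c) qD)"
  define H where "H = (\<lambda>x. jA x * jA (w * x) * T x)"
  define S where "S = (\<lambda>x. x\<^sup>2 * defect x (w * x) / T x)"
  have Thol: "T holomorphic_on - {0}"
    unfolding T_def using w c0 by (intro holomorphic_jtheta_compose[OF qD] holomorphic_intros) auto
  have Hhol: "H holomorphic_on - {0}"
    unfolding H_def using w by (intro holomorphic_on_mult holomorphic_jA Thol holomorphic_intros) auto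
  have Tsh: "T (p * z) = - T z / (w * z\<^sup>2 / c)" if "z \<noteq> 0" for z
  proof -
    have "w * (p * z)\<^sup>2 / c = qD * (w * z\<^sup>2 / c)"
      unfolding p_square[symmetric] by (simp add: power2_eq_square)
    moreover have "jtheta (qD * (w * z\<^sup>2 / c)) qD = - jtheta (w * z\<^sup>2 / c) qD / (w * z\<^sup>2 / c)"
      using w c0 that by (intro jtheta_shift[OF qD]) auto
    ultimately show ?thesis unfolding T_def by (simp only:)
  qed
  have jsh: "jA (w * (p * z)) = jA (w * z) / (q powi (n + 2) * (w * z)\<^sup>2)" if "z \<noteq> 0" for z
    using jA_shift[of "w * z"] w that by (simp add: mult.left_commute)
  have Hiff: "H (p * z) = 0 \<longleftrightarrow> H z = 0" if "z \<noteq> 0" for z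
    unfolding H_def Tsh[OF that] jA_shift[OF that] jsh[OF that] using that w c0 by simp
  have reg: "regular z (w * z)" if "z \<noteq> 0" "H z \<noteq> 0" for z
    using that w by (auto simp: regular_def H_def)
  have Uop: "open {z. z \<noteq> 0 \<and> H z \<noteq> 0}"
  proof -
    have "open (- {0} \<inter> H -` (- {0}))"
      by (intro continuous_open_preimage holomorphic_on_imp_continuous_on Hhol) auto
    moreover have "- {0} \<inter> H -` (- {0}) = {z. z \<noteq> 0 \<and> H z \<noteq> 0}" by auto
    ultimately show ?thesis by simp
  qed
  \<comment> \<open>At a normalised pole in x or in y the argument of \<open>T\<close> is -w or -1 /
    w. These two facts keep the zeros of \<open>T\<close> apart from both kinds of poles.\<close>
  have Tm: "jtheta (- w) qD \<noteq> 0" by (rule jtheta_minus_nonzero[OF w(1,2)])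
  have Tm': "jtheta (- 1 / w) qD \<noteq> 0"
    using jtheta_inverse[OF qD, of "- w"] Tm w by simp
  have Tcont: "isCont T z" if "z \<noteq> 0" for z
    by (rule holomorphic_on_imp_isCont[OF Thol]) (use that in auto)
  have fin: "((\<lambda>u. (u - k) * S u) \<longlongrightarrow> 0) (at k)"
    if "k \<noteq> 0" "T k \<noteq> 0" "((\<lambda>u. (u - k) * defect u (w * u)) \<longlongrightarrow> 0) (at k)" for k
  proof -
    have "((\<lambda>u. u\<^sup>2 / T u * ((u - k) * defect u (w * u))) \<longlongrightarrow> k\<^sup>2 / T k * 0) (at k)"
      using Tcont[OF that(1)] that unfolding isCont_def by (intro tendsto_intros) auto
    thus ?thesis by (simp add: S_def mult_ac)
  qed
  have "S x = 0"
  proof (rule quasi_periodic_zero[OF p, where S = S and x = x and H = H and c = "- 1" and ?z0.0 = x])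
    show "S holomorphic_on {z. z \<noteq> 0 \<and> H z \<noteq> 0}"
      unfolding S_def using reg w
      by (intro holomorphic_on_divide holomorphic_on_mult holomorphic_defect[OF Uop] holomorphic_on_subset[OF Thol])
         (auto simp: H_def intro!: holomorphic_intros)
    show "H (p * z) \<noteq> 0 \<and> S (p * z) = - 1 * S z" if z: "z \<noteq> 0" "H z \<noteq> 0" for z
    proof
      show "H (p * z) \<noteq> 0" using z Hiff by simp
      have "q powi (n + 2) * z * (w * z) * defect (p * z) (p * (w * z)) = defect z (w * z)"
        by (rule defect_shift[OF reg[OF z]])
      hence e: "defect (p * z) (w * (p * z)) = defect z (w * z) / (q powi (n + 2) * z * (w * z))"
        using z w by (simp add: field_simps)
      have "q powi (n + 2) * c = q powi (n + 2 + (3 * n + 2))"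
        unfolding c_def by (simp only: power_int_add q0 simp_thms)
      also have "n + 2 + (3 * n + 2) = 4 * (n + 1)" by simp
      finally have pc: "p * p = q powi (n + 2) * c" by (simp only: p_square)
      \<comment> \<open>The constant in front becomes -1 by \<open>pc\<close>; the p * p stems from
        the factor x^2 in \<open>S\<close>.\<close>
      have "S (p * z) = - (p * p) / (q powi (n + 2) * c) * (z\<^sup>2 * defect z (w * z) / T z)"
        unfolding S_def e Tsh[OF z(1)] using z w c0 by (simp add: field_simps power2_eq_square)
      thus "S (p * z) = - 1 * S z" unfolding pc S_def using c0 by simp
    qed
    show "H (p * z) = 0" if "z \<noteq> 0" "H z = 0" for z
      using that Hiff by simp
    show "\<exists>i::int. ((\<lambda>u. (u - p powi i * z) * S u) \<longlongrightarrow> 0) (at (p powi i * z))" if z: "z \<noteq> 0" "H z = 0" for z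
    proof -
      consider "jA z = 0" | "jA (w * z) = 0" | "T z = 0" using z(2) by (auto simp: H_def)
      thus ?thesis
      proof cases
        case 1
        then obtain i where i: "(p powi i * z)\<^sup>2 = - c"
          using jA_eq_0_imp[OF z(1)] unfolding c_def by blast
        let ?k = "p powi i * z"
        have "T ?k \<noteq> 0" unfolding T_def i using Tm c0 by simp
        thus ?thesis using z
          by (intro exI[of _ i] fin tendsto_defect_pole w) (use i in \<open>auto simp: c_def\<close>)
      next
        case 2
        then obtain i where "(p powi i * (w * z))\<^sup>2 = - c"
          using jA_eq_0_imp[of "w * z"] w z unfolding c_def by auto
        moreover define k where "k = p powi i * z"
        ultimately have wk: "(w * k)\<^sup>2 = - c" by (simp add: mult_ac)
        have k0: "k \<noteq> 0" using z by (simp add: k_def)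
        have "w * k\<^sup>2 / c = - 1 / w"
        proof -
          have "w * k\<^sup>2 / c = (w * k)\<^sup>2 / (w * c)" using w by (simp add: power2_eq_square)
          thus ?thesis unfolding wk using c0 by simp
        qed
        hence Tk: "T k \<noteq> 0" unfolding T_def using Tm' by simp
        \<comment> \<open>A pole in y is a pole in the first variable once the roles are exchanged,
          which replaces the ratio w by 1 / w.\<close>
        have w': "1 / w \<noteq> 0" "jtheta ((1 / w)\<^sup>2) qD \<noteq> 0" "jtheta ((1 / w) powi n) Q \<noteq> 0"
          using w jtheta_inverse[OF qD, of "w\<^sup>2"] jtheta_inverse[OF Q, of "w powi n"]
          by (auto simp: power_divide power_int_divide_distrib)
        have "((\<lambda>X. (X - w * k) * defect X (1 / w * X)) \<longlongrightarrow> 0) (at (w * k))"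
          by (rule tendsto_defect_pole[OF _ w']) (use wk in \<open>simp add: c_def\<close>)
        moreover have "filterlim (\<lambda>u. w * u) (at (w * k)) (at k)"
        proof (rule filterlim_atI)
          show "((\<lambda>u. w * u) \<longlongrightarrow> w * k) (at k)" by (intro tendsto_intros)
          show "\<forall>\<^sub>F u in at k. w * u \<noteq> w * k"
            using w by (auto simp: eventually_at_filter)
        qed
        ultimately have "((\<lambda>u. (w * u - w * k) * defect (w * u) (1 / w * (w * u))) \<longlongrightarrow> 0) (at k)"
          by (rule filterlim_compose)
        hence "((\<lambda>u. 1 / w * ((w * u - w * k) * defect (w * u) (1 / w * (w * u)))) \<longlongrightarrow> 1 / w * 0) (at k)"
          by (intro tendsto_mult tendsto_const)
        hence lim: "((\<lambda>u. 1 / w * ((w * u - w * k) * defect (w * u) (1 / w * (w * u)))) \<longlongrightarrow> 0) (at k)"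
          by simp
        have "\<forall>\<^sub>F u in at k. u \<in> - {0} - {k}"
          using k0 by (intro eventually_at_in_open) auto
        hence "\<forall>\<^sub>F u in at k. 1 / w * ((w * u - w * k) * defect (w * u) (1 / w * (w * u))) = (u - k) * defect u (w * u)"
        proof eventually_elim
          case (elim u)
          have "defect (w * u) (1 / w * (w * u)) = defect u (w * u)"
            using defect_sym[of u "w * u"] elim w by simp
          thus ?case using w by (simp add: right_diff_distrib[symmetric])
        qed
        from Lim_transform_eventually[OF lim this]
        have "((\<lambda>u. (u - k) * S u) \<longlongrightarrow> 0) (at k)" using k0 Tk by (intro fin)
        thus ?thesis unfolding k_def by blast
      next
        case 3
        then obtain i where i: "w * z\<^sup>2 / c = qD powi i"
          using jtheta_eq_0_iff[OF qD, of "w * z\<^sup>2 / c"] w z c0 unfolding T_def by auto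
        \<comment> \<open>The translate with w k^2 = c, that is x y = q^(3n+2), where
          \<open>defect_zero\<close> applies.\<close>
        define k where "k = p powi (- i) * z"
        have k0: "k \<noteq> 0" using z by (simp add: k_def)
        have wk: "w * k\<^sup>2 = c"
        proof -
          have "w * k\<^sup>2 / c = (p * p) powi (- i) * (w * z\<^sup>2 / c)"
            unfolding k_def by (simp add: power2_eq_square power_int_mult_distrib)
          also have "\<dots> = 1" unfolding i p_square by (simp add: power_int_minus)
          finally show ?thesis using c0 by simp
        qed
        have k2: "k\<^sup>2 = c / w" using wk w by (simp add: field_simps)
        have pc: "q powi (n + 2) * c = qD"
        proof -
          have "q powi (n + 2) * c = q powi (n + 2 + (3 * n + 2))"
            unfolding c_def by (simp only: power_int_add q0 simp_thms)
          also have "n + 2 + (3 * n + 2) = 4 * (n + 1)" by simp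
          finally show ?thesis .
        qed
        have a1: "jA k \<noteq> 0"
        proof -
          have "- (q powi (n + 2)) * k\<^sup>2 = qD * (- 1 / w)" unfolding k2 pc[symmetric] by simp
          hence "jA k = - jtheta (- 1 / w) qD / (- 1 / w)"
            unfolding jA_def using jtheta_shift[OF qD, of "- 1 / w"] w by (simp only:) simp
          thus ?thesis using Tm' w by simp
        qed
        have a2: "jA (w * k) \<noteq> 0"
        proof -
          have "- (q powi (n + 2)) * (w * k)\<^sup>2 = qD * (- w)"
            unfolding power_mult_distrib k2 pc[symmetric] using w by (simp add: power2_eq_square)
          hence "jA (w * k) = - jtheta (- w) qD / (- w)"
            unfolding jA_def using jtheta_shift[OF qD, of "- w"] w by (simp only:) simp
          thus ?thesis using Tm w by simp
        qed
        have Ek: "((\<lambda>u. defect u (w * u)) \<longlongrightarrow> 0) (at k)"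
        proof -
          let ?U = "{s. s \<noteq> 0 \<and> regular s (w * s)}"
          have op: "open ?U"
            using open_regular[of "\<lambda>s. s" "\<lambda>s. w * s"] w by (auto intro!: holomorphic_intros)
          have "(\<lambda>u. defect u (w * u)) holomorphic_on ?U"
            by (rule holomorphic_defect[OF op]) (auto intro!: holomorphic_intros)
          moreover have "k \<in> ?U" using k0 a1 a2 w by (auto simp: regular_def)
          ultimately have "isCont (\<lambda>u. defect u (w * u)) k" using op holomorphic_on_imp_isCont by blast
          moreover have "defect k (w * k) = 0"
            using defect_zero[of k "w * k"] k0 w wk by (simp add: c_def power2_eq_square mult_ac)
          ultimately show ?thesis by (simp add: isCont_def)
        qed
        let ?P3 = "qpoch_inf qD qD ^ 3"
        have P30: "?P3 \<noteq> 0" using qpoch_inf_self_nonzero[OF qD(2)] by simp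
        \<comment> \<open>Since w k^2 = c, the quotient u^2 / k^2 is the argument of
          \<open>T\<close>, and it approaches the simple zero of theta at 1.\<close>
        have "filterlim (\<lambda>u. u\<^sup>2 / k\<^sup>2) (at 1) (at k)"
        proof (rule filterlim_atI)
          have "((\<lambda>u. u\<^sup>2 / k\<^sup>2) \<longlongrightarrow> k\<^sup>2 / k\<^sup>2) (at k)" using k0 by (intro tendsto_intros) auto
          thus "((\<lambda>u. u\<^sup>2 / k\<^sup>2) \<longlongrightarrow> 1) (at k)" using k0 by simp
          have "\<forall>\<^sub>F u in at k. u \<in> - {- k} - {k}"
            using k0 by (intro eventually_at_in_open) (auto simp: eq_neg_iff_add_eq_0)
          thus "\<forall>\<^sub>F u in at k. u\<^sup>2 / k\<^sup>2 \<noteq> 1"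
            by eventually_elim (use k0 in \<open>auto simp: power2_eq_iff\<close>)
        qed
        from filterlim_compose[OF tendsto_jtheta_div[OF qD] this]
        have "((\<lambda>u. u\<^sup>2 * defect u (w * u) * (- (k\<^sup>2) / (u + k)) / (jtheta (u\<^sup>2 / k\<^sup>2) qD / (1 - u\<^sup>2 / k\<^sup>2))) \<longlongrightarrow>
            k\<^sup>2 * 0 * (- (k\<^sup>2) / (k + k)) / ?P3) (at k)"
          using k0 P30 by (intro tendsto_divide tendsto_mult Ek tendsto_intros) auto
        hence lim: "((\<lambda>u. u\<^sup>2 * defect u (w * u) * (- (k\<^sup>2) / (u + k)) / (jtheta (u\<^sup>2 / k\<^sup>2) qD / (1 - u\<^sup>2 / k\<^sup>2))) \<longlongrightarrow> 0) (at k)"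
          by simp
        have "\<forall>\<^sub>F u in at k. u \<in> - {- k} - {k}"
          using k0 by (intro eventually_at_in_open) (auto simp: eq_neg_iff_add_eq_0)
        hence "\<forall>\<^sub>F u in at k. u\<^sup>2 * defect u (w * u) * (- (k\<^sup>2) / (u + k)) / (jtheta (u\<^sup>2 / k\<^sup>2) qD / (1 - u\<^sup>2 / k\<^sup>2)) = (u - k) * S u"
        proof eventually_elim
          case (elim u)
          have "u + k \<noteq> 0" using elim by (auto simp: eq_neg_iff_add_eq_0)
          moreover have "1 - u\<^sup>2 / k\<^sup>2 = - ((u - k) * (u + k)) / k\<^sup>2"
            using k0 by (simp add: field_simps power2_eq_square)
          moreover have "w * u\<^sup>2 / c = u\<^sup>2 / k\<^sup>2" unfolding k2 using w c0 by simp
          ultimately show ?case unfolding S_def T_def using k0 by simp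
        qed
        from Lim_transform_eventually[OF lim this] show ?thesis unfolding k_def by blast
      qed
    qed
  qed (use Hhol x in \<open>auto simp: H_def T_def c_def\<close>)
  thus ?thesis using x unfolding S_def T_def c_def by simp
qed

text \<open>With x fixed, the second variable s moves the ratio s / x. Excluded ratios and zeros of
  the divisor are isolated in s, so the difference vanishes near y and by continuity at y.\<close>

lemma defect_eq_0:
  assumes "regular x y"
  shows "defect x y = 0"
proof -
  from assms have r: "x \<noteq> 0" "y \<noteq> 0" "jA x \<noteq> 0" "jA y \<noteq> 0" "jtheta ((y / x) powi n) Q \<noteq> 0"
    by (auto simp: regular_def)
  let ?U = "{s. s \<noteq> 0 \<and> regular x s}"
  have op: "open ?U"
    using open_regular[of "\<lambda>s. x" "\<lambda>s. s"] r by (auto intro!: holomorphic_intros)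
  have "(\<lambda>s. defect x s) holomorphic_on ?U"
    by (rule holomorphic_defect[OF op]) (auto intro!: holomorphic_intros)
  moreover have yU: "y \<in> ?U" using assms r by auto
  ultimately have "isCont (defect x) y" using op holomorphic_on_imp_isCont by blast
  hence lim: "defect x \<midarrow>y\<rightarrow> defect x y" by (simp add: isCont_def)
  \<comment> \<open>The witnesses here and in \<open>e2\<close> make the theta argument equal to -1,
    where theta does not vanish.\<close>
  have e1: "\<forall>\<^sub>F s in at y. jtheta ((s / x)\<^sup>2) qD \<noteq> 0"
    by (rule eventually_jtheta_nonzero[OF qD, where ?z0.0 = "\<i> * x"]) (use r in \<open>auto intro!: holomorphic_intros\<close>)
  have e2: "\<forall>\<^sub>F s in at y. jtheta (x * s / q powi (3 * n + 2)) qD \<noteq> 0"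
    by (rule eventually_jtheta_nonzero[OF qD, where ?z0.0 = "- (q powi (3 * n + 2)) / x"]) (use r in \<open>auto intro!: holomorphic_intros\<close>)
  have e3: "\<forall>\<^sub>F s in at y. s \<in> ?U - {y}"
    using op yU by (intro eventually_at_in_open) auto
  from e1 e2 e3 have "\<forall>\<^sub>F s in at y. defect x s = 0"
  proof eventually_elim
    case (elim s)
    have s: "s = s / x * x" using r by simp
    have t: "s / x * x\<^sup>2 = x * s" using r by (simp add: power2_eq_square)
    have "jtheta (s / x * x\<^sup>2 / q powi (3 * n + 2)) qD \<noteq> 0" unfolding t using elim(2) .
    hence "defect x (s / x * x) = 0"
      using elim r by (intro defect_generic_zero) (auto simp: regular_def)
    thus ?case by (simp only: s[symmetric])
  qed
  from Lim_transform_eventually[OF lim this] show ?thesis by (simp add: tendsto_const_iff)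
qed

end

theorem theorem0p12:
  fixes q x y :: complex and n :: int
  assumes "0 < norm q" and "norm q < 1"
    and "n > 0" and "odd n"
    and "x \<noteq> 0" and "y \<noteq> 0"
    and "appell_g_no_pole n (n + 2) n x y q (y powi n / x powi n) (x powi n / y powi n)"
    and "Theta_n2_no_pole n x y q"
  shows "hecke_f n (n + 2) n x y q =
    appell_g n (n + 2) n x y q (y powi n / x powi n) (x powi n / y powi n) - Theta_n2 n x y q"
proof -
  obtain l where l: "n = 2 * l + 1" using \<open>odd n\<close> by (auto elim: oddE)
  interpret hecke_n2 q n l
    using assms l by unfold_locales auto
  have "regular x y"
    using assms(5,6,8) by (simp add: regular_def Theta_n2_no_pole_def jA_def power_int_divide_distrib)
  from defect_eq_0[OF this] show ?thesis
    unfolding appell_g_eq[OF assms(5,6)] Theta_n2_eq by (simp add: defect_def algebra_simps)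
qed

end
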